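(* Let $D_1,D_2\subseteq\mathbb{R}^d$ be domains with $d\geq 1$ and let $\mathscr{F}:L^2(D_1)\to L^2(D_2)$ be a Hilbert--Schmidt operator with singular values $\sigma_1\ge\sigma_2\ge\cdots\ge 0$ and right singular functions $v_1,v_2,\ldots\in L^2(D_1)$. Let $K:D_1\times D_1\to\mathbb{R}$ be a continuous symmetric positive definite kernel with eigenvalues $\lambda_1\ge\lambda_2\ge\cdots>0$. Select a target rank $k\geq 1$ and an oversampling parameter $p\geq 2$, and let $\mathbf{\Omega}=[\omega_1|\cdots|\omega_{k+p}]$ be a $D_1\times(k+p)$ quasimatrix whose columns are i.i.d. and drawn from $\mathcal{GP}(0,K)$. Let $\mathbf{Y}=\mathscr{F}\mathbf{\Omega}=[\mathscr{F}\omega_1|\cdots|\mathscr{F}\omega_{k+p}]$ and let $\mathbf{P}_{\mathbf{Y}}$ be the orthogonal projection onto the vector space spanned by the columns of $\mathbf{Y}$. Define the $k\times k$ matrix $\mathbf{C}$ by $$\mathbf{C}_{ij}=\int_{D_1\times D_1}v_i(x)K(x,y)v_j(y)\,dx\,dy,\quad 1\le i,j\le k,\qquad \gamma_k=\frac{k}{\lambda_1\operatorname{Tr}(\mathbf{C}^{-1})}.$$ Then $$\mathbb{E}\left[\|\mathscr{F}-\mathbf{P}_{\mathbf{Y}}\mathscr{F}\|_{\mathrm{HS}}\right]\leq\left(1+\sqrt{\frac{1}{\gamma_k}\frac{k(k+p)}{p-1}}\right)\left(\sum_{j=k+1}^\infty\sigma_j^2\right)^{1/2}.$$ Assume further that $p\geq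 4$. Then for any $s,t\geq 1$, $$\|\mathscr{F}-\mathbf{P}_{\mathbf{Y}}\mathscr{F}\|_{\mathrm{HS}}\leq\sqrt{1+t^2s^2\frac{3}{\gamma_k}\frac{k(k+p)}{p+1}\sum_{j=1}^\infty\frac{\lambda_j}{\lambda_1}}\left(\sum_{j=k+1}^\infty\sigma_j^2\right)^{1/2}$$ with probability at least $1-t^{-p}-[s e^{-(s^2-1)/2}]^{k+p}$.
   Context: A $D_1\times \ell$ quasimatrix is an ordered list of $\ell$ functions in $L^2(D_1)$, viewed as the columns of a matrix. $\|\cdot\|_{\mathrm{HS}}$ is the Hilbert--Schmidt norm. The singular value decomposition of $\mathscr{F}$ is $\mathscr{F}f=\sum_j\sigma_j\langle v_j,f\rangle u_j$ with $\{v_j\}$ orthonormal in $L^2(D_1)$ and $\{u_j\}$ orthonormal in $L^2(D_2)$. Standing assumptions on the kernel: the continuous symmetric positive definite kernel $K$ has a Mercer expansion $K(x,y)=\sum_{j\ge1}\lambda_j\psi_j(x)\psi_j(y)$ (absolutely and uniformly convergent), where $\{\psi_j\}$ is an orthonormal basis of $L^2(D_1)$ of eigenfunctions of the integral operator with kernel $K$, all eigenvalues $\lambda_j$ are strictly positive, and $\operatorname{Tr}(K)=\sum_j\lambda_j<\infty$. A function $\omega\sim\mathcal{GP}(0,K)$ is a sample of the centered Gaussian process with covariance kernel $K$, equivalently $\omega=\sum_{j\ge1}\sqrt{\lambda_j}\,c_j\psi_j$ with $c_j$ i.i.d. standard Gaussian random variables. *)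

theory Defs
  imports "HOL-Probability.Probability" "Jordan_Normal_Form.Gauss_Jordan_Elimination"
begin

text \<open>Elements of \<open>L\<^sup>2(M)\<close> are represented by functions, so equality in \<open>L\<^sup>2(M)\<close> is equality almost
  everywhere and \<open>L2_norm\<close> is a seminorm on the representatives.\<close>

definition L2_space :: "'a measure \<Rightarrow> ('a \<Rightarrow> real) set" where
  "L2_space M = {f \<in> borel_measurable M. integrable M (\<lambda>x. (f x)\<^sup>2)}"

definition L2_inner :: "'a measure \<Rightarrow> ('a \<Rightarrow> real) \<Rightarrow> ('a \<Rightarrow> real) \<Rightarrow> real" where
  "L2_inner M f g = (\<integral>x. f x * g x \<partial>M)"

definition L2_norm :: "'a measure \<Rightarrow> ('a \<Rightarrow> real) \<Rightarrow> real" where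
  "L2_norm M f = sqrt (L2_inner M f f)"

definition L2_eq :: "'a measure \<Rightarrow> ('a \<Rightarrow> real) \<Rightarrow> ('a \<Rightarrow> real) \<Rightarrow> bool" where
  "L2_eq M f g \<longleftrightarrow> (AE x in M. f x = g x)"

definition L2_sums :: "'a measure \<Rightarrow> (nat \<Rightarrow> 'a \<Rightarrow> real) \<Rightarrow> ('a \<Rightarrow> real) \<Rightarrow> bool" where
  "L2_sums M g f \<longleftrightarrow> (\<lambda>n. L2_norm M (\<lambda>x. f x - (\<Sum>j<n. g j x))) \<longlonglongrightarrow> 0"

definition L2_orthonormal :: "'a measure \<Rightarrow> (nat \<Rightarrow> 'a \<Rightarrow> real) \<Rightarrow> bool" where
  "L2_orthonormal M e \<longleftrightarrow> (\<forall>j. e j \<in> L2_space M) \<and>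
     (\<forall>i j. L2_inner M (e i) (e j) = (if i = j then 1 else 0))"

definition L2_basis :: "'a measure \<Rightarrow> (nat \<Rightarrow> 'a \<Rightarrow> real) \<Rightarrow> bool" where
  "L2_basis M e \<longleftrightarrow> L2_orthonormal M e \<and>
     (\<forall>f \<in> L2_space M. L2_sums M (\<lambda>j x. L2_inner M (e j) f * e j x) f)"

definition L2_operator ::
  "'a measure \<Rightarrow> 'b measure \<Rightarrow> (('a \<Rightarrow> real) \<Rightarrow> ('b \<Rightarrow> real)) \<Rightarrow> bool" where
  "L2_operator M N A \<longleftrightarrow>
     (\<forall>f \<in> L2_space M. A f \<in> L2_space N) \<and>
     (\<forall>f \<in> L2_space M. \<forall>g \<in> L2_space M. L2_eq M f g \<longrightarrow> L2_eq N (A f) (A g)) \<and>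
     (\<forall>f \<in> L2_space M. \<forall>g \<in> L2_space M.
        L2_eq N (A (\<lambda>x. f x + g x)) (\<lambda>y. A f y + A g y)) \<and>
     (\<forall>f \<in> L2_space M. \<forall>c. L2_eq N (A (\<lambda>x. c * f x)) (\<lambda>y. c * A f y)) \<and>
     (\<exists>B. \<forall>f \<in> L2_space M. L2_norm N (A f) \<le> B * L2_norm M f)"

definition hilbert_schmidt ::
  "'a measure \<Rightarrow> 'b measure \<Rightarrow> (('a \<Rightarrow> real) \<Rightarrow> ('b \<Rightarrow> real)) \<Rightarrow> bool" where
  "hilbert_schmidt M N A \<longleftrightarrow> L2_operator M N A \<and>
     (\<exists>e. L2_basis M e \<and> summable (\<lambda>j. (L2_norm N (A (e j)))\<^sup>2))"

text \<open>The sum does not depend on the orthonormal basis, so an arbitrary one is chosen.\<close>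

definition hs_norm ::
  "'a measure \<Rightarrow> 'b measure \<Rightarrow> (('a \<Rightarrow> real) \<Rightarrow> ('b \<Rightarrow> real)) \<Rightarrow> real" where
  "hs_norm M N A = (let e = (SOME e. L2_basis M e) in sqrt (\<Sum>j. (L2_norm N (A (e j)))\<^sup>2))"

text \<open>All sequences are indexed from 0, so \<open>\<sigma> j\<close> is the \<open>(j+1)\<close>-st singular value. An operator of
  finite rank is padded with zero singular values.\<close>

definition is_svd ::
  "'a measure \<Rightarrow> 'b measure \<Rightarrow> (('a \<Rightarrow> real) \<Rightarrow> ('b \<Rightarrow> real)) \<Rightarrow>
   (nat \<Rightarrow> real) \<Rightarrow> (nat \<Rightarrow> 'b \<Rightarrow> real) \<Rightarrow> (nat \<Rightarrow> 'a \<Rightarrow> real) \<Rightarrow> bool" where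
  "is_svd M N A \<sigma> u v \<longleftrightarrow>
     decseq \<sigma> \<and> (\<forall>j. 0 \<le> \<sigma> j) \<and> L2_orthonormal M v \<and> L2_orthonormal N u \<and>
     (\<forall>f \<in> L2_space M. L2_sums N (\<lambda>j y. \<sigma> j * L2_inner M (v j) f * u j y) (A f))"

text \<open>A quasimatrix with \<open>l\<close> columns is a family of functions of which the members with index
  \<open>< l\<close> are used.\<close>

definition col_span :: "nat \<Rightarrow> (nat \<Rightarrow> 'a \<Rightarrow> real) \<Rightarrow> ('a \<Rightarrow> real) set" where
  "col_span l Y = {h. \<exists>a. h = (\<lambda>x. \<Sum>i<l. a i * Y i x)}"

text \<open>For finite-dimensional \<open>V\<close> the projection exists and is unique up to equality almost
  everywhere.\<close>

definition orth_proj :: "'a measure \<Rightarrow> ('a \<Rightarrow> real) set \<Rightarrow> ('a \<Rightarrow> real) \<Rightarrow> ('a \<Rightarrow> real)" where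
  "orth_proj M V f = (SOME g. g \<in> V \<and> (\<forall>h \<in> V. L2_inner M (\<lambda>x. f x - g x) h = 0))"

definition range_residual ::
  "'b measure \<Rightarrow> (('a \<Rightarrow> real) \<Rightarrow> ('b \<Rightarrow> real)) \<Rightarrow> nat \<Rightarrow> (nat \<Rightarrow> 'b \<Rightarrow> real) \<Rightarrow>
   ('a \<Rightarrow> real) \<Rightarrow> ('b \<Rightarrow> real)" where
  "range_residual N A l Y = (\<lambda>f y. A f y - orth_proj N (col_span l Y) (A f) y)"

definition sym_pos_def_kernel :: "'a set \<Rightarrow> ('a \<Rightarrow> 'a \<Rightarrow> real) \<Rightarrow> bool" where
  "sym_pos_def_kernel D K \<longleftrightarrow>
     (\<forall>x \<in> D. \<forall>y \<in> D. K x y = K y x) \<and>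
     (\<forall>S a. finite S \<and> S \<subseteq> D \<longrightarrow> (\<Sum>x\<in>S. \<Sum>y\<in>S. a x * a y * K x y) \<ge> 0)"

definition mercer_expansion ::
  "'a::euclidean_space set \<Rightarrow> ('a \<Rightarrow> 'a \<Rightarrow> real) \<Rightarrow> (nat \<Rightarrow> real) \<Rightarrow> (nat \<Rightarrow> 'a \<Rightarrow> real) \<Rightarrow> bool" where
  "mercer_expansion D K lam \<psi> \<longleftrightarrow>
     decseq lam \<and> (\<forall>j. 0 < lam j) \<and> summable lam \<and>
     L2_basis (lebesgue_on D) \<psi> \<and>
     (\<forall>j. L2_eq (lebesgue_on D)
        (\<lambda>x. \<integral>y. K x y * \<psi> j y \<partial>lebesgue_on D) (\<lambda>x. lam j * \<psi> j x)) \<and>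
     (\<forall>x \<in> D. \<forall>y \<in> D. summable (\<lambda>j. \<bar>lam j * \<psi> j x * \<psi> j y\<bar>)) \<and>
     uniform_limit (D \<times> D) (\<lambda>n (x, y). \<Sum>j<n. lam j * \<psi> j x * \<psi> j y) (\<lambda>(x, y). K x y)
       sequentially"

text \<open>The case of variance 0 is the point mass at 0, for which \<open>normal_density\<close> is not a density.\<close>

definition centered_gaussian :: "'w measure \<Rightarrow> ('w \<Rightarrow> real) \<Rightarrow> real \<Rightarrow> bool" where
  "centered_gaussian P X var \<longleftrightarrow>
     X \<in> borel_measurable P \<and>
     (if var = 0 then (AE w in P. X w = 0)
      else 0 < var \<and> distributed P lborel X (normal_density 0 (sqrt var)))"

text \<open>The finite-dimensional marginals are multivariate Gaussian with covariance matrix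
  \<open>K(x\<^sub>i,x\<^sub>j)\<close>: every linear combination of the values at finitely many points is Gaussian with
  the corresponding variance. Samples are functions in \<open>L\<^sup>2(D)\<close>, and joint measurability makes the
  sample a random element of \<open>L\<^sup>2(D)\<close>.\<close>

definition gaussian_process ::
  "'w measure \<Rightarrow> 'a::euclidean_space set \<Rightarrow> ('a \<Rightarrow> 'a \<Rightarrow> real) \<Rightarrow> ('w \<Rightarrow> 'a \<Rightarrow> real) \<Rightarrow> bool" where
  "gaussian_process P D K X \<longleftrightarrow>
     (\<lambda>(w, x). X w x) \<in> borel_measurable (P \<Otimes>\<^sub>M lebesgue_on D) \<and>
     (\<forall>w \<in> space P. X w \<in> L2_space (lebesgue_on D)) \<and>
     (\<forall>S a. finite S \<and> S \<subseteq> D \<longrightarrow>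
        centered_gaussian P (\<lambda>w. \<Sum>x\<in>S. a x * X w x) (\<Sum>x\<in>S. \<Sum>y\<in>S. a x * a y * K x y))"

text \<open>Identical distribution is part of the first conjunct, since the finite-dimensional marginals
  determine the law of a process on the product sigma-algebra.\<close>

definition iid_gaussian_processes ::
  "'w measure \<Rightarrow> 'a::euclidean_space set \<Rightarrow> ('a \<Rightarrow> 'a \<Rightarrow> real) \<Rightarrow> nat \<Rightarrow>
   (nat \<Rightarrow> 'w \<Rightarrow> 'a \<Rightarrow> real) \<Rightarrow> bool" where
  "iid_gaussian_processes P D K l \<omega> \<longleftrightarrow>
     (\<forall>i<l. gaussian_process P D K (\<omega> i)) \<and>
     prob_space.indep_vars P (\<lambda>_. PiM D (\<lambda>_. borel)) (\<lambda>i w. restrict (\<omega> i w) D) {..<l}"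

definition kernel_matrix ::
  "'a::euclidean_space set \<Rightarrow> ('a \<Rightarrow> 'a \<Rightarrow> real) \<Rightarrow> (nat \<Rightarrow> 'a \<Rightarrow> real) \<Rightarrow> nat \<Rightarrow> real mat" where
  "kernel_matrix D K v k = mat k k (\<lambda>(i, j).
     \<integral>(x, y). v i x * K x y * v j y \<partial>(lebesgue_on D \<Otimes>\<^sub>M lebesgue_on D))"

definition mat_trace :: "real mat \<Rightarrow> real" where
  "mat_trace A = (\<Sum>i<dim_row A. A $$ (i, i))"

definition quality_factor ::
  "'a::euclidean_space set \<Rightarrow> ('a \<Rightarrow> 'a \<Rightarrow> real) \<Rightarrow> (nat \<Rightarrow> real) \<Rightarrow> (nat \<Rightarrow> 'a \<Rightarrow> real) \<Rightarrow>
   nat \<Rightarrow> real" where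
  "quality_factor D K lam v k =
     real k / (lam 0 * mat_trace (the (mat_inverse (kernel_matrix D K v k))))"

end

theory Submission
  imports Defs "Jordan_Normal_Form.Determinant"
begin

text \<open>
  Write \<open>x\<^sub>m\<^sub>i = \<langle>v\<^sub>m, \<omega>\<^sub>i\<rangle>\<close> and \<open>l = k + p\<close>. If \<open>T\<close> is a right inverse of the \<open>k \<times> l\<close> matrix of the \<open>x\<^sub>m\<^sub>i\<close> with
  \<open>m < k\<close>, then approximating \<open>F e\<close> by \<open>\<Sum>\<^sub>i (\<Sum>\<^sub>j \<langle>v\<^sub>j, e\<rangle> T\<^sub>i\<^sub>j) F \<omega>\<^sub>i\<close> for every member \<open>e\<close> of an orthonormal basis gives
  \<open>err\<^sup>2 \<le> \<tau>\<^sup>2 + A R\<close>, where \<open>\<tau>\<^sup>2\<close> is the tail of the \<open>\<sigma>\<^sub>m\<^sup>2\<close>, \<open>A = \<Sum>\<^sub>m \<sigma>\<^sub>m\<^sup>2 \<Sum>\<^sub>i x\<^sub>m\<^sub>i\<^sup>2\<close> over \<open>m \<ge> k\<close>, and \<open>R\<close> is the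
  squared Frobenius norm of \<open>T\<close>. For the optimal \<open>T\<close>, \<open>R\<close> is the sum of the inverse squared distances of each row
  from the span of the other rows. The factors \<open>A\<close> and \<open>R\<close> are dependent, so expectations are split by the
  Cauchy-Schwarz inequality and probabilities by a union bound.

  Whitening the rows with respect to the kernel turns \<open>C\<^sup>-\<^sup>1\<^sub>j\<^sub>j\<close> times a squared distance into the squared distance of a
  standard Gaussian vector from an independent subspace of dimension at most \<open>k - 1\<close>, which dominates a
  chi-square variable with \<open>p + 1\<close> degrees of freedom; its negative moments follow from its Laplace transform.
  The factor \<open>A\<close> is controlled by convexity of the exponential. That the \<open>x\<^sub>m\<^sub>i\<close> are jointly Gaussian is obtained
  by approximating \<open>\<langle>f, \<omega>\<rangle>\<close> in mean square by finite combinations of point values.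
\<close>

subsection \<open>Square-integrable functions\<close>

text \<open>For a standard Gaussian test matrix the rows m < k and m \<ge> k would be independent
  because the v_m are orthonormal, and A and R could be averaged separately. A general kernel
  correlates the functionals of one sample. This is the source of the dependence, and the reason why
  R is governed by Tr(C^-1). The chi-square variable has l - (k - 1) = p + 1 degrees of freedom. Its
  inverse mean is 1/((p + 1) - 2) = 1/(p - 1). Its moment of order -p/2, an order matched to the
  decay t^-p, is at most (3/(p + 1))^(p/2), with equality at p = 2; hence the constant 3. The factor
  k / \<gamma>_k is just \<lambda>_1 Tr(C^-1): \<lambda>_1 bounds the variance of a tail functional,
  and the diagonal of C^-1 rescales the distances. A second obstacle is that the process is
  specified by its values at finitely many points and independence is stated for the product
  sigma-algebra over D1. Integrals of samples are not directly covered by either, so their joint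
  laws are reached through limits of characteristic functions.\<close>

lemma L2_spaceI:
  "f \<in> borel_measurable M \<Longrightarrow> integrable M (\<lambda>x. (f x)\<^sup>2) \<Longrightarrow> f \<in> L2_space M"
  by (simp add: L2_space_def)

lemma L2_space_measurable [measurable_dest]: "f \<in> L2_space M \<Longrightarrow> f \<in> borel_measurable M"
  by (simp add: L2_space_def)

lemma L2_space_integrable_sq: "f \<in> L2_space M \<Longrightarrow> integrable M (\<lambda>x. (f x)\<^sup>2)"
  by (simp add: L2_space_def)

lemma L2_space_integrable_mult:
  assumes "f \<in> L2_space M" "g \<in> L2_space M"
  shows "integrable M (\<lambda>x. f x * g x)"
proof (rule Bochner_Integration.integrable_bound)
  show "integrable M (\<lambda>x. (f x)\<^sup>2 + (g x)\<^sup>2)"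
    using assms by (intro Bochner_Integration.integrable_add L2_space_integrable_sq)
  show "(\<lambda>x. f x * g x) \<in> borel_measurable M"
    using assms by (auto dest!: L2_space_measurable)
  have "\<bar>a * b\<bar> \<le> a\<^sup>2 + b\<^sup>2" for a b :: real
    using sum_squares_bound[of a b] sum_squares_bound[of a "-b"] sum_power2_ge_zero[of a b]
    unfolding abs_le_iff power2_minus by linarith
  then show "AE x in M. norm (f x * g x) \<le> norm ((f x)\<^sup>2 + (g x)\<^sup>2)"
    by (auto simp: abs_of_nonneg)
qed

lemma L2_space_add:
  assumes "f \<in> L2_space M" "g \<in> L2_space M"
  shows "(\<lambda>x. f x + g x) \<in> L2_space M"
proof (rule L2_spaceI)
  have "integrable M (\<lambda>x. (f x)\<^sup>2 + (g x)\<^sup>2 + 2 * (f x * g x))"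
    using assms by (intro Bochner_Integration.integrable_add integrable_mult_right
        L2_space_integrable_sq L2_space_integrable_mult)
  then show "integrable M (\<lambda>x. (f x + g x)\<^sup>2)"
    by (simp add: power2_eq_square algebra_simps)
qed (use assms in \<open>auto dest!: L2_space_measurable\<close>)

lemma L2_space_scale: "f \<in> L2_space M \<Longrightarrow> (\<lambda>x. c * f x) \<in> L2_space M"
  by (auto simp: L2_space_def power_mult_distrib)

lemma L2_space_diff:
  assumes "f \<in> L2_space M" "g \<in> L2_space M"
  shows "(\<lambda>x. f x - g x) \<in> L2_space M"
  using L2_space_add[OF assms(1) L2_space_scale[OF assms(2), of "-1"]] by simp

lemma L2_space_zero [simp]: "(\<lambda>x. 0) \<in> L2_space M"
  by (simp add: L2_space_def)

lemma L2_space_sum: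
  "(\<And>i. i \<in> I \<Longrightarrow> f i \<in> L2_space M) \<Longrightarrow> (\<lambda>x. \<Sum>i\<in>I. f i x) \<in> L2_space M"
  by (induction I rule: infinite_finite_induct) (auto intro: L2_space_add)

lemma L2_inner_commute: "L2_inner M f g = L2_inner M g f"
  by (simp add: L2_inner_def mult.commute)

lemma L2_inner_add_left:
  assumes "f \<in> L2_space M" "g \<in> L2_space M" "h \<in> L2_space M"
  shows "L2_inner M (\<lambda>x. f x + g x) h = L2_inner M f h + L2_inner M g h"
  using assms by (simp add: L2_inner_def distrib_right L2_space_integrable_mult)

lemma L2_inner_scale_left: "L2_inner M (\<lambda>x. c * f x) h = c * L2_inner M f h"
  by (simp add: L2_inner_def mult.assoc)

lemma L2_inner_diff_left:
  assumes "f \<in> L2_space M" "g \<in> L2_space M" "h \<in> L2_space M"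
  shows "L2_inner M (\<lambda>x. f x - g x) h = L2_inner M f h - L2_inner M g h"
  using assms by (simp add: L2_inner_def left_diff_distrib L2_space_integrable_mult)

lemma L2_inner_sum_left:
  assumes "\<And>i. i \<in> I \<Longrightarrow> f i \<in> L2_space M" "h \<in> L2_space M"
  shows "L2_inner M (\<lambda>x. \<Sum>i\<in>I. f i x) h = (\<Sum>i\<in>I. L2_inner M (f i) h)"
  using assms by (simp add: L2_inner_def sum_distrib_right L2_space_integrable_mult)

lemma L2_inner_lincomb_left:
  assumes "\<And>i. i \<in> I \<Longrightarrow> f i \<in> L2_space M" "h \<in> L2_space M"
  shows "L2_inner M (\<lambda>x. \<Sum>i\<in>I. a i * f i x) h = (\<Sum>i\<in>I. a i * L2_inner M (f i) h)"
  by (subst L2_inner_sum_left) (use assms in \<open>auto intro: L2_space_scale simp: L2_inner_scale_left\<close>)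

lemma L2_inner_lincomb_right:
  assumes "\<And>i. i \<in> I \<Longrightarrow> f i \<in> L2_space M" "h \<in> L2_space M"
  shows "L2_inner M h (\<lambda>x. \<Sum>i\<in>I. a i * f i x) = (\<Sum>i\<in>I. a i * L2_inner M h (f i))"
  using L2_inner_lincomb_left[OF assms] by (simp add: L2_inner_commute)

lemma L2_inner_diff_right:
  assumes "f \<in> L2_space M" "g \<in> L2_space M" "h \<in> L2_space M"
  shows "L2_inner M h (\<lambda>x. f x - g x) = L2_inner M h f - L2_inner M h g"
  using L2_inner_diff_left[OF assms] by (simp add: L2_inner_commute)

lemma L2_inner_add_right:
  assumes "f \<in> L2_space M" "g \<in> L2_space M" "h \<in> L2_space M"
  shows "L2_inner M h (\<lambda>x. f x + g x) = L2_inner M h f + L2_inner M h g"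
  using L2_inner_add_left[OF assms] by (simp add: L2_inner_commute)

lemma L2_inner_scale_right: "L2_inner M h (\<lambda>x. c * f x) = c * L2_inner M h f"
  using L2_inner_scale_left by (simp add: L2_inner_commute)

lemma L2_inner_self_nonneg [simp]: "0 \<le> L2_inner M f f"
  by (simp add: L2_inner_def)

lemma L2_norm_nonneg [simp]: "0 \<le> L2_norm M f"
  by (simp add: L2_norm_def)

lemma L2_norm_sq: "(L2_norm M f)\<^sup>2 = L2_inner M f f"
  by (simp add: L2_norm_def)

lemma L2_inner_self_eq: "L2_inner M f f = (\<integral>x. (f x)\<^sup>2 \<partial>M)"
  by (simp add: L2_inner_def power2_eq_square)

lemma L2_inner_add_scaled_self:
  assumes "f \<in> L2_space M" "g \<in> L2_space M"
  shows "L2_inner M (\<lambda>x. f x + c * g x) (\<lambda>x. f x + c * g x)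
    = L2_inner M f f + 2 * c * L2_inner M f g + c\<^sup>2 * L2_inner M g g"
  using assms
  by (simp add: L2_inner_add_left L2_inner_add_right L2_space_add L2_space_scale
      L2_inner_scale_left L2_inner_scale_right L2_inner_commute[of M g f] power2_eq_square
      algebra_simps)

lemma L2_Cauchy_Schwarz_sq:
  assumes "f \<in> L2_space M" "g \<in> L2_space M"
  shows "(L2_inner M f g)\<^sup>2 \<le> L2_inner M f f * L2_inner M g g"
proof -
  define a b c where "a = L2_inner M f f" and "b = L2_inner M f g" and "c = L2_inner M g g"
  have q: "0 \<le> a + 2 * t * b + t\<^sup>2 * c" for t
    using L2_inner_self_nonneg[of M "\<lambda>x. f x + t * g x"] L2_inner_add_scaled_self[OF assms, of t]
    by (simp add: a_def b_def c_def)
  have c0: "0 \<le> c" by (simp add: c_def)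
  have "b\<^sup>2 \<le> a * c"
  proof (cases "c = 0")
    case True
    have "b = 0"
    proof (rule ccontr)
      assume "b \<noteq> 0"
      \<comment> \<open>With \<open>c = 0\<close> the quadratic is affine in \<open>t\<close>; this
        \<open>t\<close> makes its value \<open>-1\<close>.\<close>
      then show False using q[of "- (a + 1) / (2 * b)"] True by (simp add: field_simps)
    qed
    with True show ?thesis by simp
  next
    case False
    then have "0 < c" using c0 by simp
    then show ?thesis using q[of "- b / c"]
      by (simp add: field_simps power2_eq_square)
  qed
  then show ?thesis by (simp add: a_def b_def c_def)
qed

lemma L2_Cauchy_Schwarz:
  assumes "f \<in> L2_space M" "g \<in> L2_space M"
  shows "\<bar>L2_inner M f g\<bar> \<le> L2_norm M f * L2_norm M g"
  using real_sqrt_le_mono[OF L2_Cauchy_Schwarz_sq[OF assms]]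
  by (simp add: L2_norm_def real_sqrt_mult)

lemma L2_norm_scale: "L2_norm M (\<lambda>x. c * f x) = \<bar>c\<bar> * L2_norm M f"
  by (simp add: L2_norm_def L2_inner_scale_left L2_inner_scale_right real_sqrt_mult
      flip: mult.assoc)

lemma L2_norm_triangle:
  assumes "f \<in> L2_space M" "g \<in> L2_space M"
  shows "L2_norm M (\<lambda>x. f x + g x) \<le> L2_norm M f + L2_norm M g"
proof (rule power2_le_imp_le)
  show "(L2_norm M (\<lambda>x. f x + g x))\<^sup>2 \<le> (L2_norm M f + L2_norm M g)\<^sup>2"
    using L2_inner_add_scaled_self[OF assms, of 1] L2_Cauchy_Schwarz[OF assms]
    by (simp add: L2_norm_sq power2_sum)
qed simp

lemma L2_norm_triangle_add_scaled:
  assumes "f \<in> L2_space M" "g \<in> L2_space M"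
  shows "L2_norm M (\<lambda>x. f x + c * g x) \<le> L2_norm M f + \<bar>c\<bar> * L2_norm M g"
  using L2_norm_triangle[OF assms(1) L2_space_scale[OF assms(2), of c]] by (simp add: L2_norm_scale)

lemma L2_norm_triangle_sum:
  assumes "finite I" "f \<in> L2_space M" "\<And>i. i \<in> I \<Longrightarrow> g i \<in> L2_space M"
  shows "L2_norm M (\<lambda>x. f x + (\<Sum>i\<in>I. a i * g i x)) \<le> L2_norm M f + (\<Sum>i\<in>I. \<bar>a i\<bar> * L2_norm M (g i))"
  using assms(1,3)
proof (induction I)
  case (insert j I)
  have "L2_norm M (\<lambda>x. (f x + (\<Sum>i\<in>I. a i * g i x)) + a j * g j x)
    \<le> L2_norm M (\<lambda>x. f x + (\<Sum>i\<in>I. a i * g i x)) + \<bar>a j\<bar> * L2_norm M (g j)"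
    using insert assms(2)
    by (intro L2_norm_triangle_add_scaled L2_space_add L2_space_sum L2_space_scale) auto
  moreover have "(\<lambda>x. (f x + (\<Sum>i\<in>I. a i * g i x)) + a j * g j x)
      = (\<lambda>x. f x + (\<Sum>i\<in>insert j I. a i * g i x))"
    using insert by (simp add: add_ac fun_eq_iff)
  ultimately show ?case using insert by auto
qed simp

lemma L2_norm_diff_le:
  assumes "f \<in> L2_space M" "g \<in> L2_space M"
  shows "\<bar>L2_norm M f - L2_norm M g\<bar> \<le> L2_norm M (\<lambda>x. f x - g x)"
proof -
  have "L2_norm M f \<le> L2_norm M g + L2_norm M (\<lambda>x. f x - g x)"
    using L2_norm_triangle[OF assms(2) L2_space_diff[OF assms]] by simp
  moreover have "L2_norm M g \<le> L2_norm M f + L2_norm M (\<lambda>x. f x - g x)"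
    using L2_norm_triangle_add_scaled[OF assms(1) L2_space_diff[OF assms], of "-1"] by simp
  ultimately show ?thesis by simp
qed

subsection \<open>Orthonormal expansions\<close>

lemma L2_orthonormal_space: "L2_orthonormal M e \<Longrightarrow> e j \<in> L2_space M"
  by (simp add: L2_orthonormal_def)

lemma L2_orthonormal_inner:
  "L2_orthonormal M e \<Longrightarrow> L2_inner M (e i) (e j) = (if i = j then 1 else 0)"
  unfolding L2_orthonormal_def by blast

lemma L2_orthonormal_lincomb_sq:
  assumes "L2_orthonormal M e" "finite I"
  shows "L2_inner M (\<lambda>x. \<Sum>j\<in>I. a j * e j x) (\<lambda>x. \<Sum>j\<in>I. a j * e j x) = (\<Sum>j\<in>I. (a j)\<^sup>2)"
proof -
  have e: "e j \<in> L2_space M" for j using assms by (simp add: L2_orthonormal_def)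
  have "L2_inner M (\<lambda>x. \<Sum>j\<in>I. a j * e j x) (\<lambda>x. \<Sum>j\<in>I. a j * e j x)
      = (\<Sum>i\<in>I. a i * (\<Sum>j\<in>I. a j * L2_inner M (e i) (e j)))"
    by (simp add: e L2_inner_lincomb_left L2_inner_lincomb_right L2_space_sum L2_space_scale)
  also have "\<dots> = (\<Sum>j\<in>I. (a j)\<^sup>2)"
    using assms(2)
    by (simp add: L2_orthonormal_inner[OF assms(1)] if_distrib power2_eq_square cong: if_cong)
  finally show ?thesis .
qed

text \<open>The norm is continuous along the partial sums, whose norms are known by orthonormality.
  Besides Parseval for a basis this covers images expanded in left singular functions, which may
  span only a subspace.\<close>

lemma L2_sums_orthonormal_norm:
  assumes "L2_orthonormal M e" "h \<in> L2_space M" "L2_sums M (\<lambda>j x. c j * e j x) h"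
  shows "(\<lambda>j. (c j)\<^sup>2) sums L2_inner M h h"
proof -
  have e: "e j \<in> L2_space M" for j using assms by (simp add: L2_orthonormal_def)
  let ?s = "\<lambda>n x. \<Sum>j<n. c j * e j x"
  have s: "?s n \<in> L2_space M" for n by (intro L2_space_sum L2_space_scale e)
  have lim: "(\<lambda>n. L2_norm M (\<lambda>x. h x - ?s n x)) \<longlonglongrightarrow> 0"
    using assms(3) by (simp add: L2_sums_def)
  have "(\<lambda>n. \<bar>L2_norm M h - L2_norm M (?s n)\<bar>) \<longlonglongrightarrow> 0"
    by (rule tendsto_sandwich[OF _ _ tendsto_const lim])
      (auto intro!: always_eventually L2_norm_diff_le assms(2) s)
  then have "(\<lambda>n. L2_norm M h - L2_norm M (?s n)) \<longlonglongrightarrow> 0"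
    by (rule tendsto_rabs_zero_cancel)
  then have "(\<lambda>n. L2_norm M h - (L2_norm M h - L2_norm M (?s n))) \<longlonglongrightarrow> L2_norm M h - 0"
    by (intro tendsto_diff tendsto_const)
  then have "(\<lambda>n. (L2_norm M (?s n))\<^sup>2) \<longlonglongrightarrow> (L2_norm M h)\<^sup>2"
    by (intro tendsto_power) simp
  then show ?thesis
    using L2_orthonormal_lincomb_sq[OF assms(1), of "{..<_}" c]
    by (simp add: L2_norm_sq sums_def)
qed

lemma L2_basis_orthonormal: "L2_basis M e \<Longrightarrow> L2_orthonormal M e"
  by (simp add: L2_basis_def)

lemma L2_basis_Parseval:
  assumes "L2_basis M e" "f \<in> L2_space M"
  shows "(\<lambda>j. (L2_inner M (e j) f)\<^sup>2) sums L2_inner M f f"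
  using assms by (intro L2_sums_orthonormal_norm[of M e]) (auto simp: L2_basis_def)

lemma L2_sums_add_scaled:
  assumes "f \<in> L2_space M" "f' \<in> L2_space M" "\<And>j. g j \<in> L2_space M" "\<And>j. g' j \<in> L2_space M"
    and "L2_sums M g f" "L2_sums M g' f'"
  shows "L2_sums M (\<lambda>j x. g j x + c * g' j x) (\<lambda>x. f x + c * f' x)"
  unfolding L2_sums_def
proof (rule tendsto_sandwich[OF always_eventually always_eventually tendsto_const])
  let ?r = "\<lambda>n x. f x - (\<Sum>j<n. g j x)" and ?r' = "\<lambda>n x. f' x - (\<Sum>j<n. g' j x)"
  have "L2_norm M (\<lambda>x. ?r n x + c * ?r' n x) \<le> L2_norm M (?r n) + \<bar>c\<bar> * L2_norm M (?r' n)" for n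
    by (intro L2_norm_triangle_add_scaled L2_space_diff L2_space_sum assms)
  moreover have "(\<lambda>x. ?r n x + c * ?r' n x) =
      (\<lambda>x. f x + c * f' x - (\<Sum>j<n. g j x + c * g' j x))" for n
    by (simp add: algebra_simps sum.distrib sum_distrib_left)
  ultimately show "\<forall>n. L2_norm M (\<lambda>x. f x + c * f' x - (\<Sum>j<n. g j x + c * g' j x))
      \<le> L2_norm M (?r n) + \<bar>c\<bar> * L2_norm M (?r' n)" by simp
  have "(\<lambda>n. L2_norm M (?r n) + \<bar>c\<bar> * L2_norm M (?r' n)) \<longlonglongrightarrow> 0 + \<bar>c\<bar> * 0"
    using assms(5,6) unfolding L2_sums_def by (intro tendsto_add tendsto_mult tendsto_const)
  then show "(\<lambda>n. L2_norm M (?r n) + \<bar>c\<bar> * L2_norm M (?r' n)) \<longlonglongrightarrow> 0" by simp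
qed simp

subsection \<open>Orthogonal projection onto a finite span\<close>

lemma col_span_L2_space:
  assumes "\<And>i. i < l \<Longrightarrow> Y i \<in> L2_space M" "h \<in> col_span l Y"
  shows "h \<in> L2_space M"
  using assms by (auto simp: col_span_def intro!: L2_space_sum L2_space_scale)

lemma col_span_Suc_add:
  assumes "g \<in> col_span l Y"
  shows "(\<lambda>x. g x + c * Y l x) \<in> col_span (Suc l) Y"
proof -
  obtain a where a: "g = (\<lambda>x. \<Sum>i<l. a i * Y i x)" using assms by (auto simp: col_span_def)
  show ?thesis
    unfolding col_span_def a by (rule CollectI, rule exI[of _ "a(l := c)"]) simp
qed

lemma col_span_add_scaled:
  assumes "g \<in> col_span l Y" "h \<in> col_span l Y"
  shows "(\<lambda>x. g x + c * h x) \<in> col_span l Y"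
proof -
  obtain a b where "g = (\<lambda>x. \<Sum>i<l. a i * Y i x)" "h = (\<lambda>x. \<Sum>i<l. b i * Y i x)"
    using assms by (auto simp: col_span_def)
  then show ?thesis
    unfolding col_span_def
    by (intro CollectI exI[of _ "\<lambda>i. a i + c * b i"])
      (simp add: algebra_simps sum.distrib sum_distrib_left)
qed

lemma col_span_SucE:
  assumes "h \<in> col_span (Suc l) Y"
  obtains g c where "g \<in> col_span l Y" "h = (\<lambda>x. g x + c * Y l x)"
  using assms by (fastforce simp: col_span_def)

lemma orth_proj_exists:
  assumes "\<And>i. i < l \<Longrightarrow> Y i \<in> L2_space M" "f \<in> L2_space M"
  shows "\<exists>g\<in>col_span l Y. \<forall>h\<in>col_span l Y. L2_inner M (\<lambda>x. f x - g x) h = 0"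
  using assms
proof (induction l arbitrary: f)
  case 0
  show ?case by (simp add: col_span_def L2_inner_def)
next
  case (Suc l)
  have V: "h \<in> L2_space M" if "h \<in> col_span l Y" for h
    using Suc.prems(1) by (rule col_span_L2_space[OF _ that]) simp
  have IH: "\<exists>g\<in>col_span l Y. \<forall>h\<in>col_span l Y. L2_inner M (\<lambda>x. f' x - g x) h = 0"
    if "f' \<in> L2_space M" for f'
    using Suc.IH[OF _ that] Suc.prems(1) by simp
  obtain g where g: "g \<in> col_span l Y" "\<And>h. h \<in> col_span l Y \<Longrightarrow> L2_inner M (\<lambda>x. f x - g x) h = 0"
    using IH[OF Suc.prems(2)] by blast
  obtain y where y: "y \<in> col_span l Y"
      "\<And>h. h \<in> col_span l Y \<Longrightarrow> L2_inner M (\<lambda>x. Y l x - y x) h = 0"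
    using IH[of "Y l"] Suc.prems(1) by blast
  define r where "r = (\<lambda>x. Y l x - y x)"
  define q where "q = (\<lambda>x. f x - g x)"
  have rq: "r \<in> L2_space M" "q \<in> L2_space M"
    using V g y Suc.prems by (auto simp: r_def q_def intro!: L2_space_diff)
  \<comment> \<open>If the new column already lies in the old span, \<open>L2_inner M r r\<close> is
    0 and so is \<open>c\<close>. Cauchy-Schwarz then gives \<open>L2_inner M q r = 0\<close>, so
    dependent columns obey the same equation.\<close>
  define c where "c = L2_inner M q r / L2_inner M r r"
  have c: "L2_inner M q r = c * L2_inner M r r"
    using L2_Cauchy_Schwarz_sq[OF rq(2) rq(1)] by (auto simp: c_def)
  define G where "G = (\<lambda>x. (g x + (-c) * y x) + c * Y l x)"
  have "G \<in> col_span (Suc l) Y"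
    unfolding G_def by (intro col_span_Suc_add col_span_add_scaled g y)
  moreover have "L2_inner M (\<lambda>x. f x - G x) h = 0" if hS: "h \<in> col_span (Suc l) Y" for h
  proof -
    obtain h' d where h': "h' \<in> col_span l Y" "h = (\<lambda>x. h' x + d * Y l x)"
      by (rule col_span_SucE[OF hS])
    define h2 where "h2 = (\<lambda>x. h' x + d * y x)"
    have h2: "h2 \<in> col_span l Y" unfolding h2_def by (intro col_span_add_scaled h' y)
    have h: "h = (\<lambda>x. h2 x + d * r x)" by (auto simp: h' h2_def r_def algebra_simps)
    have "(\<lambda>x. f x - G x) = (\<lambda>x. q x - c * r x)"
      by (auto simp: G_def q_def r_def algebra_simps)
    moreover have "L2_inner M (\<lambda>x. q x - c * r x) h2 = 0"
      using g(2)[OF h2] y(2)[OF h2] rq V[OF h2]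
      by (simp add: L2_inner_diff_left L2_space_scale L2_inner_scale_left flip: q_def r_def)
    moreover have "L2_inner M (\<lambda>x. q x - c * r x) r = 0"
      using rq c by (simp add: L2_inner_diff_left L2_space_scale L2_inner_scale_left)
    ultimately show ?thesis
      using rq V[OF h2] unfolding h
      by (simp add: L2_inner_add_right L2_space_scale L2_space_diff L2_inner_scale_right)
  qed
  ultimately show ?case by blast
qed

context
  fixes M :: "'a measure" and Y :: "nat \<Rightarrow> 'a \<Rightarrow> real" and l :: nat and f :: "'a \<Rightarrow> real"
  assumes Y: "\<And>i. i < l \<Longrightarrow> Y i \<in> L2_space M" and f: "f \<in> L2_space M"
begin

lemma orth_proj_in_span: "orth_proj M (col_span l Y) f \<in> col_span l Y"
  and orth_proj_orthogonal:
    "h \<in> col_span l Y \<Longrightarrow> L2_inner M (\<lambda>x. f x - orth_proj M (col_span l Y) f x) h = 0"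
  using someI_ex[OF orth_proj_exists[OF Y f, unfolded Bex_def]] by (auto simp: orth_proj_def)

lemma orth_proj_L2_space: "orth_proj M (col_span l Y) f \<in> L2_space M"
  using col_span_L2_space[OF Y orth_proj_in_span] .

lemma orth_proj_minimal:
  assumes h: "h \<in> col_span l Y"
  shows "L2_norm M (\<lambda>x. f x - orth_proj M (col_span l Y) f x) \<le> L2_norm M (\<lambda>x. f x - h x)"
proof (rule power2_le_imp_le)
  let ?g = "orth_proj M (col_span l Y) f"
  let ?r = "\<lambda>x. f x - ?g x" and ?d = "\<lambda>x. ?g x + (-1) * h x"
  have d: "?d \<in> col_span l Y" by (intro col_span_add_scaled orth_proj_in_span h)
  have "L2_inner M (\<lambda>x. ?r x + 1 * ?d x) (\<lambda>x. ?r x + 1 * ?d x)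
      = L2_inner M ?r ?r + 2 * 1 * L2_inner M ?r ?d + 1\<^sup>2 * L2_inner M ?d ?d"
    by (intro L2_inner_add_scaled_self L2_space_diff f orth_proj_L2_space col_span_L2_space[OF Y d])
  also have "L2_inner M ?r ?d = 0" by (rule orth_proj_orthogonal[OF d])
  finally show "(L2_norm M ?r)\<^sup>2 \<le> (L2_norm M (\<lambda>x. f x - h x))\<^sup>2"
    by (simp add: L2_norm_sq)
qed simp

text \<open>The projection is a \<open>SOME\<close>-choice without visible measurability in a
  parameter. Its distance is an infimum over coefficients, and rational ones suffice, so sublevel
  sets become countable unions; lists of rationals serve as a countable index type.\<close>

lemma orth_proj_less_iff_rat:
  "L2_norm M (\<lambda>x. f x - orth_proj M (col_span l Y) f x) < b \<longleftrightarrow>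
   (\<exists>q :: rat list. L2_norm M (\<lambda>x. f x - (\<Sum>i<l. of_rat (q ! i) * Y i x)) < b)"
proof
  assume "\<exists>q :: rat list. L2_norm M (\<lambda>x. f x - (\<Sum>i<l. of_rat (q ! i) * Y i x)) < b"
  then obtain q :: "rat list" where q: "L2_norm M (\<lambda>x. f x - (\<Sum>i<l. of_rat (q ! i) * Y i x)) < b" ..
  have "L2_norm M (\<lambda>x. f x - orth_proj M (col_span l Y) f x)
      \<le> L2_norm M (\<lambda>x. f x - (\<Sum>i<l. of_rat (q ! i) * Y i x))"
    by (rule orth_proj_minimal) (auto simp: col_span_def)
  with q show "L2_norm M (\<lambda>x. f x - orth_proj M (col_span l Y) f x) < b" by simp
next
  let ?r = "\<lambda>x. f x - orth_proj M (col_span l Y) f x"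
  assume less: "L2_norm M ?r < b"
  obtain a where a: "orth_proj M (col_span l Y) f = (\<lambda>x. \<Sum>i<l. a i * Y i x)"
    using orth_proj_in_span by (auto simp: col_span_def)
  define B where "B = (\<Sum>i<l. L2_norm M (Y i))"
  have B: "0 \<le> B" by (simp add: B_def sum_nonneg)
  \<comment> \<open>The slack shared among the columns; the added 1 covers the case that all columns
    have norm 0.\<close>
  define e where "e = (b - L2_norm M ?r) / (B + 1)"
  have e: "0 < e" "B * e < b - L2_norm M ?r"
    using less B by (auto simp: e_def field_simps)
  have "\<exists>q :: rat. \<bar>a i - of_rat q\<bar> < e" for i
    using of_rat_dense[of "a i - e" "a i + e"] e(1) by (auto simp: abs_less_iff) (smt (verit))
  then obtain q :: "nat \<Rightarrow> rat" where q: "\<And>i. \<bar>a i - of_rat (q i)\<bar> < e" by metis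
  let ?Q = "map q [0..<l]"
  have eq: "(\<lambda>x. f x - (\<Sum>i<l. of_rat (?Q ! i) * Y i x)) =
      (\<lambda>x. ?r x + (\<Sum>i<l. (a i - of_rat (q i)) * Y i x))"
    by (simp add: a left_diff_distrib sum_subtractf)
  have "L2_norm M (\<lambda>x. ?r x + (\<Sum>i<l. (a i - of_rat (q i)) * Y i x))
      \<le> L2_norm M ?r + (\<Sum>i<l. \<bar>a i - of_rat (q i)\<bar> * L2_norm M (Y i))"
    by (intro L2_norm_triangle_sum L2_space_diff f orth_proj_L2_space) (auto intro: Y)
  also have "(\<Sum>i<l. \<bar>a i - of_rat (q i)\<bar> * L2_norm M (Y i)) \<le> (\<Sum>i<l. e * L2_norm M (Y i))"
    using q by (intro sum_mono mult_right_mono) (auto intro: less_imp_le)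
  also have "\<dots> = B * e" by (simp add: B_def sum_distrib_left mult.commute)
  finally show "\<exists>q :: rat list. L2_norm M (\<lambda>x. f x - (\<Sum>i<l. of_rat (q ! i) * Y i x)) < b"
    using e(2) eq by (intro exI[of _ ?Q]) simp
qed

end

lemma borel_measurable_orth_proj_residual:
  assumes Y: "\<And>w i. w \<in> space P \<Longrightarrow> i < l \<Longrightarrow> Y w i \<in> L2_space M"
    and f: "\<And>w. w \<in> space P \<Longrightarrow> f w \<in> L2_space M"
    and meas: "\<And>a. (\<lambda>w. L2_norm M (\<lambda>x. f w x - (\<Sum>i<l. a i * Y w i x))) \<in> borel_measurable P"
  shows "(\<lambda>w. L2_norm M (\<lambda>x. f w x - orth_proj M (col_span l (Y w)) (f w) x)) \<in> borel_measurable P"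
proof (subst borel_measurable_iff_less, intro allI)
  fix b
  have "{w \<in> space P. L2_norm M (\<lambda>x. f w x - orth_proj M (col_span l (Y w)) (f w) x) < b} =
    (\<Union>q :: rat list. {w \<in> space P. L2_norm M (\<lambda>x. f w x - (\<Sum>i<l. of_rat (q ! i) * Y w i x)) < b})"
    using orth_proj_less_iff_rat[OF Y f] by auto
  also have "\<dots> \<in> sets P"
    using meas by (intro sets.countable_UN' ) (auto simp: borel_measurable_iff_less)
  finally show "{w \<in> space P. L2_norm M (\<lambda>x. f w x - orth_proj M (col_span l (Y w)) (f w) x) < b}
    \<in> sets P" .
qed

subsection \<open>Characteristic functions of Gaussian vectors\<close>

text \<open>Reweighting the measure by \<open>W / c\<close> gives a probability measure under which
  \<open>Y\<close> has the standard normal characteristic function, so Levy uniqueness applies. Here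
  \<open>c\<close> is the total mass of \<open>W\<close>; if it vanishes, so does \<open>W\<close>
  almost everywhere.\<close>

lemma (in prob_space) weighted_std_normal_nonneg:
  fixes W Y :: "'a \<Rightarrow> real" and c :: real
  assumes [measurable]: "W \<in> borel_measurable M" "Y \<in> borel_measurable M" "B \<in> sets borel"
    and W: "\<And>w. 0 \<le> W w" "\<And>w. W w \<le> C"
    and char: "\<And>t. (\<integral>w. complex_of_real (W w) * iexp (t * Y w) \<partial>M) = c * exp (- (t\<^sup>2) / 2)"
  shows "(\<integral>w. W w * indicator B (Y w) \<partial>M) = c * measure std_normal_distribution B"
proof -
  have intW: "integrable M W"
    by (rule integrable_const_bound[of _ C]) (use W in \<open>auto simp: abs_of_nonneg\<close>)
  have c: "(\<integral>w. W w \<partial>M) = c"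
  proof -
    have "complex_of_real (\<integral>w. W w \<partial>M) = complex_of_real c" using char[of 0] by simp
    then show ?thesis by (simp only: of_real_eq_iff)
  qed
  have c0: "0 \<le> c" using W by (simp flip: c)
  show ?thesis
  proof (cases "c = 0")
    case True
    then have "AE w in M. W w = 0"
      using integral_nonneg_eq_0_iff_AE[OF intW] W c by simp
    then have "AE w in M. W w * indicator B (Y w) = 0" by auto
    then have "(\<integral>w. W w * indicator B (Y w) \<partial>M) = (\<integral>w. 0 \<partial>M)"
      by (intro integral_cong_AE) auto
    with True show ?thesis by simp
  next
    case False
    with c0 have cpos: "0 < c" by simp
    define N where "N = density M (\<lambda>w. ennreal (W w / c))"
    define D where "D = distr N borel Y"
    have sN[measurable_cong]: "sets N = sets M" by (simp add: N_def)
    interpret N: prob_space N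
    proof
      have "emeasure N (space N) = (\<integral>\<^sup>+w. ennreal (W w / c) \<partial>M)"
        by (simp add: N_def emeasure_density cong: nn_integral_cong)
      also have "\<dots> = ennreal (\<integral>w. W w / c \<partial>M)"
        using W cpos intW by (intro nn_integral_eq_integral) auto
      also have "\<dots> = 1" using c cpos by simp
      finally show "emeasure N (space N) = 1" .
    qed
    interpret D: real_distribution D
      unfolding D_def by (rule N.real_distribution_distr) simp
    have "char D t = char std_normal_distribution t" for t
    proof -
      have "char D t = (\<integral>w. iexp (t * Y w) \<partial>N)"
        unfolding char_def D_def by (subst integral_distr) auto
      also have "\<dots> = (\<integral>w. (W w / c) *\<^sub>R iexp (t * Y w) \<partial>M)"
        unfolding N_def by (subst integral_density) (use W cpos in auto)
      also have "\<dots> = (\<integral>w. complex_of_real (W w) * iexp (t * Y w) / c \<partial>M)"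
        by (intro Bochner_Integration.integral_cong) (auto simp: scaleR_conv_of_real)
      also have "\<dots> = (\<integral>w. complex_of_real (W w) * iexp (t * Y w) \<partial>M) / c" by simp
      also have "\<dots> = exp (- (t\<^sup>2) / 2)" unfolding char using cpos by simp
      finally show ?thesis by (simp add: char_std_normal_distribution)
    qed
    then have "D = std_normal_distribution"
      by (intro Levy_uniqueness D.real_distribution_axioms real_dist_normal_dist ext)
    then have "measure std_normal_distribution B = measure D B" by simp
    also have "\<dots> = (\<integral>x. indicator B x \<partial>D)" by (simp add: D_def)
    also have "\<dots> = (\<integral>w. indicator B (Y w) \<partial>N)"
      unfolding D_def by (subst integral_distr) auto
    also have "\<dots> = (\<integral>w. (W w / c) *\<^sub>R indicator B (Y w) \<partial>M)"
      unfolding N_def by (subst integral_density) (use W cpos in auto)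
    also have "\<dots> = (\<integral>w. W w * indicator B (Y w) \<partial>M) / c" by simp
    finally show ?thesis using cpos by (simp add: field_simps)
  qed
qed

text \<open>\<open>1 + Re W\<close> lies between 0 and 2, hence is an admissible nonnegative weight;
  the contribution of the constant weight 1 is subtracted afterwards.\<close>

lemma (in prob_space) weighted_std_normal_Re:
  fixes W :: "'a \<Rightarrow> complex" and Y :: "'a \<Rightarrow> real" and c :: complex
  assumes [measurable]: "W \<in> borel_measurable M" "Y \<in> borel_measurable M" "B \<in> sets borel"
    and W: "\<And>w. norm (W w) \<le> 1"
    and Y: "\<And>t. (\<integral>w. iexp (t * Y w) \<partial>M) = exp (- (t\<^sup>2) / 2)"
    and char: "\<And>t. (\<integral>w. W w * iexp (t * Y w) \<partial>M) = c * exp (- (t\<^sup>2) / 2)"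
  shows "(\<integral>w. Re (W w) * indicator B (Y w) \<partial>M) = Re c * measure std_normal_distribution B"
proof -
  have intW: "integrable M (\<lambda>w. W w * iexp (t * Y w))" for t
    by (rule integrable_const_bound[of _ 1]) (use W in \<open>auto simp: norm_mult\<close>)
  have intE: "integrable M (\<lambda>w. iexp (t * Y w))" for t
    by (rule integrable_const_bound[of _ 1]) auto
  have lin: "(\<integral>w. f w + (g w + cnj (h w)) / 2 \<partial>M) = (\<integral>w. f w \<partial>M) + ((\<integral>w. g w \<partial>M) + cnj (\<integral>w. h w \<partial>M)) / 2"
    if "integrable M f" "integrable M g" "integrable M h" for f g h :: "'a \<Rightarrow> complex"
    using that by simp
  have bd: "\<bar>Re (W w)\<bar> \<le> 1" for w using abs_Re_le_cmod[of "W w"] W[of w] by linarith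
  have "(\<integral>w. (1 + Re (W w)) * indicator B (Y w) \<partial>M)
      = (1 + Re c) * measure std_normal_distribution B"
  proof (rule weighted_std_normal_nonneg[where C = 2])
    show "0 \<le> 1 + Re (W w)" "1 + Re (W w) \<le> 2" for w using bd[of w] by linarith+
    fix t
    \<comment> \<open>The transform of \<open>Re W\<close> at \<open>t\<close> is the mean of the
      transform of \<open>W\<close> at \<open>t\<close> and the conjugate of that at
      \<open>-t\<close>. The Gaussian factor is even, so the two constants average to
      \<open>Re c\<close>.\<close>
    have eq: "complex_of_real (1 + Re (W w)) * iexp (t * Y w) =
        iexp (t * Y w) + (W w * iexp (t * Y w) + cnj (W w * iexp ((-t) * Y w))) / 2" for w
      by (simp add: complex_eq_iff exp_eq_polar cis.ctr algebra_simps)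
    have "(\<integral>w. complex_of_real (1 + Re (W w)) * iexp (t * Y w) \<partial>M) =
        (\<integral>w. iexp (t * Y w) \<partial>M) + ((\<integral>w. W w * iexp (t * Y w) \<partial>M)
          + cnj (\<integral>w. W w * iexp ((-t) * Y w) \<partial>M)) / 2"
      unfolding eq by (rule lin[OF intE intW intW])
    also have "\<dots> = (1 + Re c) * exp (- (t\<^sup>2) / 2)"
      unfolding Y char by (simp add: complex_eq_iff algebra_simps)
    finally show "(\<integral>w. complex_of_real (1 + Re (W w)) * iexp (t * Y w) \<partial>M)
      = (1 + Re c) * exp (- (t\<^sup>2) / 2)" .
  qed auto
  moreover have "(\<integral>w. 1 * indicator B (Y w) \<partial>M) = 1 * measure std_normal_distribution B"
    by (rule weighted_std_normal_nonneg[where C = 1]) (use Y in auto)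
  moreover have "(\<integral>w. (1 + Re (W w)) * indicator B (Y w) \<partial>M)
      = (\<integral>w. 1 * indicator B (Y w) \<partial>M) + (\<integral>w. Re (W w) * indicator B (Y w) \<partial>M)"
    unfolding distrib_right
    by (intro Bochner_Integration.integral_add integrable_const_bound[of _ 1])
      (use bd in \<open>auto simp: indicator_def abs_mult\<close>)
  ultimately show ?thesis by (simp add: algebra_simps)
qed

lemma (in prob_space) weighted_std_normal:
  fixes W :: "'a \<Rightarrow> complex" and Y :: "'a \<Rightarrow> real" and c :: complex
  assumes [measurable]: "W \<in> borel_measurable M" "Y \<in> borel_measurable M" "B \<in> sets borel"
    and W: "\<And>w. norm (W w) \<le> 1"
    and Y: "\<And>t. (\<integral>w. iexp (t * Y w) \<partial>M) = exp (- (t\<^sup>2) / 2)"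
    and char: "\<And>t. (\<integral>w. W w * iexp (t * Y w) \<partial>M) = c * exp (- (t\<^sup>2) / 2)"
  shows "(\<integral>w. W w * indicator B (Y w) \<partial>M) = c * measure std_normal_distribution B"
proof -
  have int: "integrable M (\<lambda>w. W w * indicator B (Y w))"
    by (rule integrable_const_bound[of _ 1]) (use W in \<open>auto simp: norm_mult indicator_def\<close>)
  have "Re (\<integral>w. W w * indicator B (Y w) \<partial>M) = (\<integral>w. Re (W w) * indicator B (Y w) \<partial>M)"
    using int by (subst integral_Re[symmetric])
      (auto intro!: Bochner_Integration.integral_cong simp: indicator_def)
  also have "\<dots> = Re c * measure std_normal_distribution B"
    by (rule weighted_std_normal_Re) (use W Y char in auto)
  finally have 1: "Re (\<integral>w. W w * indicator B (Y w) \<partial>M) = Re c * measure std_normal_distribution B" .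
  \<comment> \<open>The imaginary part of z is the real part of -i z, and multiplication by -i
    preserves the bound on the weight.\<close>
  have "Im (\<integral>w. W w * indicator B (Y w) \<partial>M) = (\<integral>w. Re (- \<i> * W w) * indicator B (Y w) \<partial>M)"
    using int by (subst integral_Im[symmetric])
      (auto intro!: Bochner_Integration.integral_cong simp: indicator_def)
  also have "\<dots> = Re (- \<i> * c) * measure std_normal_distribution B"
  proof (rule weighted_std_normal_Re)
    have "(\<integral>w. - \<i> * (W w * iexp (t * Y w)) \<partial>M) = - \<i> * (c * exp (- (t\<^sup>2) / 2))" for t
      unfolding char[symmetric] by simp
    then show "(\<integral>w. - \<i> * W w * iexp (t * Y w) \<partial>M) = - \<i> * c * exp (- (t\<^sup>2) / 2)" for t
      by (simp only: mult.assoc)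
  qed (use W Y in \<open>auto simp: norm_mult\<close>)
  finally show ?thesis using 1 by (simp add: complex_eq_iff)
qed

text \<open>One-dimensional uniqueness suffices: the coordinates are converted from exponentials to indicators
  one at a time.\<close>

lemma (in prob_space) distr_PiM_std_normalI:
  fixes Y :: "'i \<Rightarrow> 'a \<Rightarrow> real"
  assumes I: "finite I" and Y [measurable]: "\<And>i. i \<in> I \<Longrightarrow> Y i \<in> borel_measurable M"
    and char: "\<And>t. (\<integral>w. iexp (\<Sum>i\<in>I. t i * Y i w) \<partial>M) = exp (- (\<Sum>i\<in>I. (t i)\<^sup>2) / 2)"
  shows "distr M (PiM I (\<lambda>_. borel)) (\<lambda>w. \<lambda>i\<in>I. Y i w) = PiM I (\<lambda>_. std_normal_distribution)"
proof -
  let ?\<nu> = "std_normal_distribution"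
  have marg: "(\<integral>w. iexp (t * Y j w) \<partial>M) = exp (- (t\<^sup>2) / 2)" if "j \<in> I" for j t
    using char[of "\<lambda>i. if i = j then t else 0"] that I
    by (simp add: if_distrib if_distribR cong: if_cong)
  have step: "(\<integral>w. (\<Prod>i\<in>J. indicator (B i) (Y i w)) * iexp (\<Sum>i\<in>I-J. t i * Y i w) \<partial>M)
      = complex_of_real ((\<Prod>i\<in>J. measure ?\<nu> (B i)) * exp (- (\<Sum>i\<in>I-J. (t i)\<^sup>2) / 2))"
    if "J \<subseteq> I" "\<And>i. B i \<in> sets borel" for J B t
    using finite_subset[OF that(1) I] that(1)
  proof (induction J arbitrary: t)
    case empty
    then show ?case using char by simp
  next
    case (insert j J)
    let ?R = "I - insert j J"
    have R: "I - J = insert j ?R" "j \<notin> ?R" "finite ?R" using insert I by auto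
    \<comment> \<open>All factors except the one of coordinate \<open>j\<close> form a complex
      weight of modulus at most 1, so the weighted uniqueness result converts this
      coordinate.\<close>
    define W where "W = (\<lambda>w. (\<Prod>i\<in>J. indicator (B i) (Y i w)) * iexp (\<Sum>i\<in>?R. t i * Y i w))"
    have [measurable]: "Y j \<in> borel_measurable M" "\<And>i. i \<in> J \<Longrightarrow> Y i \<in> borel_measurable M"
      "\<And>i. B i \<in> sets borel"
      using insert that by auto
    have Wm: "W \<in> borel_measurable M" unfolding W_def by (measurable; use insert.prems in auto)
    have Wn: "norm (W w) \<le> 1" for w
      unfolding W_def norm_mult by (auto simp: indicator_def simp flip: prod_norm intro!: prod_le_1)
    have "(\<integral>w. W w * indicator (B j) (Y j w) \<partial>M) =
       complex_of_real ((\<Prod>i\<in>J. measure ?\<nu> (B i)) * exp (- (\<Sum>i\<in>?R. (t i)\<^sup>2) / 2))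
        * measure ?\<nu> (B j)"
    proof (rule weighted_std_normal)
      fix s
      have "(\<integral>w. W w * iexp (s * Y j w) \<partial>M) =
        (\<integral>w. (\<Prod>i\<in>J. indicator (B i) (Y i w)) * iexp (\<Sum>i\<in>I-J. (t(j := s)) i * Y i w) \<partial>M)"
        unfolding W_def R(1) using R(2,3)
        by (intro Bochner_Integration.integral_cong refl)
          (auto simp: algebra_simps exp_add sum.insert intro!: sum.cong arg_cong[of _ _ exp] prod.cong)
      also have "\<dots> = complex_of_real ((\<Prod>i\<in>J. measure ?\<nu> (B i)) *
          exp (- (\<Sum>i\<in>I-J. ((t(j := s)) i)\<^sup>2) / 2))"
        using insert by (intro insert.IH) auto
      also have "(\<Sum>i\<in>I-J. ((t(j := s)) i)\<^sup>2) = s\<^sup>2 + (\<Sum>i\<in>?R. (t i)\<^sup>2)"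
        unfolding R(1) using R(2,3) by (auto intro!: sum.cong)
      also have "exp (- (s\<^sup>2 + (\<Sum>i\<in>?R. (t i)\<^sup>2)) / 2)
          = exp (- (\<Sum>i\<in>?R. (t i)\<^sup>2) / 2) * exp (- (s\<^sup>2) / 2)"
        by (simp add: diff_divide_distrib flip: exp_add)
      finally show "(\<integral>w. W w * iexp (s * Y j w) \<partial>M) =
        complex_of_real ((\<Prod>i\<in>J. measure ?\<nu> (B i)) * exp (- (\<Sum>i\<in>?R. (t i)\<^sup>2) / 2))
          * exp (- (s\<^sup>2) / 2)"
        by (simp add: mult.assoc)
    qed (use Wm Wn marg insert in auto)
    then show ?case
      using insert(1,2) by (simp add: W_def mult_ac)
  qed
  interpret \<nu>: prob_space ?\<nu> by (rule prob_space_normal_density) simp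
  interpret product_sigma_finite "\<lambda>_ :: 'i. ?\<nu>" by standard
  show ?thesis
  proof (rule PiM_eqI)
    show "sets (distr M (PiM I (\<lambda>_. borel)) (\<lambda>w. \<lambda>i\<in>I. Y i w)) = sets (PiM I (\<lambda>_. ?\<nu>))"
      by (simp cong: sets_PiM_cong)
    fix A assume "\<And>i. i \<in> I \<Longrightarrow> A i \<in> sets ?\<nu>"
    then have A: "\<And>i. i \<in> I \<Longrightarrow> A i \<in> sets borel" by simp
    \<comment> \<open>Extended by the empty set outside \<open>I\<close>, so that measurability
      holds for every index.\<close>
    define B where "B i = (if i \<in> I then A i else {})" for i
    have B[measurable]: "B i \<in> sets borel" for i using A by (auto simp: B_def)
    have "(\<integral>w. complex_of_real (\<Prod>i\<in>I. indicator (B i) (Y i w)) \<partial>M) =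
        complex_of_real (\<Prod>i\<in>I. measure ?\<nu> (B i))"
      using step[of I B] by (simp add: of_real_indicator)
    then have *: "(\<integral>w. (\<Prod>i\<in>I. indicator (B i) (Y i w)) \<partial>M) = (\<Prod>i\<in>I. measure ?\<nu> (B i))"
      by (simp only: integral_complex_of_real of_real_eq_iff)
    have "emeasure (distr M (PiM I (\<lambda>_. borel)) (\<lambda>w. \<lambda>i\<in>I. Y i w)) (Pi\<^sub>E I A)
        = emeasure M ((\<lambda>w. \<lambda>i\<in>I. Y i w) -` (Pi\<^sub>E I A) \<inter> space M)"
      using A I by (intro emeasure_distr) auto
    also have "(\<lambda>w. \<lambda>i\<in>I. Y i w) -` (Pi\<^sub>E I A) \<inter> space M = {w \<in> space M. \<forall>i\<in>I. Y i w \<in> B i}"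
      by (auto simp: B_def PiE_iff)
    also have "emeasure M \<dots> = ennreal (\<integral>w. (\<Prod>i\<in>I. indicator (B i) (Y i w)) \<partial>M)"
    proof -
      have [measurable]: "{w \<in> space M. \<forall>i\<in>I. Y i w \<in> B i} \<in> sets M" using I by measurable
      have "measure M {w \<in> space M. \<forall>i\<in>I. Y i w \<in> B i} =
          (\<integral>w. indicator {w \<in> space M. \<forall>i\<in>I. Y i w \<in> B i} w \<partial>M)" by simp
      also have "\<dots> = (\<integral>w. (\<Prod>i\<in>I. indicator (B i) (Y i w)) \<partial>M)"
        using I by (intro Bochner_Integration.integral_cong refl)
          (auto simp: indicator_def prod_zero_iff intro!: prod.neutral[symmetric])
      finally show ?thesis by (simp add: emeasure_eq_measure)
    qed
    also have "\<dots> = (\<Prod>i\<in>I. emeasure ?\<nu> (B i))"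
      unfolding * by (simp add: \<nu>.emeasure_eq_measure prod_ennreal)
    also have "\<dots> = (\<Prod>i\<in>I. emeasure ?\<nu> (A i))" by (auto simp: B_def intro!: prod.cong)
    finally show "emeasure (distr M (PiM I (\<lambda>_. borel)) (\<lambda>w. \<lambda>i\<in>I. Y i w)) (Pi\<^sub>E I A)
      = (\<Prod>i\<in>I. emeasure ?\<nu> (A i))" .
  qed (rule I)
qed

subsection \<open>Laplace transforms and negative moments\<close>

text \<open>The integrand is \<tau> times a normal density of variance \<tau>^2 = 1/(1 + 2s).
  Positive \<open>s\<close> serves the negative moments, and negative \<open>s\<close> the
  exponential moments of the tail factor.\<close>

lemma nn_integral_std_normal_exp_sq:
  fixes s :: real
  assumes s: "- 1 / 2 < s"
  shows "(\<integral>\<^sup>+x. ennreal (exp (- s * x\<^sup>2)) \<partial>std_normal_distribution) = ennreal ((1 + 2 * s) powr (- 1 / 2))"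
proof -
  define \<tau> where "\<tau> = (1 + 2 * s) powr (- 1 / 2)"
  have \<tau>: "0 < \<tau>" using s by (simp add: \<tau>_def)
  have \<tau>2: "\<tau>\<^sup>2 = 1 / (1 + 2 * s)"
    using s by (simp add: \<tau>_def powr_minus_divide power_divide powr_half_sqrt)
  have eq: "std_normal_density x * exp (- s * x\<^sup>2) = \<tau> * normal_density 0 \<tau> x" for x
  proof -
    have "x\<^sup>2 / (2 * \<tau>\<^sup>2) = x\<^sup>2 / 2 + s * x\<^sup>2"
      using s by (simp add: \<tau>2 field_simps)
    then have "exp (- (x\<^sup>2) / 2) * exp (- s * x\<^sup>2) = exp (- (x\<^sup>2) / (2 * \<tau>\<^sup>2))"
      by (simp flip: exp_add)
    moreover have "sqrt (2 * pi * \<tau>\<^sup>2) = \<tau> * sqrt (2 * pi)"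
      using \<tau> by (simp add: real_sqrt_mult)
    ultimately show ?thesis using \<tau> by (simp add: normal_density_def)
  qed
  have "(\<integral>\<^sup>+x. ennreal (exp (- s * x\<^sup>2)) \<partial>std_normal_distribution)
      = (\<integral>\<^sup>+x. ennreal \<tau> * ennreal (normal_density 0 \<tau> x) \<partial>lborel)"
    using \<tau> by (subst nn_integral_density)
      (auto intro!: nn_integral_cong simp: eq[symmetric] ennreal_mult'[symmetric] normal_density_nonneg)
  also have "\<dots> = ennreal \<tau> * (\<integral>\<^sup>+x. ennreal (normal_density 0 \<tau> x) \<partial>lborel)"
    by (rule nn_integral_cmult) simp
  also have "(\<integral>\<^sup>+x. ennreal (normal_density 0 \<tau> x) \<partial>lborel) = 1"
    using \<tau> by (subst nn_integral_eq_integral)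
      (auto simp: integrable_normal_density integral_normal_density)
  finally show ?thesis by (simp add: \<tau>_def)
qed

lemma nn_integral_Gamma_scaled:
  fixes a r :: real
  assumes a: "0 < a" and r: "0 < r"
  shows "(\<integral>\<^sup>+s\<in>{0<..}. ennreal (s powr (a - 1) * exp (- r * s)) \<partial>lborel) = ennreal (Gamma a / r powr a)"
proof -
  have "((\<lambda>t. t powr (a - 1) / exp t) has_integral Gamma a) {0..}"
    by (rule Gamma_integral_real[OF a])
  then have "(\<integral>\<^sup>+s\<in>{0..}. ennreal (s powr (a - 1) / exp s) \<partial>lborel) = ennreal (Gamma a)"
    by (intro nn_integral_has_integral_lebesgue') auto
  moreover have "(\<integral>\<^sup>+s\<in>{0..}. ennreal (s powr (a - 1) / exp s) \<partial>lborel)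
    = (\<integral>\<^sup>+s\<in>{0<..}. ennreal (s powr (a - 1) / exp s) \<partial>lborel)"
    by (intro nn_integral_cong) (auto simp: indicator_def)
  ultimately have G: "(\<integral>\<^sup>+s\<in>{0<..}. ennreal (s powr (a - 1) / exp s) \<partial>lborel) = ennreal (Gamma a)"
    by simp
  have "(\<integral>\<^sup>+s\<in>{0<..}. ennreal (s powr (a - 1) / exp s) \<partial>lborel)
    = ennreal \<bar>r\<bar> * (\<integral>\<^sup>+s. ennreal ((0 + r * s) powr (a - 1) / exp (0 + r * s)) * indicator {0<..} (0 + r * s) \<partial>lborel)"
    using r by (intro nn_integral_real_affine) auto
  also have "\<dots> = ennreal r * (\<integral>\<^sup>+s. ennreal (r powr (a - 1)) *
      (ennreal (s powr (a - 1) * exp (- r * s)) * indicator {0<..} s) \<partial>lborel)"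
  proof -
    have "ennreal ((0 + r * s) powr (a - 1) / exp (0 + r * s)) * indicator {0<..} (0 + r * s)
      = ennreal (r powr (a - 1)) * (ennreal (s powr (a - 1) * exp (- r * s)) * indicator {0<..} s)" for s
      using r by (cases "0 < s")
        (simp_all add: indicator_def zero_less_mult_iff powr_mult exp_minus divide_inverse
          ennreal_mult'[symmetric] mult.assoc)
    then show ?thesis using r by simp
  qed
  also have "\<dots> = ennreal r * (ennreal (r powr (a - 1)) *
      (\<integral>\<^sup>+s\<in>{0<..}. ennreal (s powr (a - 1) * exp (- r * s)) \<partial>lborel))"
    by (subst nn_integral_cmult) auto
  also have "\<dots> = ennreal (r powr a) * (\<integral>\<^sup>+s\<in>{0<..}. ennreal (s powr (a - 1) * exp (- r * s)) \<partial>lborel)"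
    using r by (simp add: mult.assoc[symmetric] ennreal_mult'[symmetric] powr_diff)
  finally have "ennreal (r powr a) * (\<integral>\<^sup>+s\<in>{0<..}. ennreal (s powr (a - 1) * exp (- r * s)) \<partial>lborel)
    = ennreal (Gamma a)"
    using G by simp
  moreover have "ennreal (Gamma a) = ennreal (r powr a) * ennreal (Gamma a / r powr a)"
    using r by (simp add: ennreal_mult'[symmetric])
  ultimately show ?thesis
    using r by (simp add: ennreal_mult_cancel_left)
qed

text \<open>Extended so that \<open>0\<close> to a negative power is infinite, unlike \<^const>\<open>powr\<close>.\<close>

definition neg_power :: "real \<Rightarrow> real \<Rightarrow> ennreal" where
  "neg_power a x = (if x \<le> 0 then \<infinity> else ennreal (x powr - a))"

lemma neg_power_measurable [measurable]: "neg_power a \<in> borel_measurable borel"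
  unfolding neg_power_def by measurable

text \<open>For positive \<open>x\<close> this is the Gamma integral after scaling. At
  \<open>x = 0\<close> the left side is infinite, and divergence of the right side is obtained by
  exceeding every real bound.\<close>

lemma neg_power_le_Gamma_integral:
  assumes a: "0 < a" and x: "0 \<le> x"
  shows "ennreal (Gamma a) * neg_power a x \<le>
    (\<integral>\<^sup>+s\<in>{0<..}. ennreal (s powr (a - 1)) * ennreal (exp (- s * x)) \<partial>lborel)"
proof (cases "x = 0")
  case False
  then show ?thesis
    using nn_integral_Gamma_scaled[OF a, of x] x Gamma_real_pos[OF a]
    by (simp add: neg_power_def ennreal_mult'[symmetric] powr_minus_divide mult.commute)
next
  case True
  have *: "ennreal b \<le> (\<integral>\<^sup>+s\<in>{0<..}. ennreal (s powr (a - 1)) \<partial>lborel)" if b: "0 < b" for b :: real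
  proof -
    \<comment> \<open>Chosen so that the Gamma integral with rate \<open>r\<close> has exactly the
      value \<open>b\<close>.\<close>
    define r where "r = (Gamma a / b) powr (1 / a)"
    have G0: "Gamma a \<noteq> 0" using Gamma_real_pos[OF a] by linarith
    have "0 < r" using a b G0 by (simp add: r_def)
    moreover have "r powr a = Gamma a / b"
      using a b Gamma_real_pos[OF a] by (simp add: r_def powr_powr)
    ultimately have "ennreal b = (\<integral>\<^sup>+s\<in>{0<..}. ennreal (s powr (a - 1) * exp (- r * s)) \<partial>lborel)"
      using nn_integral_Gamma_scaled[OF a, of r] G0 b by simp
    also have "\<dots> \<le> (\<integral>\<^sup>+s\<in>{0<..}. ennreal (s powr (a - 1)) \<partial>lborel)"
      using \<open>0 < r\<close> by (intro nn_integral_mono)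
        (auto simp: indicator_def intro!: ennreal_leI mult_left_le)
    finally show ?thesis .
  qed
  have "(\<integral>\<^sup>+s\<in>{0<..}. ennreal (s powr (a - 1)) \<partial>lborel) = \<infinity>"
  proof (rule ccontr)
    assume "(\<integral>\<^sup>+s\<in>{0<..}. ennreal (s powr (a - 1)) \<partial>lborel) \<noteq> \<infinity>"
    then obtain z where "0 \<le> z" "(\<integral>\<^sup>+s\<in>{0<..}. ennreal (s powr (a - 1)) \<partial>lborel) = ennreal z"
      by (cases "\<integral>\<^sup>+s\<in>{0<..}. ennreal (s powr (a - 1)) \<partial>lborel") auto
    with *[of "z + 1"] show False by simp
  qed
  then show ?thesis using True by simp
qed

text \<open>Integrating the Laplace transform against \<open>s powr (a - 1)\<close> turns it into a
  negative moment. The bound is the exact moment of order -a of a chi-square variable with 2c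
  degrees of freedom, while for \<open>D\<close> a bound on the Laplace transform is enough.\<close>

lemma neg_power_moment_le:
  fixes D :: "'w \<Rightarrow> real" and a c :: real
  assumes "sigma_finite_measure P"
    and [measurable]: "D \<in> borel_measurable P" and D: "\<And>w. w \<in> space P \<Longrightarrow> 0 \<le> D w"
    and L: "\<And>s. 0 < s \<Longrightarrow> (\<integral>\<^sup>+w. ennreal (exp (- s * D w)) \<partial>P) \<le> ennreal ((1 + 2 * s) powr - c)"
    and ac: "0 < a" "a < c"
  shows "(\<integral>\<^sup>+w. neg_power a (D w) \<partial>P) \<le> ennreal (Gamma (c - a) / (2 powr a * Gamma c))"
proof -
  interpret P: sigma_finite_measure P by fact
  interpret pair_sigma_finite P lborel ..
  have pos: "0 < Gamma a" "0 < Gamma c" "0 < Gamma (c - a)" using ac by (auto intro: Gamma_real_pos)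
  have 1: "ennreal (Gamma a) * (\<integral>\<^sup>+w. neg_power a (D w) \<partial>P)
      \<le> (\<integral>\<^sup>+s\<in>{0<..}. ennreal (s powr (a - 1)) * ennreal ((1 + 2 * s) powr - c) \<partial>lborel)"
  proof -
    have "ennreal (Gamma a) * (\<integral>\<^sup>+w. neg_power a (D w) \<partial>P) = (\<integral>\<^sup>+w. ennreal (Gamma a) * neg_power a (D w) \<partial>P)"
      by (subst nn_integral_cmult) auto
    also have "\<dots> \<le> (\<integral>\<^sup>+w. (\<integral>\<^sup>+s\<in>{0<..}. ennreal (s powr (a - 1)) * ennreal (exp (- s * D w)) \<partial>lborel) \<partial>P)"
      by (intro nn_integral_mono neg_power_le_Gamma_integral ac D)
    also have "\<dots> = (\<integral>\<^sup>+s. (\<integral>\<^sup>+w. ennreal (s powr (a - 1)) * ennreal (exp (- s * D w)) * indicator {0<..} s \<partial>P) \<partial>lborel)"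
      by (subst Fubini'[symmetric]) auto
    also have "\<dots> = (\<integral>\<^sup>+s. (ennreal (s powr (a - 1)) * indicator {0<..} s) * (\<integral>\<^sup>+w. ennreal (exp (- s * D w)) \<partial>P) \<partial>lborel)"
      by (intro nn_integral_cong, subst nn_integral_cmult[symmetric]) (auto simp: mult_ac)
    also have "\<dots> \<le> (\<integral>\<^sup>+s. (ennreal (s powr (a - 1)) * indicator {0<..} s) * ennreal ((1 + 2 * s) powr - c) \<partial>lborel)"
      using L by (intro nn_integral_mono) (auto simp: indicator_def intro!: mult_left_mono)
    finally show ?thesis by (simp add: mult_ac)
  qed
  \<comment> \<open>Evaluates a Beta integral: the power of \<open>1 + 2 * s\<close> is itself
    written as a Gamma integral in \<open>y\<close>, and after exchanging the order both
    integrations are Gamma integrals.\<close>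
  have "ennreal (Gamma c) * (\<integral>\<^sup>+s\<in>{0<..}. ennreal (s powr (a - 1)) * ennreal ((1 + 2 * s) powr - c) \<partial>lborel)
      = (\<integral>\<^sup>+s. (\<integral>\<^sup>+y. ennreal (s powr (a - 1)) * indicator {0<..} s *
           (ennreal (y powr (c - 1) * exp (- (1 + 2 * s) * y)) * indicator {0<..} y) \<partial>lborel) \<partial>lborel)"
  proof (subst nn_integral_cmult[symmetric], simp, intro nn_integral_cong)
    fix s :: real
    show "ennreal (Gamma c) * (ennreal (s powr (a - 1)) * ennreal ((1 + 2 * s) powr - c) * indicator {0<..} s) =
      (\<integral>\<^sup>+y. ennreal (s powr (a - 1)) * indicator {0<..} s *
           (ennreal (y powr (c - 1) * exp (- (1 + 2 * s) * y)) * indicator {0<..} y) \<partial>lborel)"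
    proof (cases "0 < s")
      case True
      have G: "(\<integral>\<^sup>+y\<in>{0<..}. ennreal (y powr (c - 1) * exp (- (1 + 2 * s) * y)) \<partial>lborel)
          = ennreal (Gamma c) * ennreal ((1 + 2 * s) powr - c)"
        using pos ac True nn_integral_Gamma_scaled[of c "1 + 2 * s"]
        by (simp add: ennreal_mult'[symmetric] powr_minus_divide)
      show ?thesis
        by (subst nn_integral_cmult, simp, subst G) (use True in \<open>simp add: mult_ac\<close>)
    qed simp
  qed
  also have "\<dots> = (\<integral>\<^sup>+y. (\<integral>\<^sup>+s. ennreal (s powr (a - 1)) * indicator {0<..} s *
           (ennreal (y powr (c - 1) * exp (- (1 + 2 * s) * y)) * indicator {0<..} y) \<partial>lborel) \<partial>lborel)"
    by (subst lborel_pair.Fubini') auto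
  also have "\<dots> = (\<integral>\<^sup>+y. ennreal (Gamma a / 2 powr a) *
      (ennreal (y powr (c - a - 1) * exp (- 1 * y)) * indicator {0<..} y) \<partial>lborel)"
  proof (intro nn_integral_cong)
    fix y :: real
    show "(\<integral>\<^sup>+s. ennreal (s powr (a - 1)) * indicator {0<..} s *
           (ennreal (y powr (c - 1) * exp (- (1 + 2 * s) * y)) * indicator {0<..} y) \<partial>lborel) =
      ennreal (Gamma a / 2 powr a) * (ennreal (y powr (c - a - 1) * exp (- 1 * y)) * indicator {0<..} y)"
    proof (cases "0 < y")
      case True
      have "(\<integral>\<^sup>+s. ennreal (s powr (a - 1)) * indicator {0<..} s *
           (ennreal (y powr (c - 1) * exp (- (1 + 2 * s) * y)) * indicator {0<..} y) \<partial>lborel) =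
        (\<integral>\<^sup>+s. ennreal (y powr (c - 1) * exp (- 1 * y)) *
           (ennreal (s powr (a - 1) * exp (- (2 * y) * s)) * indicator {0<..} s) \<partial>lborel)"
        using True by (intro nn_integral_cong)
          (auto simp: indicator_def ennreal_mult'[symmetric] exp_add[symmetric] algebra_simps)
      also have "\<dots> = ennreal (y powr (c - 1) * exp (- 1 * y)) * ennreal (Gamma a / (2 * y) powr a)"
        by (subst nn_integral_cmult, simp, subst nn_integral_Gamma_scaled) (use True ac in auto)
      also have "\<dots> = ennreal (Gamma a / 2 powr a * (y powr (c - a - 1) * exp (- 1 * y)))"
        using True pos by (simp add: ennreal_mult'[symmetric] powr_mult powr_diff powr_add field_simps)
      finally show ?thesis using True pos by (simp add: ennreal_mult'[symmetric] mult.assoc)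
    qed simp
  qed
  also have "\<dots> = ennreal (Gamma a / 2 powr a) * ennreal (Gamma (c - a) / 1 powr (c - a))"
    using ac by (subst nn_integral_cmult) (auto simp: nn_integral_Gamma_scaled[of "c - a" 1, simplified])
  also have "\<dots> = ennreal (Gamma a) * ennreal (Gamma c) * ennreal (Gamma (c - a) / (2 powr a * Gamma c))"
    using pos by (simp add: ennreal_mult'[symmetric] field_simps)
  finally have 2: "ennreal (Gamma c) * (\<integral>\<^sup>+s\<in>{0<..}. ennreal (s powr (a - 1)) * ennreal ((1 + 2 * s) powr - c) \<partial>lborel)
      = ennreal (Gamma a) * ennreal (Gamma c) * ennreal (Gamma (c - a) / (2 powr a * Gamma c))" .
  have "ennreal (Gamma a * Gamma c) * (\<integral>\<^sup>+w. neg_power a (D w) \<partial>P)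
      \<le> ennreal (Gamma a * Gamma c) * ennreal (Gamma (c - a) / (2 powr a * Gamma c))"
    using mult_left_mono[OF 1, of "ennreal (Gamma c)"] pos unfolding 2
    by (simp add: ennreal_mult' mult_ac)
  then show ?thesis
    using pos by (subst (asm) ennreal_mult_le_mult_iff) auto
qed

section \<open>Elementary estimates for the moment constants\<close>

lemma ln_le_half_diff_inverse:
  assumes "1 \<le> (x::real)"
  shows "ln x \<le> (x - 1 / x) / 2"
proof -
  let ?g = "\<lambda>x::real. (x - 1 / x) / 2 - ln x"
  have "?g 1 \<le> ?g x"
  proof (rule DERIV_nonneg_imp_nondecreasing[OF assms])
    fix u :: real assume u: "1 \<le> u" "u \<le> x"
    have "(?g has_real_derivative ((1 + 1 / u\<^sup>2) / 2 - 1 / u)) (at u)"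
      using u by (auto intro!: derivative_eq_intros simp: power2_eq_square)
    moreover have "(1 + 1 / u\<^sup>2) / 2 - 1 / u = (1 - 1 / u)\<^sup>2 / 2"
      using u by (simp add: power2_eq_square field_simps)
    ultimately show "\<exists>y. (?g has_real_derivative y) (at u) \<and> 0 \<le> y"
      by (intro exI[of _ "(1 - 1 / u)\<^sup>2 / 2"]) simp
  qed
  then show ?thesis by simp
qed

text \<open>Controls the quotient of consecutive constants in the Gamma bound. There is little room:
  the limit is e, and the estimate ln z \<le> z - 1 would only give exp(4/3) > 3 at y = 3/2, whence
  the sharper logarithm bound.\<close>

lemma one_plus_inverse_powr_le_3:
  assumes y: "3 / 2 \<le> (y::real)"
  shows "(1 + 1 / y) powr (y + 1 / 2) \<le> 3"
proof -
  have "ln (1 + 1 / y) \<le> ((1 + 1 / y) - 1 / (1 + 1 / y)) / 2"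
    using y by (intro ln_le_half_diff_inverse) simp
  also have "\<dots> = (2 * y + 1) / (2 * (y * (y + 1)))" using y by (simp add: field_simps)
  finally have "(y + 1 / 2) * ln (1 + 1 / y) \<le> (y + 1 / 2) * ((2 * y + 1) / (2 * (y * (y + 1))))"
    using y by (intro mult_left_mono) auto
  also have "\<dots> = 1 + 1 / (4 * (y * (y + 1)))"
  proof -
    define z where "z = y * (y + 1)"
    have "(y + 1 / 2) * (2 * y + 1) = 2 * z + 1 / 2" by (simp add: z_def algebra_simps)
    then have "(y + 1 / 2) * ((2 * y + 1) / (2 * z)) = (2 * z + 1 / 2) / (2 * z)"
      by (simp only: times_divide_eq_right)
    also have "\<dots> = 1 + 1 / (4 * z)" using y by (simp add: z_def add_divide_distrib)
    finally show ?thesis by (simp add: z_def)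
  qed
  also have "\<dots> \<le> 1 + 1 / 15"
  proof -
    have "(3 / 2) * (5 / 2) \<le> y * (y + 1)" using y by (intro mult_mono) auto
    then show ?thesis by (simp add: field_simps)
  qed
  finally have le: "(y + 1 / 2) * ln (1 + 1 / y) \<le> 1 + 1 / 15" .
  have "(1 + 1 / y) powr (y + 1 / 2) = exp ((y + 1 / 2) * ln (1 + 1 / y))"
    using y add_pos_pos[of 1 "1 / y"] by (simp add: powr_def)
  also have "\<dots> \<le> exp (1 + 1 / 15)" using le by simp
  also have "\<dots> = exp 1 * exp (1 / 15)" by (rule exp_add)
  \<comment> \<open>From exp(-u) \<ge> 1 - u at u = 1/15; the final product 2.72 * 15/14 is below
    3.\<close>
  also have "exp (1 / 15) \<le> (15 / 14 :: real)"
    using exp_ge_add_one_self[of "- (1 / 15) :: real"] by (simp add: exp_minus field_simps)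
  also have "exp 1 \<le> (272 / 100 :: real)" using e_less_272 by simp
  finally show ?thesis by simp
qed

text \<open>The origin of the constant 3 of the tail bound. The recursion of Gamma shifts its
  argument by 1, which is a step from p to p + 2, hence the two base cases; p = 2 is an
  equality.\<close>

lemma Gamma_half_lower_bound:
  assumes "2 \<le> (p::nat)"
  shows "sqrt pi * (real p + 1) powr (real p / 2) \<le> 6 powr (real p / 2) * Gamma ((real p + 1) / 2)"
  using assms
proof (induction p rule: less_induct)
  case (less p)
  consider "p = 2" | "p = 3" | q where "p = q + 2" "2 \<le> q"
    using less.prems by (metis add_le_cancel_right le_Suc_ex linorder_not_less numeral_2_eq_2
        numeral_3_eq_3 less_2_cases_iff add.commute add_Suc_right add_0_right One_nat_def)
  then show ?case
  proof cases
    case 1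
    have not_pos: "(1 / 2 :: real) \<notin> \<int>\<^sub>\<le>\<^sub>0" by (auto elim!: nonpos_Ints_cases)
    have "Gamma ((2 + 1) / 2 :: real) = sqrt pi / 2"
      using Gamma_plus1[of "1/2::real"] not_pos by (simp add: Gamma_one_half_real)
    with 1 show ?thesis by simp
  next
    case 2
    have G: "Gamma ((3 + 1) / 2 :: real) = 1" by (simp add: Gamma_numeral)
    have "(4::real) powr (3 / 2) = 8" using powr_powr[of "2::real" 2 "3/2"] by simp
    moreover have "(6::real) powr (3 / 2) = sqrt 216"
      using powr_half_sqrt[of "6 ^ 3"] powr_powr[of "6::real" 3 "1/2"] by simp
    moreover have "sqrt pi * 8 = sqrt (pi * 64)" by (simp add: real_sqrt_mult)
    moreover have "pi * 64 \<le> 216" using pi_less_4 pi_approx by simp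
    ultimately show ?thesis using 2 G by simp
  next
    case 3
    define x where "x = real q"
    have x: "2 \<le> x" using 3 by (simp add: x_def)
    have IH: "sqrt pi * (x + 1) powr (x / 2) \<le> 6 powr (x / 2) * Gamma ((x + 1) / 2)"
      using less.IH[of q] 3 by (simp add: x_def)
    have p: "real p = x + 2" using 3 by (simp add: x_def)
    \<comment> \<open>With y = (x + 1)/2 the left side acquires the factor (x + 1) (1 + 1/y)^(y +
      1/2), while the right side acquires 6 y = 3 (x + 1). The step therefore asks exactly for the
      bound 3.\<close>
    have "x + 3 = (x + 1) * (1 + 2 / (x + 1))" using x by (simp add: field_simps)
    then have "(x + 3) powr (x / 2 + 1) = ((x + 1) * (1 + 2 / (x + 1))) powr (x / 2 + 1)" by simp
    also have "\<dots> = (x + 1) powr (x / 2 + 1) * (1 + 1 / ((x + 1) / 2)) powr ((x + 1) / 2 + 1 / 2)"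
    proof -
      have "1 / ((x + 1) / 2) = 2 / (x + 1)" "(x + 1) / 2 + 1 / 2 = x / 2 + 1"
        by (simp, simp add: add_divide_distrib)
      then show ?thesis using x by (simp only: powr_mult)
    qed
    also have "\<dots> \<le> (x + 1) powr (x / 2 + 1) * 3"
      using x by (intro mult_left_mono one_plus_inverse_powr_le_3) auto
    also have "\<dots> = 3 * (x + 1) * (x + 1) powr (x / 2)" using x by (simp add: powr_add)
    finally have "sqrt pi * (x + 3) powr (x / 2 + 1) \<le> 3 * (x + 1) * (sqrt pi * (x + 1) powr (x / 2))"
      by (simp add: mult_ac mult_left_mono)
    also have "\<dots> \<le> 3 * (x + 1) * (6 powr (x / 2) * Gamma ((x + 1) / 2))"
      using x IH by (intro mult_left_mono) auto
    also have "\<dots> = 6 powr (x / 2 + 1) * ((x + 1) / 2 * Gamma ((x + 1) / 2))"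
      by (simp add: powr_add)
    also have "(x + 1) / 2 * Gamma ((x + 1) / 2) = Gamma ((x + 1) / 2 + 1)"
      using x by (subst Gamma_plus1) (auto simp: nonpos_Ints_of_int elim!: nonpos_Ints_cases)
    finally show ?thesis unfolding p by (simp add: add_divide_distrib algebra_simps)
  qed
qed

text \<open>The moment constant for order p/2 and p + 1 degrees of freedom. The difference of the
  arguments is 1/2, which produces the factor sqrt(pi) of the Gamma bound.\<close>

lemma neg_moment_constant_le:
  assumes "2 \<le> (p::nat)"
  shows "Gamma ((real p + 1) / 2 - real p / 2) / (2 powr (real p / 2) * Gamma ((real p + 1) / 2))
    \<le> (3 / (real p + 1)) powr (real p / 2)"
proof -
  have G: "0 < Gamma ((real p + 1) / 2)" by (intro Gamma_real_pos) simp
  have "Gamma ((real p + 1) / 2 - real p / 2) = sqrt pi"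
    by (simp add: add_divide_distrib Gamma_one_half_real)
  moreover have "(3 / (real p + 1)) powr (real p / 2)
      = 6 powr (real p / 2) / (2 powr (real p / 2) * (real p + 1) powr (real p / 2))"
  proof -
    have "3 / (real p + 1) = 6 / (2 * (real p + 1))" by (simp add: field_simps)
    then show ?thesis by (simp only: powr_divide powr_mult)
  qed
  ultimately show ?thesis
    using Gamma_half_lower_bound[OF assms] G
    by (simp only:) (simp add: divide_le_eq pos_le_divide_eq pos_divide_le_eq mult_ac)
qed

text \<open>The mean of the inverse of a chi-square variable with p + 1 degrees of freedom, finite
  since p \<ge> 2.\<close>

lemma inverse_moment_constant:
  assumes "2 \<le> (p::nat)"
  shows "Gamma ((real p + 1) / 2 - 1) / (2 powr 1 * Gamma ((real p + 1) / 2)) = 1 / (real p - 1)"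
proof -
  define c where "c = (real p - 1) / 2"
  have c: "0 < c" using assms by (simp add: c_def)
  have "Gamma (c + 1) = c * Gamma c"
    using c by (subst Gamma_plus1) (auto elim!: nonpos_Ints_cases)
  moreover have p: "(real p + 1) / 2 = c + 1" "real p - 1 = 2 * c" by (auto simp: c_def field_simps)
  moreover have "Gamma c \<noteq> 0" using Gamma_real_pos[OF c] by linarith
  ultimately show ?thesis using c unfolding p by simp
qed

subsection \<open>Distance of a Gaussian vector from the span of independent ones\<close>

text \<open>Euclidean space of dimension \<open>l\<close> is treated as the square-integrable
  functions for the counting measure, so that the projection results above apply to rows of the test
  matrix.\<close>

lemma L2_space_count_space [simp]: "f \<in> L2_space (count_space {..<l::nat})"
  by (simp add: L2_space_def integrable_count_space)

lemma L2_inner_count_space [simp]: "L2_inner (count_space {..<l::nat}) f g = (\<Sum>i<l. f i * g i)"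
  by (simp add: L2_inner_def lebesgue_integral_count_space_finite)

lemma sum_mult_delta:
  fixes h :: "'b \<Rightarrow> 'c :: semiring_1"
  assumes "finite A" "a \<in> A"
  shows "(\<Sum>b\<in>A. h b * (if a = b then 1 else 0)) = h a"
proof -
  have "(\<Sum>b\<in>A. h b * (if a = b then 1 else 0)) = (\<Sum>b\<in>A. if a = b then h b else 0)"
    by (intro sum.cong) auto
  then show ?thesis using assms by (simp add: sum.delta')
qed

text \<open>Padding with zero rows gives a square matrix. Row \<open>r\<close> is zero, so the
  transpose annihilates the unit vector \<open>r\<close> and the determinant vanishes.\<close>

lemma underdetermined_system_nontrivial:
  fixes z :: "nat \<Rightarrow> nat \<Rightarrow> real"
  assumes "r < l"
  shows "\<exists>x. (\<exists>i<l. x i \<noteq> 0) \<and> (\<forall>a<r. (\<Sum>i<l. z a i * x i) = 0)"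
proof -
  define A where "A = mat l l (\<lambda>(a, i). if a < r then z a i else 0)"
  have A: "A \<in> carrier_mat l l" by (simp add: A_def)
  have "transpose_mat A *\<^sub>v unit_vec l r = 0\<^sub>v l"
    using assms by (intro eq_vecI) (auto simp: A_def scalar_prod_def unit_vec_def intro!: sum.neutral)
  moreover have "unit_vec l r \<noteq> (0\<^sub>v l :: real vec)"
  proof
    assume "unit_vec l r = (0\<^sub>v l :: real vec)"
    then have "unit_vec l r $ r = (0\<^sub>v l :: real vec) $ r" by simp
    then show False using assms by (simp add: unit_vec_def)
  qed
  ultimately have "det (transpose_mat A) = 0"
    by (intro iffD2[OF det_0_iff_vec_prod_zero_field[of _ l]] exI[of _ "unit_vec l r"]) (use A in auto)
  then have "det A = 0" using det_transpose[OF A] by simp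
  then obtain v where v: "v \<in> carrier_vec l" "v \<noteq> 0\<^sub>v l" "A *\<^sub>v v = 0\<^sub>v l"
    using det_0_iff_vec_prod_zero_field[OF A] by auto
  have "\<exists>i<l. v $ i \<noteq> 0" using v by (metis carrier_vecD eq_vecI index_zero_vec)
  moreover have "(\<Sum>i<l. z a i * v $ i) = 0" if "a < r" for a
  proof -
    have "(A *\<^sub>v v) $ a = 0" using v that assms by simp
    then show ?thesis
      using that assms v by (simp add: A_def scalar_prod_def atLeast0LessThan)
  qed
  ultimately show ?thesis by blast
qed

text \<open>Each further vector solves the homogeneous system given by the \<open>y j\<close> and
  the vectors already found. Only the number of equations matters, so the \<open>y j\<close> may be
  dependent.\<close>

lemma orthonormal_complement_exists:
  fixes y :: "nat \<Rightarrow> nat \<Rightarrow> real"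
  assumes "m + n \<le> l"
  shows "\<exists>e. (\<forall>a<n. \<forall>b<n. (\<Sum>i<l. e a i * e b i) = (if a = b then 1 else 0)) \<and>
             (\<forall>a<n. \<forall>j<m. (\<Sum>i<l. y j i * e a i) = 0)"
  using assms
proof (induction n)
  case (Suc n)
  then have "m + n \<le> l" by simp
  from Suc.IH[OF this] obtain e
    where "\<forall>a<n. \<forall>b<n. (\<Sum>i<l. e a i * e b i) = (if a = b then 1 else 0)"
      "\<forall>a<n. \<forall>j<m. (\<Sum>i<l. y j i * e a i) = 0" by (elim exE conjE)
  note e = this[rule_format]
  define z where "z a = (if a < m then y a else e (a - m))" for a
  obtain x where x: "\<exists>i<l. x i \<noteq> 0" "\<And>a. a < m + n \<Longrightarrow> (\<Sum>i<l. z a i * x i) = 0"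
    using underdetermined_system_nontrivial[of "m + n" l z] Suc.prems by auto
  define c where "c = (\<Sum>i<l. (x i)\<^sup>2)"
  obtain i0 where "i0 < l" "x i0 \<noteq> 0" using x(1) by blast
  then have c: "0 < c" unfolding c_def by (intro sum_pos2[of "{..<l}" i0]) auto
  define f where "f i = x i / sqrt c" for i
  have f1: "(\<Sum>i<l. f i * f i) = 1"
    using c by (simp add: f_def power2_eq_square[symmetric] power_divide flip: sum_divide_distrib c_def)
  have f2: "(\<Sum>i<l. y j i * f i) = 0" if "j < m" for j
    using x(2)[of j] that by (simp add: f_def z_def flip: sum_divide_distrib)
  have f3: "(\<Sum>i<l. e a i * f i) = 0" "(\<Sum>i<l. f i * e a i) = 0" if "a < n" for a
    using x(2)[of "m + a"] that by (simp_all add: f_def z_def mult.commute flip: sum_divide_distrib)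
  show ?case
    by (rule exI[of _ "e(n := f)"]) (use e f1 f2 f3 in \<open>auto simp: less_Suc_eq\<close>)
qed simp

definition span_dist_sq :: "nat \<Rightarrow> nat \<Rightarrow> (nat \<Rightarrow> nat \<Rightarrow> real) \<Rightarrow> (nat \<Rightarrow> real) \<Rightarrow> real" where
  "span_dist_sq l m G g =
    (L2_norm (count_space {..<l}) (\<lambda>i. g i - orth_proj (count_space {..<l}) (col_span m G) g i))\<^sup>2"

lemma span_dist_sq_nonneg [simp]: "0 \<le> span_dist_sq l m G g"
  by (simp add: span_dist_sq_def)

lemma span_dist_sq_le: "span_dist_sq l m G g \<le> (\<Sum>i<l. (g i - (\<Sum>j<m. a j * G j i))\<^sup>2)"
proof -
  have "L2_norm (count_space {..<l}) (\<lambda>i. g i - orth_proj (count_space {..<l}) (col_span m G) g i)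
    \<le> L2_norm (count_space {..<l}) (\<lambda>i. g i - (\<Sum>j<m. a j * G j i))"
    by (rule orth_proj_minimal) (auto simp: col_span_def)
  then have "span_dist_sq l m G g \<le> (L2_norm (count_space {..<l}) (\<lambda>i. g i - (\<Sum>j<m. a j * G j i)))\<^sup>2"
    unfolding span_dist_sq_def by (intro power_mono) auto
  then show ?thesis
    by (simp only: L2_norm_sq L2_inner_count_space power2_eq_square[symmetric])
qed

lemma span_dist_sq_attained:
  obtains a where "span_dist_sq l m G g = (\<Sum>i<l. (g i - (\<Sum>j<m. a j * G j i))\<^sup>2)"
    and "\<And>j. j < m \<Longrightarrow> (\<Sum>i<l. (g i - (\<Sum>j<m. a j * G j i)) * G j i) = 0"
proof -
  let ?C = "count_space {..<l}" and ?g = "orth_proj (count_space {..<l}) (col_span m G) g"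
  have "?g \<in> col_span m G" by (rule orth_proj_in_span) auto
  then obtain a where a: "?g = (\<lambda>i. \<Sum>j<m. a j * G j i)" by (auto simp: col_span_def)
  have "G j \<in> col_span m G" if "j < m" for j
    using that unfolding col_span_def
    by (intro CollectI exI[of _ "\<lambda>i. if i = j then 1 else 0"]) (simp add: if_distrib if_distribR cong: if_cong)
  then have "L2_inner ?C (\<lambda>i. g i - ?g i) (G j) = 0" if "j < m" for j
    using that by (intro orth_proj_orthogonal) auto
  with a show ?thesis
    by (intro that[of a])
      (simp_all only: span_dist_sq_def L2_norm_sq L2_inner_count_space power2_eq_square[symmetric])
qed

lemma span_dist_sq_cong:
  assumes "\<And>i j. i < l \<Longrightarrow> j < m \<Longrightarrow> G j i = G' j i" "\<And>i. i < l \<Longrightarrow> g i = g' i"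
  shows "span_dist_sq l m G g = span_dist_sq l m G' g'"
proof -
  have le: "span_dist_sq l m G g \<le> span_dist_sq l m G' g'"
    if "\<And>i j. i < l \<Longrightarrow> j < m \<Longrightarrow> G j i = G' j i" "\<And>i. i < l \<Longrightarrow> g i = g' i" for G G' g g'
  proof -
    obtain a where "span_dist_sq l m G' g' = (\<Sum>i<l. (g' i - (\<Sum>j<m. a j * G' j i))\<^sup>2)"
      by (rule span_dist_sq_attained)
    also have "\<dots> = (\<Sum>i<l. (g i - (\<Sum>j<m. a j * G j i))\<^sup>2)"
      using that by (intro sum.cong) auto
    also have "\<dots> \<ge> span_dist_sq l m G g" by (rule span_dist_sq_le)
    finally show ?thesis .
  qed
  show ?thesis using assms by (intro antisym le) auto
qed

lemma span_dist_sq_measurable: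
  assumes [measurable]: "\<And>i. i < l \<Longrightarrow> (\<lambda>w. g w i) \<in> borel_measurable M"
    "\<And>i j. i < l \<Longrightarrow> j < m \<Longrightarrow> (\<lambda>w. G w j i) \<in> borel_measurable M"
  shows "(\<lambda>w. span_dist_sq l m (G w) (g w)) \<in> borel_measurable M"
  unfolding span_dist_sq_def
  by (intro borel_measurable_power borel_measurable_orth_proj_residual) (auto simp: L2_norm_def)

text \<open>Bessel's inequality for the residual: each \<open>e a\<close> is orthogonal to the span,
  so it has the same inner product with the residual as with \<open>g\<close>.\<close>

lemma span_dist_sq_ge_complement:
  fixes e :: "nat \<Rightarrow> nat \<Rightarrow> real"
  assumes e: "\<And>a b. a < n \<Longrightarrow> b < n \<Longrightarrow> (\<Sum>i<l. e a i * e b i) = (if a = b then 1 else 0)"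
    "\<And>a j. a < n \<Longrightarrow> j < m \<Longrightarrow> (\<Sum>i<l. G j i * e a i) = 0"
  shows "(\<Sum>a<n. (\<Sum>i<l. e a i * g i)\<^sup>2) \<le> span_dist_sq l m G g"
proof -
  obtain b where b: "span_dist_sq l m G g = (\<Sum>i<l. (g i - (\<Sum>j<m. b j * G j i))\<^sup>2)"
    by (rule span_dist_sq_attained)
  define r where "r i = g i - (\<Sum>j<m. b j * G j i)" for i
  define h where "h a = (\<Sum>i<l. e a i * g i)" for a
  have h: "(\<Sum>i<l. e a i * r i) = h a" if "a < n" for a
  proof -
    have "(\<Sum>i<l. e a i * (\<Sum>j<m. b j * G j i)) = (\<Sum>j<m. b j * (\<Sum>i<l. G j i * e a i))"
      unfolding sum_distrib_left by (subst sum.swap) (intro sum.cong refl, simp add: mult_ac)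
    also have "\<dots> = 0" using that e(2) by simp
    finally show ?thesis by (simp add: r_def h_def right_diff_distrib sum_subtractf)
  qed
  have 1: "(\<Sum>i<l. r i * (\<Sum>a<n. h a * e a i)) = (\<Sum>a<n. (h a)\<^sup>2)"
  proof -
    have "(\<Sum>i<l. r i * (\<Sum>a<n. h a * e a i)) = (\<Sum>a<n. h a * (\<Sum>i<l. e a i * r i))"
      unfolding sum_distrib_left by (subst sum.swap) (intro sum.cong refl, simp add: mult_ac)
    then show ?thesis using h by (simp add: power2_eq_square)
  qed
  have 2: "(\<Sum>i<l. (\<Sum>a<n. h a * e a i)\<^sup>2) = (\<Sum>a<n. (h a)\<^sup>2)"
  proof -
    have "(\<Sum>i<l. (\<Sum>a<n. h a * e a i)\<^sup>2) = (\<Sum>i<l. \<Sum>a<n. \<Sum>b<n. h a * h b * (e a i * e b i))"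
      unfolding power2_eq_square sum_product by (intro sum.cong refl) (simp add: mult_ac)
    also have "\<dots> = (\<Sum>a<n. \<Sum>b<n. h a * h b * (\<Sum>i<l. e a i * e b i))"
      by (subst sum.swap, rule sum.cong[OF refl], subst sum.swap) (simp add: sum_distrib_left)
    also have "\<dots> = (\<Sum>a<n. \<Sum>b<n. h a * h b * (if a = b then 1 else 0))"
      using e(1) by (intro sum.cong) auto
    also have "\<dots> = (\<Sum>a<n. h a * (\<Sum>b<n. h b * (if a = b then 1 else 0)))"
      by (simp only: sum_distrib_left mult.assoc)
    also have "\<dots> = (\<Sum>a<n. (h a)\<^sup>2)"
      by (intro sum.cong refl, subst sum_mult_delta) (auto simp: power2_eq_square)
    finally show ?thesis .
  qed
  have "0 \<le> (\<Sum>i<l. (r i - (\<Sum>a<n. h a * e a i))\<^sup>2)" by (intro sum_nonneg) simp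
  also have "\<dots> = (\<Sum>i<l. (r i)\<^sup>2) - 2 * (\<Sum>i<l. r i * (\<Sum>a<n. h a * e a i))
      + (\<Sum>i<l. (\<Sum>a<n. h a * e a i)\<^sup>2)"
    by (simp add: power2_diff sum.distrib sum_subtractf sum_distrib_left mult.assoc)
  also have "\<dots> = span_dist_sq l m G g - (\<Sum>a<n. (h a)\<^sup>2)"
    unfolding 1 2 unfolding b r_def by simp
  finally show ?thesis by (simp add: h_def)
qed

lemma prob_space_std_normal: "prob_space std_normal_distribution"
  by (rule prob_space_normal_density) simp

lemma nn_integral_PiM_std_normal_exp_sq:
  fixes I :: "'i set"
  assumes "finite I" "- 1 / 2 < s"
  shows "(\<integral>\<^sup>+x. ennreal (exp (- s * (\<Sum>i\<in>I. (x i)\<^sup>2))) \<partial>PiM I (\<lambda>_. std_normal_distribution))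
    = ennreal ((1 + 2 * s) powr (- real (card I) / 2))"
proof -
  interpret \<nu>: prob_space std_normal_distribution by (rule prob_space_std_normal)
  interpret product_sigma_finite "\<lambda>_ :: 'i. std_normal_distribution" by standard
  have "(\<integral>\<^sup>+x. ennreal (exp (- s * (\<Sum>i\<in>I. (x i)\<^sup>2))) \<partial>PiM I (\<lambda>_. std_normal_distribution)) =
    (\<integral>\<^sup>+x. (\<Prod>i\<in>I. ennreal (exp (- s * (x i)\<^sup>2))) \<partial>PiM I (\<lambda>_. std_normal_distribution))"
    using assms by (intro nn_integral_cong) (simp add: prod_ennreal exp_sum sum_distrib_left)
  also have "\<dots> = (\<Prod>i\<in>I. \<integral>\<^sup>+x. ennreal (exp (- s * x\<^sup>2)) \<partial>std_normal_distribution)"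
    using assms by (intro product_nn_integral_prod) auto
  also have "\<dots> = ennreal (((1 + 2 * s) powr (- 1 / 2)) ^ card I)"
    using assms nn_integral_std_normal_exp_sq[of s] by (simp add: ennreal_power)
  also have "((1 + 2 * s) powr (- 1 / 2)) ^ card I = (1 + 2 * s) powr (- real (card I) / 2)"
    using assms by (simp add: powr_realpow[symmetric] powr_powr)
  finally show ?thesis .
qed

lemma (in prob_space) nn_integral_gaussian_exp_sq:
  fixes Y :: "'i \<Rightarrow> 'a \<Rightarrow> real"
  assumes I: "finite I" and s: "- 1 / 2 < s"
    and [measurable]: "\<And>i. i \<in> I \<Longrightarrow> Y i \<in> borel_measurable M"
    and char: "\<And>t. (\<integral>w. iexp (\<Sum>i\<in>I. t i * Y i w) \<partial>M) = exp (- (\<Sum>i\<in>I. (t i)\<^sup>2) / 2)"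
  shows "(\<integral>\<^sup>+w. ennreal (exp (- s * (\<Sum>i\<in>I. (Y i w)\<^sup>2))) \<partial>M) = ennreal ((1 + 2 * s) powr (- real (card I) / 2))"
proof -
  have "(\<integral>\<^sup>+w. ennreal (exp (- s * (\<Sum>i\<in>I. (Y i w)\<^sup>2))) \<partial>M) =
    (\<integral>\<^sup>+w. ennreal (exp (- s * (\<Sum>i\<in>I. ((\<lambda>i\<in>I. Y i w) i)\<^sup>2))) \<partial>M)"
    by (intro nn_integral_cong) simp
  also have "\<dots> = (\<integral>\<^sup>+x. ennreal (exp (- s * (\<Sum>i\<in>I. (x i)\<^sup>2))) \<partial>distr M (PiM I (\<lambda>_. borel)) (\<lambda>w. \<lambda>i\<in>I. Y i w))"
    by (subst nn_integral_distr) auto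
  also have "\<dots> = ennreal ((1 + 2 * s) powr (- real (card I) / 2))"
    using nn_integral_PiM_std_normal_exp_sq[OF I s]
    by (simp only: distr_PiM_std_normalI[OF I assms(3) char])
  finally show ?thesis .
qed

text \<open>By rotation invariance the coordinates along \<open>n\<close> orthonormal directions
  orthogonal to the fixed subspace are again independent standard normals, so the squared distance
  dominates a chi-square variable with \<open>n\<close> degrees of freedom. It is only an
  inequality, as the complement may have larger dimension.\<close>

lemma (in prob_space) gaussian_span_dist_Laplace_fixed:
  fixes Y :: "nat \<Rightarrow> 'a \<Rightarrow> real"
  assumes [measurable]: "\<And>i. i < l \<Longrightarrow> Y i \<in> borel_measurable M"
    and char: "\<And>t. (\<integral>w. iexp (\<Sum>i<l. t i * Y i w) \<partial>M) = exp (- (\<Sum>i<l. (t i)\<^sup>2) / 2)"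
    and mn: "m + n \<le> l" and s: "0 < s"
  shows "(\<integral>\<^sup>+w. ennreal (exp (- s * span_dist_sq l m G (\<lambda>i. Y i w))) \<partial>M) \<le> ennreal ((1 + 2 * s) powr (- real n / 2))"
proof -
  from orthonormal_complement_exists[OF mn, of G] obtain e
    where "\<forall>a<n. \<forall>b<n. (\<Sum>i<l. e a i * e b i) = (if a = b then 1 else 0)"
      "\<forall>a<n. \<forall>j<m. (\<Sum>i<l. G j i * e a i) = 0" by (elim exE conjE)
  note e = this[rule_format]
  have "(\<integral>\<^sup>+w. ennreal (exp (- s * span_dist_sq l m G (\<lambda>i. Y i w))) \<partial>M)
      \<le> (\<integral>\<^sup>+w. ennreal (exp (- s * (\<Sum>a<n. (\<Sum>i<l. e a i * Y i w)\<^sup>2))) \<partial>M)"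
    using s span_dist_sq_ge_complement[OF e]
    by (intro nn_integral_mono ennreal_leI) (simp add: mult_left_mono)
  also have "\<dots> = ennreal ((1 + 2 * s) powr (- real (card {..<n}) / 2))"
  proof (rule nn_integral_gaussian_exp_sq)
    fix t :: "nat \<Rightarrow> real"
    define c where "c i = (\<Sum>a<n. t a * e a i)" for i
    have "(\<Sum>a<n. t a * (\<Sum>i<l. e a i * Y i w)) = (\<Sum>i<l. c i * Y i w)" for w
      unfolding c_def sum_distrib_left sum_distrib_right
      by (subst sum.swap) (intro sum.cong refl, simp add: mult_ac)
    then have "(\<integral>w. iexp (\<Sum>a<n. t a * (\<Sum>i<l. e a i * Y i w)) \<partial>M) = exp (- (\<Sum>i<l. (c i)\<^sup>2) / 2)"
      using char[of c] by simp
    also have "(\<Sum>i<l. (c i)\<^sup>2) = (\<Sum>i<l. \<Sum>a<n. \<Sum>b<n. t a * t b * (e a i * e b i))"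
      unfolding c_def power2_eq_square sum_product by (intro sum.cong refl) (simp add: mult_ac)
    also have "\<dots> = (\<Sum>a<n. \<Sum>b<n. t a * t b * (\<Sum>i<l. e a i * e b i))"
      by (subst sum.swap, rule sum.cong[OF refl], subst sum.swap) (simp add: sum_distrib_left)
    also have "\<dots> = (\<Sum>a<n. \<Sum>b<n. t a * t b * (if a = b then 1 else 0))"
      using e(1) by (intro sum.cong) auto
    also have "\<dots> = (\<Sum>a<n. t a * (\<Sum>b<n. t b * (if a = b then 1 else 0)))"
      by (simp only: sum_distrib_left mult.assoc)
    also have "\<dots> = (\<Sum>a<n. (t a)\<^sup>2)"
      by (intro sum.cong refl, subst sum_mult_delta) (auto simp: power2_eq_square)
    finally show "(\<integral>w. iexp (\<Sum>a<n. t a * (\<Sum>i<l. e a i * Y i w)) \<partial>M) = exp (- (\<Sum>a<n. (t a)\<^sup>2) / 2)" .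
  qed (use s in auto)
  finally show ?thesis by simp
qed

text \<open>The joint law is a product measure, so by Tonelli the spanning vectors can be frozen.
  The bound for a fixed subspace depends only on the number of vectors and survives the outer
  integration.\<close>

lemma (in prob_space) gaussian_span_dist_Laplace:
  fixes Y :: "nat \<Rightarrow> nat \<Rightarrow> 'a \<Rightarrow> real"
  assumes [measurable]: "\<And>i j. i < l \<Longrightarrow> j \<le> m \<Longrightarrow> Y i j \<in> borel_measurable M"
    and char: "\<And>t. (\<integral>w. iexp (\<Sum>i<l. \<Sum>j\<le>m. t i j * Y i j w) \<partial>M) = exp (- (\<Sum>i<l. \<Sum>j\<le>m. (t i j)\<^sup>2) / 2)"
    and mn: "m + n \<le> l" and s: "0 < s"
  shows "(\<integral>\<^sup>+w. ennreal (exp (- s * span_dist_sq l m (\<lambda>j i. Y i j w) (\<lambda>i. Y i m w))) \<partial>M)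
    \<le> ennreal ((1 + 2 * s) powr (- real n / 2))"
proof -
  let ?\<nu> = "std_normal_distribution"
  interpret \<nu>: prob_space ?\<nu> by (rule prob_space_std_normal)
  interpret product_sigma_finite "\<lambda>_ :: nat \<times> nat. ?\<nu>" by standard
  \<comment> \<open>\<open>I\<close> indexes the coordinates of the spanning vectors,
    \<open>J\<close> those of the vector whose distance is measured.\<close>
  define I J where "I = {..<l} \<times> {..<m}" and "J = {..<l} \<times> {m}"
  have IJ: "finite I" "finite J" "I \<inter> J = {}" "{..<l} \<times> {..m} = I \<union> J"
    by (auto simp: I_def J_def)
  define f where "f x = ennreal (exp (- s * span_dist_sq l m (\<lambda>j i. x (i, j)) (\<lambda>i. x (i, m))))"
    for x :: "nat \<times> nat \<Rightarrow> real"
  have fm [measurable]: "f \<in> borel_measurable (PiM (I \<union> J) (\<lambda>_. borel))"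
  proof -
    have "(\<lambda>x. span_dist_sq l m (\<lambda>j i. x (i, j)) (\<lambda>i. x (i, m))) \<in> borel_measurable (PiM (I \<union> J) (\<lambda>_. borel))"
      by (intro span_dist_sq_measurable measurable_component_singleton) (auto simp: I_def J_def)
    then show ?thesis unfolding f_def by measurable
  qed
  have law: "distr M (PiM (I \<union> J) (\<lambda>_. borel)) (\<lambda>w. \<lambda>q\<in>I \<union> J. Y (fst q) (snd q) w) = PiM (I \<union> J) (\<lambda>_. ?\<nu>)"
  proof (rule distr_PiM_std_normalI)
    fix t :: "nat \<times> nat \<Rightarrow> real"
    show "(\<integral>w. iexp (\<Sum>q\<in>I \<union> J. t q * Y (fst q) (snd q) w) \<partial>M) = exp (- (\<Sum>q\<in>I \<union> J. (t q)\<^sup>2) / 2)"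
      unfolding IJ(4)[symmetric] sum.cartesian_product' fst_conv snd_conv
      by (rule char[of "\<lambda>i j. t (i, j)"])
  qed (auto simp: I_def J_def)
  have "(\<integral>\<^sup>+w. ennreal (exp (- s * span_dist_sq l m (\<lambda>j i. Y i j w) (\<lambda>i. Y i m w))) \<partial>M)
      = (\<integral>\<^sup>+w. f (\<lambda>q\<in>I \<union> J. Y (fst q) (snd q) w) \<partial>M)"
  proof -
    have "span_dist_sq l m (\<lambda>j i. (\<lambda>q\<in>I \<union> J. Y (fst q) (snd q) w) (i, j))
        (\<lambda>i. (\<lambda>q\<in>I \<union> J. Y (fst q) (snd q) w) (i, m)) = span_dist_sq l m (\<lambda>j i. Y i j w) (\<lambda>i. Y i m w)" for w
      by (rule span_dist_sq_cong) (auto simp: I_def J_def)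
    then show ?thesis by (simp only: f_def)
  qed
  also have "\<dots> = integral\<^sup>N (distr M (PiM (I \<union> J) (\<lambda>_. borel)) (\<lambda>w. \<lambda>q\<in>I \<union> J. Y (fst q) (snd q) w)) f"
    by (subst nn_integral_distr) (auto intro!: measurable_restrict simp: I_def J_def fm[unfolded I_def J_def])
  also have "\<dots> = (\<integral>\<^sup>+x. (\<integral>\<^sup>+y. f (merge I J (x, y)) \<partial>PiM J (\<lambda>_. ?\<nu>)) \<partial>PiM I (\<lambda>_. ?\<nu>))"
  proof -
    have "sets (PiM (I \<union> J) (\<lambda>_. ?\<nu>)) = sets (PiM (I \<union> J) (\<lambda>_. borel))"
      by (intro sets_PiM_cong) auto
    then have "f \<in> borel_measurable (PiM (I \<union> J) (\<lambda>_. ?\<nu>))"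
      using fm measurable_cong_sets by blast
    then show ?thesis unfolding law using IJ by (intro product_nn_integral_fold) auto
  qed
  also have "\<dots> \<le> (\<integral>\<^sup>+x. ennreal ((1 + 2 * s) powr (- real n / 2)) \<partial>PiM I (\<lambda>_. ?\<nu>))"
  proof (intro nn_integral_mono)
    fix x :: "nat \<times> nat \<Rightarrow> real"
    interpret J: prob_space "PiM J (\<lambda>_. ?\<nu>)" by (rule prob_space_PiM) (rule prob_space_std_normal)
    have "(\<integral>\<^sup>+y. f (merge I J (x, y)) \<partial>PiM J (\<lambda>_. ?\<nu>)) =
      (\<integral>\<^sup>+y. ennreal (exp (- s * span_dist_sq l m (\<lambda>j i. x (i, j)) (\<lambda>i. y (i, m)))) \<partial>PiM J (\<lambda>_. ?\<nu>))"
    proof -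
      have "span_dist_sq l m (\<lambda>j i. merge I J (x, y) (i, j)) (\<lambda>i. merge I J (x, y) (i, m))
          = span_dist_sq l m (\<lambda>j i. x (i, j)) (\<lambda>i. y (i, m))" for y
        by (rule span_dist_sq_cong) (auto simp: I_def J_def merge_def)
      then show ?thesis by (simp only: f_def)
    qed
    also have "\<dots> \<le> ennreal ((1 + 2 * s) powr (- real n / 2))"
    proof (rule J.gaussian_span_dist_Laplace_fixed[OF _ _ mn s])
      show "(\<lambda>y. y (i, m)) \<in> borel_measurable (PiM J (\<lambda>_. ?\<nu>))" if "i < l" for i
        using that measurable_component_singleton[of "(i, m)" J "\<lambda>_. ?\<nu>"]
        by (simp add: J_def cong: measurable_cong_sets)
      fix t :: "nat \<Rightarrow> real"
      have "(\<Sum>i<l. t i * y (i, m)) = (\<Sum>q\<in>J. t (fst q) * y q)" for y :: "nat \<times> nat \<Rightarrow> real"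
        unfolding J_def by (simp add: sum.cartesian_product')
      then have "(\<integral>y. iexp (\<Sum>i<l. t i * y (i, m)) \<partial>PiM J (\<lambda>_. ?\<nu>)) =
        (\<integral>y. (\<Prod>q\<in>J. iexp (t (fst q) * y q)) \<partial>PiM J (\<lambda>_. ?\<nu>))"
        using IJ by (simp add: exp_sum sum_distrib_left)
      also have "\<dots> = (\<Prod>q\<in>J. \<integral>y. iexp (t (fst q) * y) \<partial>?\<nu>)"
        using IJ by (intro product_integral_prod \<nu>.integrable_const_bound[of _ 1]) auto
      also have "\<dots> = (\<Prod>q\<in>J. complex_of_real (exp (- (t (fst q))\<^sup>2 / 2)))"
        using char_std_normal_distribution by (simp add: char_def fun_eq_iff)
      also have "\<dots> = (\<Prod>i<l. complex_of_real (exp (- (t i)\<^sup>2 / 2)))"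
        unfolding J_def by (simp add: prod.cartesian_product')
      also have "\<dots> = exp (- (\<Sum>i<l. (t i)\<^sup>2) / 2)"
        by (simp add: exp_sum[symmetric] sum_negf sum_divide_distrib flip: of_real_prod)
      finally show "(\<integral>y. iexp (\<Sum>i<l. t i * y (i, m)) \<partial>PiM J (\<lambda>_. ?\<nu>)) = exp (- (\<Sum>i<l. (t i)\<^sup>2) / 2)" .
    qed
    finally show "(\<integral>\<^sup>+y. f (merge I J (x, y)) \<partial>PiM J (\<lambda>_. ?\<nu>)) \<le> ennreal ((1 + 2 * s) powr (- real n / 2))" .
  qed
  also have "\<dots> = ennreal ((1 + 2 * s) powr (- real n / 2))"
  proof -
    interpret I: prob_space "PiM I (\<lambda>_. ?\<nu>)" by (rule prob_space_PiM) (rule prob_space_std_normal)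
    show ?thesis by (simp add: I.emeasure_space_1)
  qed
  finally show ?thesis .
qed

subsection \<open>Linear functionals of a Gaussian process\<close>

lemma sigma_finite_lebesgue_on:
  fixes D :: "'a::euclidean_space set"
  assumes "D \<in> sets lebesgue"
  shows "sigma_finite_measure (lebesgue_on D)"
proof -
  obtain C :: "'a set set" where C: "countable C" "C \<subseteq> sets lborel" "\<Union>C = space lborel" "\<forall>a\<in>C. emeasure lborel a \<noteq> \<infinity>"
    using lborel.sigma_finite_countable by blast
  have "sigma_finite_measure (lebesgue :: 'a measure)"
  proof
    show "\<exists>A. countable A \<and> A \<subseteq> sets (lebesgue :: 'a measure) \<and> \<Union>A = space lebesgue \<and> (\<forall>a\<in>A. emeasure lebesgue a \<noteq> \<infinity>)"
      using C by (intro exI[of _ C]) (auto simp: subset_iff)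
  qed
  then show ?thesis using assms by (rule sigma_finite_measure_restrict_space)
qed

lemma (in pair_sigma_finite) integrable_pair_mult:
  fixes a b :: "_ \<Rightarrow> real"
  assumes "integrable M1 a" "integrable M2 b"
  shows "integrable (M1 \<Otimes>\<^sub>M M2) (\<lambda>(x, y). a x * b y)"
    and "(\<integral>(x, y). a x * b y \<partial>(M1 \<Otimes>\<^sub>M M2)) = (\<integral>x. a x \<partial>M1) * (\<integral>y. b y \<partial>M2)"
proof -
  have [measurable]: "a \<in> borel_measurable M1" "b \<in> borel_measurable M2" using assms by auto
  show int: "integrable (M1 \<Otimes>\<^sub>M M2) (\<lambda>(x, y). a x * b y)"
    by (rule Fubini_integrable) (use assms in \<open>auto simp: abs_mult\<close>)
  show "(\<integral>(x, y). a x * b y \<partial>(M1 \<Otimes>\<^sub>M M2)) = (\<integral>x. a x \<partial>M1) * (\<integral>y. b y \<partial>M2)"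
    by (subst integral_fst[OF int, symmetric]) simp
qed

context prob_space
begin

lemma centered_gaussianD:
  assumes "centered_gaussian M Z v"
  shows centered_gaussian_measurable: "Z \<in> borel_measurable M"
    and centered_gaussian_integrable_sq: "integrable M (\<lambda>w. (Z w)\<^sup>2)"
    and centered_gaussian_variance: "(\<integral>w. (Z w)\<^sup>2 \<partial>M) = v"
    and centered_gaussian_char: "(\<integral>w. iexp (Z w) \<partial>M) = exp (- v / 2)"
proof -
  show [measurable]: "Z \<in> borel_measurable M" using assms by (simp add: centered_gaussian_def)
  have "integrable M (\<lambda>w. (Z w)\<^sup>2) \<and> (\<integral>w. (Z w)\<^sup>2 \<partial>M) = v \<and> (\<integral>w. iexp (Z w) \<partial>M) = exp (- v / 2)"
  proof (cases "v = 0")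
    case True
    then have ae: "AE w in M. Z w = 0" using assms by (simp add: centered_gaussian_def)
    have "integrable M (\<lambda>w. (Z w)\<^sup>2) \<longleftrightarrow> integrable M (\<lambda>w. 0 :: real)"
      using ae by (intro integrable_cong_AE) auto
    moreover have "(\<integral>w. (Z w)\<^sup>2 \<partial>M) = (\<integral>w. 0 \<partial>M)" using ae by (intro integral_cong_AE) auto
    moreover have "(\<integral>w. iexp (Z w) \<partial>M) = (\<integral>w. 1 \<partial>M)" using ae by (intro integral_cong_AE) auto
    ultimately show ?thesis using True by (simp add: prob_space)
  next
    case False
    then have v: "0 < v" and d: "distributed M lborel Z (normal_density 0 (sqrt v))"
      using assms by (auto simp: centered_gaussian_def)
    define U where "U w = Z w / sqrt v" for w
    have [measurable]: "U \<in> borel_measurable M" unfolding U_def by measurable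
    have Z: "Z w = sqrt v * U w" for w using v by (simp add: U_def)
    have "distributed M lborel U std_normal_density"
      using normal_standard_normal_convert[of "sqrt v" Z 0] v d by (simp add: U_def[abs_def])
    then have "distr M lborel U = std_normal_distribution" by (simp add: distributed_def)
    moreover have "distr M lborel U = distr M borel U" by (intro distr_cong) auto
    ultimately have law: "distr M borel U = std_normal_distribution" by simp
    have i: "integrable std_normal_distribution (\<lambda>x. x\<^sup>2)"
      and e: "(\<integral>x. x\<^sup>2 \<partial>std_normal_distribution) = 1"
      using std_normal_distribution_even_moments[of 1] by simp_all
    have i2: "integrable M (\<lambda>w. (U w)\<^sup>2)" using i unfolding law[symmetric]
      by (subst (asm) integrable_distr_eq) auto
    have e2: "(\<integral>w. (U w)\<^sup>2 \<partial>M) = 1" using e unfolding law[symmetric]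
      by (subst (asm) integral_distr) auto
    have "(\<integral>w. iexp (sqrt v * U w) \<partial>M) = (\<integral>x. iexp (sqrt v * x) \<partial>distr M borel U)"
      by (subst integral_distr) auto
    also have "\<dots> = char std_normal_distribution (sqrt v)" unfolding law char_def ..
    also have "\<dots> = exp (- v / 2)" using v by (simp add: char_std_normal_distribution)
    finally show ?thesis
      using i2 e2 v by (simp add: Z power_mult_distrib)
  qed
  then show "integrable M (\<lambda>w. (Z w)\<^sup>2)" "(\<integral>w. (Z w)\<^sup>2 \<partial>M) = v" "(\<integral>w. iexp (Z w) \<partial>M) = exp (- v / 2)"
    by auto
qed

lemma centered_gaussian_L2_space: "centered_gaussian M Z v \<Longrightarrow> Z \<in> L2_space M"
  by (intro L2_spaceI centered_gaussian_measurable centered_gaussian_integrable_sq)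

end

section \<open>Covariance of linear functionals of a sample\<close>

definition kernel_form :: "'a::euclidean_space set \<Rightarrow> ('a \<Rightarrow> 'a \<Rightarrow> real) \<Rightarrow> ('a \<Rightarrow> real) \<Rightarrow> ('a \<Rightarrow> real) \<Rightarrow> real" where
  "kernel_form D K f g = (\<integral>(x, y). f x * K x y * g y \<partial>(lebesgue_on D \<Otimes>\<^sub>M lebesgue_on D))"

locale mercer_process = prob_space P for P :: "'w measure" +
  fixes D :: "'a::euclidean_space set" and K :: "'a \<Rightarrow> 'a \<Rightarrow> real" and lam :: "nat \<Rightarrow> real"
    and \<psi> :: "nat \<Rightarrow> 'a \<Rightarrow> real" and X :: "'w \<Rightarrow> 'a \<Rightarrow> real"
  assumes D: "D \<in> sets lebesgue"
    and mercer: "mercer_expansion D K lam \<psi>"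
    and gp: "gaussian_process P D K X"
begin

abbreviation MD :: "'a measure" where "MD \<equiv> lebesgue_on D"

abbreviation Z :: "('a \<Rightarrow> real) \<Rightarrow> 'w \<Rightarrow> real" where "Z f w \<equiv> L2_inner MD f (X w)"

sublocale MD: sigma_finite_measure MD by (rule sigma_finite_lebesgue_on[OF D])

sublocale MM: pair_sigma_finite MD MD ..

sublocale MM': sigma_finite_measure "MD \<Otimes>\<^sub>M MD" ..

sublocale PM: pair_sigma_finite P MD ..

sublocale PMM: pair_sigma_finite P "MD \<Otimes>\<^sub>M MD" ..

lemma basis: "L2_basis MD \<psi>" and lam_pos: "0 < lam j" and lam_dec: "decseq lam"
  and lam_summable: "summable lam"
  using mercer by (auto simp: mercer_expansion_def)

lemma lam_le: "lam j \<le> lam 0"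
  using lam_dec by (simp add: decseq_def)

lemma \<psi>_L2: "\<psi> j \<in> L2_space MD"
  using basis by (intro L2_orthonormal_space L2_basis_orthonormal)

lemma X_L2: "w \<in> space P \<Longrightarrow> X w \<in> L2_space MD"
  using gp by (simp add: gaussian_process_def)

lemma X_comb_gaussian:
  "finite S \<Longrightarrow> S \<subseteq> D \<Longrightarrow>
    centered_gaussian P (\<lambda>w. \<Sum>x\<in>S. a x * X w x) (\<Sum>x\<in>S. \<Sum>y\<in>S. a x * a y * K x y)"
  using gp by (simp add: gaussian_process_def)

lemma X_measurable [measurable (raw)]:
  assumes "g \<in> measurable N P" "h \<in> measurable N MD"
  shows "(\<lambda>z. X (g z) (h z)) \<in> borel_measurable N"
proof -
  have "(\<lambda>(w, x). X w x) \<in> borel_measurable (P \<Otimes>\<^sub>M MD)"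
    using gp by (simp add: gaussian_process_def)
  from measurable_compose[OF measurable_Pair[OF assms] this] show ?thesis by simp
qed

lemma kernel_sums:
  assumes "x \<in> D" "y \<in> D"
  shows "(\<lambda>j. lam j * \<psi> j x * \<psi> j y) sums K x y"
proof -
  have "uniform_limit (D \<times> D) (\<lambda>n (x, y). \<Sum>j<n. lam j * \<psi> j x * \<psi> j y) (\<lambda>(x, y). K x y) sequentially"
    using mercer by (simp add: mercer_expansion_def)
  from tendsto_uniform_limitI[OF this, of "(x, y)"] assms show ?thesis
    by (simp add: sums_def)
qed

lemma kernel_sym: "x \<in> D \<Longrightarrow> y \<in> D \<Longrightarrow> K x y = K y x"
  by (rule sums_unique2[OF kernel_sums[of x y]]) (use kernel_sums[of y x] in \<open>simp_all add: mult.assoc mult.commute[of "\<psi> _ y"]\<close>)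

lemma X_point_gaussian: "x \<in> D \<Longrightarrow> centered_gaussian P (\<lambda>w. X w x) (K x x)"
  using X_comb_gaussian[of "{x}" "\<lambda>_. 1"] by simp

lemma X_covariance:
  assumes "x \<in> D" "y \<in> D"
  shows "integrable P (\<lambda>w. X w x * X w y)" "(\<integral>w. X w x * X w y \<partial>P) = K x y"
proof -
  have L: "(\<lambda>w. X w x) \<in> L2_space P" "(\<lambda>w. X w y) \<in> L2_space P"
    using assms by (auto intro: centered_gaussian_L2_space X_point_gaussian)
  show "integrable P (\<lambda>w. X w x * X w y)" by (rule L2_space_integrable_mult[OF L])
  show "(\<integral>w. X w x * X w y \<partial>P) = K x y"
  proof (cases "x = y")
    case True
    then show ?thesis using centered_gaussian_variance[OF X_point_gaussian[OF assms(1)]]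
      by (simp add: power2_eq_square)
  next
    case False
    \<comment> \<open>The marginals determine variances of linear combinations; the covariance
      follows by polarization. The points must differ, since otherwise the set \<open>{x, y}\<close>
      counts the value once.\<close>
    have "centered_gaussian P (\<lambda>w. \<Sum>z\<in>{x, y}. 1 * X w z) (\<Sum>z\<in>{x, y}. \<Sum>z'\<in>{x, y}. 1 * 1 * K z z')"
      using assms by (intro X_comb_gaussian) auto
    from centered_gaussian_variance[OF this] False
    have "(\<integral>w. (X w x + X w y)\<^sup>2 \<partial>P) = K x x + K x y + (K y x + K y y)" by simp
    moreover have "(\<integral>w. (X w x + X w y)\<^sup>2 \<partial>P) = (\<integral>w. (X w x)\<^sup>2 \<partial>P) + 2 * (\<integral>w. X w x * X w y \<partial>P) + (\<integral>w. (X w y)\<^sup>2 \<partial>P)"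
      using L2_inner_add_scaled_self[OF L, of 1] unfolding L2_inner_self_eq by (simp add: L2_inner_def)
    ultimately show ?thesis
      using centered_gaussian_variance[OF X_point_gaussian] assms kernel_sym[OF assms] by simp
  qed
qed

text \<open>On the diagonal the Mercer series has nonnegative terms, so it may be integrated
  termwise. Its value, the trace of the kernel, becomes the mean squared norm of a sample.\<close>

lemma nn_integral_kernel_diag: "(\<integral>\<^sup>+x. ennreal (K x x) \<partial>MD) = ennreal (suminf lam)"
proof -
  have "(\<integral>\<^sup>+x. ennreal (K x x) \<partial>MD) = (\<integral>\<^sup>+x. (\<Sum>j. ennreal (lam j * (\<psi> j x)\<^sup>2)) \<partial>MD)"
  proof (rule nn_integral_cong)
    fix x assume "x \<in> space MD"
    then have "(\<lambda>j. lam j * (\<psi> j x)\<^sup>2) sums K x x"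
      using kernel_sums[of x x] by (simp add: power2_eq_square mult.assoc)
    then show "ennreal (K x x) = (\<Sum>j. ennreal (lam j * (\<psi> j x)\<^sup>2))"
      by (intro suminf_ennreal_eq[symmetric]) (auto intro!: mult_nonneg_nonneg simp: less_imp_le[OF lam_pos])
  qed
  also have "\<dots> = (\<Sum>j. \<integral>\<^sup>+x. ennreal (lam j * (\<psi> j x)\<^sup>2) \<partial>MD)"
    using \<psi>_L2[THEN L2_space_measurable] by (intro nn_integral_suminf) auto
  also have "\<dots> = (\<Sum>j. ennreal (lam j))"
  proof (rule suminf_cong)
    fix j
    have "(\<integral>\<^sup>+x. ennreal (lam j * (\<psi> j x)\<^sup>2) \<partial>MD) = ennreal (\<integral>x. lam j * (\<psi> j x)\<^sup>2 \<partial>MD)"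
      using lam_pos[of j] L2_space_integrable_sq[OF \<psi>_L2[of j]] by (intro nn_integral_eq_integral) auto
    also have "(\<integral>x. lam j * (\<psi> j x)\<^sup>2 \<partial>MD) = lam j"
      using L2_orthonormal_inner[OF L2_basis_orthonormal[OF basis], of j j] by (simp add: L2_inner_self_eq)
    finally show "(\<integral>\<^sup>+x. ennreal (lam j * (\<psi> j x)\<^sup>2) \<partial>MD) = ennreal (lam j)" .
  qed
  also have "\<dots> = ennreal (suminf lam)"
    using lam_pos lam_summable by (intro suminf_ennreal2) (auto intro: less_imp_le)
  finally show ?thesis .
qed

lemma X_norm_measurable [measurable]: "(\<lambda>w. L2_inner MD (X w) (X w)) \<in> borel_measurable P"
  unfolding L2_inner_def by measurable

lemma Z_measurable: "f \<in> L2_space MD \<Longrightarrow> Z f \<in> borel_measurable P"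
  unfolding L2_inner_def using L2_space_measurable[of f MD] by measurable

lemma X_norm_nn_integral: "(\<integral>\<^sup>+w. ennreal (L2_inner MD (X w) (X w)) \<partial>P) = ennreal (suminf lam)"
proof -
  have "(\<integral>\<^sup>+w. ennreal (L2_inner MD (X w) (X w)) \<partial>P) = (\<integral>\<^sup>+w. \<integral>\<^sup>+x. ennreal ((X w x)\<^sup>2) \<partial>MD \<partial>P)"
    unfolding L2_inner_self_eq using X_L2
    by (intro nn_integral_cong nn_integral_eq_integral[symmetric] L2_space_integrable_sq) auto
  also have "\<dots> = (\<integral>\<^sup>+x. \<integral>\<^sup>+w. ennreal ((X w x)\<^sup>2) \<partial>P \<partial>MD)"
    by (rule PM.Fubini'[symmetric]) measurable
  also have "\<dots> = (\<integral>\<^sup>+x. ennreal (K x x) \<partial>MD)"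
  proof (rule nn_integral_cong)
    fix x assume "x \<in> space MD"
    then have g: "centered_gaussian P (\<lambda>w. X w x) (K x x)" by (intro X_point_gaussian) simp
    show "(\<integral>\<^sup>+w. ennreal ((X w x)\<^sup>2) \<partial>P) = ennreal (K x x)"
      using centered_gaussian_integrable_sq[OF g] centered_gaussian_variance[OF g]
      by (simp add: nn_integral_eq_integral)
  qed
  finally show ?thesis by (simp only: nn_integral_kernel_diag)
qed

lemma lam_sum_nonneg: "0 \<le> suminf lam"
  using lam_pos lam_summable by (intro suminf_nonneg) (auto intro: less_imp_le)

lemma X_norm_integrable: "integrable P (\<lambda>w. L2_inner MD (X w) (X w))"
  and X_norm_expectation: "(\<integral>w. L2_inner MD (X w) (X w) \<partial>P) = suminf lam"
  using nn_integral_eq_integrable[of "\<lambda>w. L2_inner MD (X w) (X w)" P "suminf lam"]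
    X_norm_nn_integral lam_sum_nonneg by auto

lemma Z_L2:
  assumes f: "f \<in> L2_space MD"
  shows "Z f \<in> L2_space P"
proof (rule L2_spaceI[OF Z_measurable[OF f]])
  have [measurable]: "Z f \<in> borel_measurable P" by (rule Z_measurable[OF f])
  show "integrable P (\<lambda>w. (Z f w)\<^sup>2)"
  proof (rule Bochner_Integration.integrable_bound)
    show "integrable P (\<lambda>w. L2_inner MD f f * L2_inner MD (X w) (X w))"
      using X_norm_integrable by simp
    show "AE w in P. norm ((Z f w)\<^sup>2) \<le> norm (L2_inner MD f f * L2_inner MD (X w) (X w))"
      using L2_Cauchy_Schwarz_sq[OF f X_L2] by auto
  qed measurable
qed

text \<open>A crude bound with the trace in place of the largest eigenvalue; it supplies the
  mean-square continuity in \<open>f\<close> from which the sharp bound is derived by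
  approximation.\<close>

lemma Z_norm_le:
  assumes f: "f \<in> L2_space MD"
  shows "L2_norm P (Z f) \<le> L2_norm MD f * sqrt (suminf lam)"
proof -
  have "(\<integral>w. (Z f w)\<^sup>2 \<partial>P) \<le> (\<integral>w. L2_inner MD f f * L2_inner MD (X w) (X w) \<partial>P)"
    using L2_space_integrable_sq[OF Z_L2[OF f]] X_norm_integrable L2_Cauchy_Schwarz_sq[OF f X_L2]
    by (intro integral_mono) auto
  then have "L2_inner P (Z f) (Z f) \<le> L2_inner MD f f * suminf lam"
    by (simp add: L2_inner_self_eq[of P] X_norm_expectation)
  then show ?thesis
    unfolding L2_norm_def real_sqrt_mult[symmetric] by (rule real_sqrt_le_mono)
qed

text \<open>Fubini on the product of the sample space with two copies of the domain. Absolute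
  integrability comes from the pathwise Cauchy-Schwarz inequality and the finite mean squared norm
  of the sample.\<close>

lemma Z_covariance:
  assumes f: "f \<in> L2_space MD" and g: "g \<in> L2_space MD"
  shows "L2_inner P (Z f) (Z g) = kernel_form D K f g"
    and kernel_form_integrable: "integrable (MD \<Otimes>\<^sub>M MD) (\<lambda>(x, y). f x * K x y * g y)"
proof -
  have [measurable]: "f \<in> borel_measurable MD" "g \<in> borel_measurable MD"
    using f g by (auto dest: L2_space_measurable)
  define F where "F w = (\<lambda>(x, y). (f x * X w x) * (g y * X w y))" for w
  have [measurable]: "(\<lambda>(w, z). F w z) \<in> borel_measurable (P \<Otimes>\<^sub>M (MD \<Otimes>\<^sub>M MD))"
    unfolding F_def split_beta' by measurable
  have fX: "integrable MD (\<lambda>x. f x * X w x)" "integrable MD (\<lambda>x. g x * X w x)" if "w \<in> space P" for w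
    using f g X_L2[OF that] by (auto intro: L2_space_integrable_mult)
  have Fi: "integrable (MD \<Otimes>\<^sub>M MD) (F w)" "(\<integral>z. F w z \<partial>(MD \<Otimes>\<^sub>M MD)) = Z f w * Z g w"
    "(\<integral>z. norm (F w z) \<partial>(MD \<Otimes>\<^sub>M MD)) = (\<integral>x. \<bar>f x * X w x\<bar> \<partial>MD) * (\<integral>x. \<bar>g x * X w x\<bar> \<partial>MD)"
    if "w \<in> space P" for w
  proof -
    show "integrable (MD \<Otimes>\<^sub>M MD) (F w)" "(\<integral>z. F w z \<partial>(MD \<Otimes>\<^sub>M MD)) = Z f w * Z g w"
      using MM.integrable_pair_mult[OF fX[OF that]] by (simp_all add: F_def L2_inner_def)
    have "(\<lambda>z. norm (F w z)) = (\<lambda>(x, y). \<bar>f x * X w x\<bar> * \<bar>g y * X w y\<bar>)"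
      by (auto simp: F_def fun_eq_iff abs_mult)
    then show "(\<integral>z. norm (F w z) \<partial>(MD \<Otimes>\<^sub>M MD)) = (\<integral>x. \<bar>f x * X w x\<bar> \<partial>MD) * (\<integral>x. \<bar>g x * X w x\<bar> \<partial>MD)"
      using MM.integrable_pair_mult(2)[OF fX[OF that, THEN integrable_abs]] by simp
  qed
  have abs_bound: "(\<integral>x. \<bar>h x * X w x\<bar> \<partial>MD) \<le> L2_norm MD h * L2_norm MD (X w)"
    if "w \<in> space P" "h \<in> L2_space MD" for w h
  proof -
    have L: "(\<lambda>x. \<bar>h x\<bar>) \<in> L2_space MD" "(\<lambda>x. \<bar>X w x\<bar>) \<in> L2_space MD"
      using that X_L2[OF that(1)] by (auto simp: L2_space_def)
    show ?thesis
      using L2_Cauchy_Schwarz[OF L] by (simp add: L2_inner_def L2_norm_def abs_mult)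
  qed
  have int: "integrable (P \<Otimes>\<^sub>M (MD \<Otimes>\<^sub>M MD)) (\<lambda>(w, z). F w z)"
  proof (rule PMM.Fubini_integrable)
    show "AE w in P. integrable (MD \<Otimes>\<^sub>M MD) (\<lambda>z. case (w, z) of (w, z) \<Rightarrow> F w z)"
      using Fi(1) by (auto intro!: AE_I2)
    show "integrable P (\<lambda>w. \<integral>z. norm (case (w, z) of (w, z) \<Rightarrow> F w z) \<partial>(MD \<Otimes>\<^sub>M MD))"
    proof (rule Bochner_Integration.integrable_bound)
      show "integrable P (\<lambda>w. L2_norm MD f * L2_norm MD g * L2_inner MD (X w) (X w))"
        using X_norm_integrable by simp
      show "AE w in P. norm (\<integral>z. norm (case (w, z) of (w, z) \<Rightarrow> F w z) \<partial>(MD \<Otimes>\<^sub>M MD))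
          \<le> norm (L2_norm MD f * L2_norm MD g * L2_inner MD (X w) (X w))"
      proof (rule AE_I2)
        fix w assume w: "w \<in> space P"
        have "(\<integral>x. \<bar>f x * X w x\<bar> \<partial>MD) * (\<integral>x. \<bar>g x * X w x\<bar> \<partial>MD)
            \<le> (L2_norm MD f * L2_norm MD (X w)) * (L2_norm MD g * L2_norm MD (X w))"
          using f g by (intro mult_mono abs_bound[OF w]) auto
        also have "\<dots> = L2_norm MD f * L2_norm MD g * L2_inner MD (X w) (X w)"
          by (simp add: L2_norm_sq[symmetric] power2_eq_square)
        finally show "norm (\<integral>z. norm (case (w, z) of (w, z) \<Rightarrow> F w z) \<partial>(MD \<Otimes>\<^sub>M MD))
            \<le> norm (L2_norm MD f * L2_norm MD g * L2_inner MD (X w) (X w))"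
          using Fi(3)[OF w] by (simp add: abs_mult)
      qed
    qed measurable
  qed measurable
  have FK: "(\<integral>w. F w z \<partial>P) = f (fst z) * K (fst z) (snd z) * g (snd z)"
    if "z \<in> space (MD \<Otimes>\<^sub>M MD)" for z
  proof -
    have "F w z = (f (fst z) * g (snd z)) * (X w (fst z) * X w (snd z))" for w
      by (simp add: F_def split_beta)
    then show ?thesis
      using that X_covariance[of "fst z" "snd z"] by (auto simp: space_pair_measure)
  qed
  have "integrable (MD \<Otimes>\<^sub>M MD) (\<lambda>z. \<integral>w. F w z \<partial>P)"
    by (rule PMM.integrable_snd[OF int])
  then show "integrable (MD \<Otimes>\<^sub>M MD) (\<lambda>(x, y). f x * K x y * g y)"
    using FK by (subst Bochner_Integration.integrable_cong[OF refl, of _ _ "\<lambda>z. \<integral>w. F w z \<partial>P"])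
      (auto simp: split_beta)
  have "kernel_form D K f g = (\<integral>z. (\<integral>w. F w z \<partial>P) \<partial>(MD \<Otimes>\<^sub>M MD))"
    unfolding kernel_form_def using FK
    by (intro Bochner_Integration.integral_cong refl) (auto simp: split_beta)
  also have "\<dots> = (\<integral>w. (\<integral>z. F w z \<partial>(MD \<Otimes>\<^sub>M MD)) \<partial>P)"
    by (rule PMM.Fubini_integral[OF int])
  also have "\<dots> = L2_inner P (Z f) (Z g)"
    unfolding L2_inner_def[of P] using Fi(2) by (intro Bochner_Integration.integral_cong refl) auto
  finally show "L2_inner P (Z f) (Z g) = kernel_form D K f g" ..
qed

lemma kernel_form_eigenfunction:
  assumes f: "f \<in> L2_space MD"
  shows "kernel_form D K f (\<psi> j) = lam j * L2_inner MD f (\<psi> j)"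
proof -
  have eig: "AE x in MD. (\<integral>y. K x y * \<psi> j y \<partial>MD) = lam j * \<psi> j x"
    using mercer by (simp add: mercer_expansion_def L2_eq_def)
  have int: "integrable (MD \<Otimes>\<^sub>M MD) (\<lambda>(x, y). f x * (K x y * \<psi> j y))"
    using kernel_form_integrable[OF f \<psi>_L2[of j]] by (simp add: mult.assoc)
  have "kernel_form D K f (\<psi> j) = (\<integral>x. (\<integral>y. f x * (K x y * \<psi> j y) \<partial>MD) \<partial>MD)"
    unfolding MM.integral_fst[OF int] by (simp add: kernel_form_def mult.assoc)
  also have "\<dots> = (\<integral>x. lam j * (f x * \<psi> j x) \<partial>MD)"
  proof (rule integral_cong_AE)
    show "(\<lambda>x. \<integral>y. f x * (K x y * \<psi> j y) \<partial>MD) \<in> borel_measurable MD"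
      using MM.integrable_fst[OF int] by auto
    show "(\<lambda>x. lam j * (f x * \<psi> j x)) \<in> borel_measurable MD"
      using L2_space_integrable_mult[OF f \<psi>_L2[of j]] by auto
    show "AE x in MD. (\<integral>y. f x * (K x y * \<psi> j y) \<partial>MD) = lam j * (f x * \<psi> j x)"
      using eig by eventually_elim simp
  qed
  finally show ?thesis by (simp add: L2_inner_def)
qed

lemma Z_lincomb:
  assumes "\<And>i. i \<in> I \<Longrightarrow> f i \<in> L2_space MD" "w \<in> space P"
  shows "Z (\<lambda>x. \<Sum>i\<in>I. a i * f i x) w = (\<Sum>i\<in>I. a i * Z (f i) w)"
  using assms by (intro L2_inner_lincomb_left X_L2)

lemma Z_inner_cong:
  assumes "\<And>w. w \<in> space P \<Longrightarrow> Z f w = Z' w"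
  shows "L2_inner P (Z f) (Z f) = L2_inner P Z' Z'"
  unfolding L2_inner_def[of P] using assms by (intro Bochner_Integration.integral_cong) auto

text \<open>On truncated expansions in eigenfunctions the covariance is diagonal and the bound is
  immediate; the remainder is removed in the limit by the crude continuity bound.\<close>

lemma kernel_form_le:
  assumes f: "f \<in> L2_space MD"
  shows "kernel_form D K f f \<le> lam 0 * L2_inner MD f f"
proof -
  define c where "c j = L2_inner MD (\<psi> j) f" for j
  define s where "s n = (\<lambda>x. \<Sum>j<n. c j * \<psi> j x)" for n
  have s: "s n \<in> L2_space MD" for n
    unfolding s_def by (intro L2_space_sum L2_space_scale \<psi>_L2)
  have on: "L2_orthonormal MD \<psi>" by (rule L2_basis_orthonormal[OF basis])
  have Ps: "(\<lambda>j. (c j)\<^sup>2) sums L2_inner MD f f"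
    unfolding c_def by (rule L2_basis_Parseval[OF basis f])
  have Zs: "L2_norm P (Z (s n)) \<le> sqrt (lam 0) * L2_norm MD f" for n
  proof -
    have "L2_inner P (Z (s n)) (Z (s n)) = L2_inner P (\<lambda>w. \<Sum>j<n. c j * Z (\<psi> j) w) (\<lambda>w. \<Sum>j<n. c j * Z (\<psi> j) w)"
      unfolding s_def by (rule Z_inner_cong) (intro Z_lincomb \<psi>_L2)
    also have "\<dots> = (\<Sum>i<n. c i * (\<Sum>j<n. c j * L2_inner P (Z (\<psi> i)) (Z (\<psi> j))))"
      by (simp add: L2_inner_lincomb_left L2_inner_lincomb_right Z_L2 \<psi>_L2 L2_space_sum L2_space_scale)
    also have "\<dots> = (\<Sum>i<n. c i * (\<Sum>j<n. (c j * lam j) * (if i = j then 1 else 0)))"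
      by (simp add: Z_covariance \<psi>_L2 kernel_form_eigenfunction L2_orthonormal_inner[OF on] mult.assoc)
    also have "\<dots> = (\<Sum>i<n. lam i * (c i)\<^sup>2)"
      by (intro sum.cong refl, subst sum_mult_delta) (auto simp: power2_eq_square)
    also have "\<dots> \<le> (\<Sum>i<n. lam 0 * (c i)\<^sup>2)"
      by (intro sum_mono mult_right_mono lam_le) auto
    also have "\<dots> \<le> lam 0 * L2_inner MD f f"
      unfolding sum_distrib_left[symmetric] sums_unique[OF Ps]
      using lam_pos[of 0] sums_summable[OF Ps] by (intro mult_left_mono sum_le_suminf) auto
    finally show ?thesis
      unfolding L2_norm_def real_sqrt_mult[symmetric] by (rule real_sqrt_le_mono)
  qed
  have lim: "(\<lambda>n. L2_norm MD (\<lambda>x. f x - s n x)) \<longlonglongrightarrow> 0"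
    using basis f by (simp add: L2_basis_def L2_sums_def s_def c_def)
  have bound: "L2_norm P (Z f) \<le> sqrt (lam 0) * L2_norm MD f + L2_norm MD (\<lambda>x. f x - s n x) * sqrt (suminf lam)" for n
  proof -
    have d: "(\<lambda>x. f x - s n x) \<in> L2_space MD" by (intro L2_space_diff f s)
    have "L2_norm P (Z f) = L2_norm P (\<lambda>w. Z (s n) w + Z (\<lambda>x. f x - s n x) w)"
      unfolding L2_norm_def by (rule arg_cong[of _ _ sqrt], rule Z_inner_cong)
        (simp add: L2_inner_diff_left f s X_L2)
    also have "\<dots> \<le> L2_norm P (Z (s n)) + L2_norm P (Z (\<lambda>x. f x - s n x))"
      by (intro L2_norm_triangle Z_L2 s d)
    finally show ?thesis using Zs[of n] Z_norm_le[OF d] by linarith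
  qed
  have "(\<lambda>n. sqrt (lam 0) * L2_norm MD f + L2_norm MD (\<lambda>x. f x - s n x) * sqrt (suminf lam))
      \<longlonglongrightarrow> sqrt (lam 0) * L2_norm MD f + 0 * sqrt (suminf lam)"
    by (intro tendsto_intros lim)
  then have "L2_norm P (Z f) \<le> sqrt (lam 0) * L2_norm MD f + 0 * sqrt (suminf lam)"
    by (rule LIMSEQ_le_const) (use bound in auto)
  then have "(L2_norm P (Z f))\<^sup>2 \<le> (sqrt (lam 0) * L2_norm MD f)\<^sup>2"
    by (intro power_mono) auto
  then show ?thesis
    using lam_pos[of 0] by (simp add: L2_norm_sq power_mult_distrib Z_covariance f)
qed

text \<open>Some coefficient of \<open>f\<close> is nonzero, and the functional of that
  eigenfunction has nonzero covariance with the one of \<open>f\<close> because every eigenvalue is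
  positive; Cauchy-Schwarz excludes variance 0. This makes the matrix C positive definite.\<close>

lemma kernel_form_pos:
  assumes f: "f \<in> L2_space MD" and nz: "L2_inner MD f f \<noteq> 0"
  shows "0 < kernel_form D K f f"
proof -
  have "\<exists>j. L2_inner MD (\<psi> j) f \<noteq> 0"
  proof (rule ccontr)
    assume "\<nexists>j. L2_inner MD (\<psi> j) f \<noteq> 0"
    then have "(\<lambda>j. 0) sums L2_inner MD f f" using L2_basis_Parseval[OF basis f] by simp
    from sums_unique2[OF this sums_zero] show False using nz by simp
  qed
  then obtain j where j: "L2_inner MD f (\<psi> j) \<noteq> 0" by (auto simp: L2_inner_commute)
  have "0 < (L2_inner P (Z f) (Z (\<psi> j)))\<^sup>2"
    using j lam_pos[of j] by (simp add: Z_covariance f \<psi>_L2 kernel_form_eigenfunction)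
  also have "\<dots> \<le> L2_inner P (Z f) (Z f) * L2_inner P (Z (\<psi> j)) (Z (\<psi> j))"
    by (intro L2_Cauchy_Schwarz_sq Z_L2 f \<psi>_L2)
  finally have "L2_inner P (Z f) (Z f) \<noteq> 0" by auto
  then show ?thesis
    using L2_inner_self_nonneg[of P "Z f"] by (simp add: Z_covariance f)
qed

end

section \<open>Mean-square approximation by point values\<close>

context mercer_process
begin

lemma X_point_L2: "x \<in> D \<Longrightarrow> (\<lambda>w. X w x) \<in> L2_space P"
  by (rule centered_gaussian_L2_space[OF X_point_gaussian])

text \<open>Maurey's argument: averaging over the sampling point with density \<open>f\<^sup>2\<close>, the error of replacing
  \<open>\<integral>f X\<close> by \<open>X(x) / f(x)\<close> is orthogonal to everything done before, so some point is at least as good as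
  the average. Where \<open>f\<close> vanishes the weight \<open>1 / f(x)\<close> is \<open>0\<close>.\<close>

lemma Maurey_step:
  assumes f: "f \<in> L2_space MD" and f1: "L2_inner MD f f = 1" and A: "A \<in> L2_space P"
  shows "\<exists>x\<in>D. \<exists>b. L2_inner P (\<lambda>w. A w + Z f w - b * X w x) (\<lambda>w. A w + Z f w - b * X w x)
    \<le> L2_inner P A A + (suminf lam + 1)"
proof (rule ccontr)
  assume neg: "\<not> ?thesis"
  \<comment> \<open>Without the extra 1 in the claim the contradiction would need a strict
    inequality between integrals. With it, a lower bound \<open>C + 1\<close> at every point meets
    the average \<open>C\<close>.\<close>
  define C where "C = L2_inner P A A + suminf lam"
  have C: "0 \<le> C" using lam_sum_nonneg by (simp add: C_def)
  define g where "g w x = A w + Z f w - 1 / f x * X w x" for w x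
  have [measurable]: "f \<in> borel_measurable MD" "A \<in> borel_measurable P" "Z f \<in> borel_measurable P"
    using f A by (auto intro: L2_space_measurable Z_measurable)
  have gL2: "g' \<in> L2_space P" if "x \<in> D" "g' = (\<lambda>w. g w x)" for g' x
    unfolding that(2) g_def by (intro L2_space_diff L2_space_add A Z_L2 f L2_space_scale X_point_L2 that(1))
  have lower: "ennreal (C + 1) \<le> (\<integral>\<^sup>+w. ennreal ((g w x)\<^sup>2) \<partial>P)" if "x \<in> D" for x
  proof -
    have "C + 1 \<le> L2_inner P (\<lambda>w. g w x) (\<lambda>w. g w x)"
    proof (rule ccontr)
      assume "\<not> ?thesis"
      then have "L2_inner P (\<lambda>w. A w + Z f w - 1 / f x * X w x) (\<lambda>w. A w + Z f w - 1 / f x * X w x)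
          \<le> L2_inner P A A + (suminf lam + 1)"
        unfolding g_def C_def by linarith
      with neg that show False by blast
    qed
    then show ?thesis
      using L2_space_integrable_sq[OF gL2[OF that refl]]
      by (simp add: L2_inner_self_eq nn_integral_eq_integral ennreal_leI)
  qed
  have "ennreal (C + 1) = (\<integral>\<^sup>+x. ennreal ((f x)\<^sup>2) * ennreal (C + 1) \<partial>MD)"
    using f1 L2_space_integrable_sq[OF f]
    by (subst nn_integral_multc) (auto simp: nn_integral_eq_integral L2_inner_self_eq)
  also have "\<dots> \<le> (\<integral>\<^sup>+x. ennreal ((f x)\<^sup>2) * (\<integral>\<^sup>+w. ennreal ((g w x)\<^sup>2) \<partial>P) \<partial>MD)"
    using lower by (intro nn_integral_mono mult_left_mono) auto
  also have "\<dots> = (\<integral>\<^sup>+x. (\<integral>\<^sup>+w. ennreal ((f x * g w x)\<^sup>2) \<partial>P) \<partial>MD)"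
  proof (rule nn_integral_cong)
    fix x assume "x \<in> space MD"
    then have [measurable]: "(\<lambda>w. g w x) \<in> borel_measurable P"
      using gL2[OF _ refl] by (auto intro: L2_space_measurable)
    show "ennreal ((f x)\<^sup>2) * (\<integral>\<^sup>+w. ennreal ((g w x)\<^sup>2) \<partial>P) = (\<integral>\<^sup>+w. ennreal ((f x * g w x)\<^sup>2) \<partial>P)"
      by (subst nn_integral_cmult[symmetric]) (auto simp: power_mult_distrib ennreal_mult')
  qed
  also have "\<dots> = (\<integral>\<^sup>+w. (\<integral>\<^sup>+x. ennreal ((f x * g w x)\<^sup>2) \<partial>MD) \<partial>P)"
    unfolding g_def by (rule PM.Fubini') measurable
  also have "\<dots> \<le> (\<integral>\<^sup>+w. ennreal ((A w)\<^sup>2) + ennreal (L2_inner MD (X w) (X w)) \<partial>P)"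
  proof (rule nn_integral_mono)
    fix w assume w: "w \<in> space P"
    \<comment> \<open>The product of \<open>f x\<close> and the weight \<open>1 / f x\<close> is 1
      where \<open>f\<close> does not vanish and 0 elsewhere, so multiplication by \<open>f\<close>
      leaves the sample cut off to the support of \<open>f\<close>.\<close>
    define X' where "X' x = (if f x = 0 then 0 else X w x)" for x
    have Xm [measurable]: "X w \<in> borel_measurable MD" using X_L2[OF w] by (rule L2_space_measurable)
    have X': "X' \<in> L2_space MD"
    proof (rule L2_spaceI)
      show m: "X' \<in> borel_measurable MD" unfolding X'_def by measurable
      show "integrable MD (\<lambda>x. (X' x)\<^sup>2)"
        by (rule Bochner_Integration.integrable_bound[OF L2_space_integrable_sq[OF X_L2[OF w]]])
          (use m in \<open>auto simp: X'_def\<close>)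
    qed
    define c where "c = A w + Z f w"
    have eq: "f x * g w x = - (X' x + (- c) * f x)" for x
      by (simp add: g_def X'_def c_def field_simps)
    have fX: "L2_inner MD X' f = Z f w"
      unfolding L2_inner_def by (intro Bochner_Integration.integral_cong) (auto simp: X'_def)
    have XX: "L2_inner MD X' X' \<le> L2_inner MD (X w) (X w)"
      unfolding L2_inner_self_eq
      by (intro integral_mono L2_space_integrable_sq X' X_L2[OF w]) (auto simp: X'_def)
    have "(\<integral>\<^sup>+x. ennreal ((f x * g w x)\<^sup>2) \<partial>MD) = ennreal (L2_inner MD (\<lambda>x. X' x + (- c) * f x) (\<lambda>x. X' x + (- c) * f x))"
      unfolding eq power2_minus L2_inner_self_eq
      by (intro nn_integral_eq_integral L2_space_integrable_sq L2_space_add X' L2_space_scale f) auto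
    also have "L2_inner MD (\<lambda>x. X' x + (- c) * f x) (\<lambda>x. X' x + (- c) * f x)
        = L2_inner MD X' X' - 2 * c * Z f w + c\<^sup>2"
      by (subst L2_inner_add_scaled_self[OF X' f]) (simp add: f1 fX)
    \<comment> \<open>Completing the square with \<open>c = A w + Z f w\<close>; the negative term
      is then dropped.\<close>
    also have "\<dots> = (A w)\<^sup>2 - (Z f w)\<^sup>2 + L2_inner MD X' X'"
      by (simp add: c_def power2_eq_square algebra_simps)
    also have "ennreal \<dots> \<le> ennreal ((A w)\<^sup>2 + L2_inner MD (X w) (X w))"
      using XX zero_le_power2[of "Z f w"] by (intro ennreal_leI) linarith
    also have "\<dots> = ennreal ((A w)\<^sup>2) + ennreal (L2_inner MD (X w) (X w))"
      by (rule ennreal_plus) auto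
    finally show "(\<integral>\<^sup>+x. ennreal ((f x * g w x)\<^sup>2) \<partial>MD) \<le> ennreal ((A w)\<^sup>2) + ennreal (L2_inner MD (X w) (X w))" .
  qed
  also have "\<dots> = ennreal (L2_inner P A A) + ennreal (suminf lam)"
    using L2_space_integrable_sq[OF A]
    by (subst nn_integral_add) (auto simp: X_norm_nn_integral nn_integral_eq_integral L2_inner_self_eq[of P])
  also have "\<dots> = ennreal C"
    unfolding C_def using lam_sum_nonneg by (simp add: ennreal_plus)
  finally show False using C by (simp add: ennreal_le_iff)
qed

text \<open>The squared error grows linearly in \<open>n\<close> while the target is
  \<open>n\<close> times the functional, so division by \<open>n\<close> leaves a mean-square error
  of order 1/n.\<close>

lemma Maurey_sampling:
  assumes f: "f \<in> L2_space MD" and f1: "L2_inner MD f f = 1"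
  shows "\<exists>S a. finite S \<and> S \<subseteq> D \<and>
    L2_inner P (\<lambda>w. real n * Z f w - (\<Sum>x\<in>S. a x * X w x)) (\<lambda>w. real n * Z f w - (\<Sum>x\<in>S. a x * X w x))
      \<le> real n * (suminf lam + 1)"
proof (induction n)
  case 0
  show ?case by (intro exI[of _ "{}"]) (simp add: L2_inner_def)
next
  case (Suc n)
  then obtain S a where S: "finite S" "S \<subseteq> D" and
    le: "L2_inner P (\<lambda>w. real n * Z f w - (\<Sum>x\<in>S. a x * X w x)) (\<lambda>w. real n * Z f w - (\<Sum>x\<in>S. a x * X w x))
      \<le> real n * (suminf lam + 1)" by auto
  define A where "A w = real n * Z f w - (\<Sum>x\<in>S. a x * X w x)" for w
  have A: "A \<in> L2_space P"
    unfolding A_def using S(2)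
    by (intro L2_space_diff L2_space_scale Z_L2 f L2_space_sum X_point_L2) auto
  obtain x b where x: "x \<in> D" and
    le2: "L2_inner P (\<lambda>w. A w + Z f w - b * X w x) (\<lambda>w. A w + Z f w - b * X w x)
      \<le> L2_inner P A A + (suminf lam + 1)"
    using Maurey_step[OF f f1 A] by blast
  \<comment> \<open>The new point may already belong to \<open>S\<close>, in which case the two
    weights are added.\<close>
  define a' where "a' y = (if y \<in> S then a y else 0) + (if x = y then b else 0)" for y
  have "(\<Sum>y\<in>insert x S. a' y * X w y) = (\<Sum>y\<in>S. a y * X w y) + b * X w x" for w
  proof -
    have "(\<Sum>y\<in>insert x S. a' y * X w y) = (\<Sum>y\<in>insert x S. if y \<in> S then a y * X w y else 0)
        + (\<Sum>y\<in>insert x S. if x = y then b * X w y else 0)"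
      unfolding sum.distrib[symmetric] by (intro sum.cong refl) (auto simp: a'_def algebra_simps)
    also have "(\<Sum>y\<in>insert x S. if y \<in> S then a y * X w y else 0) = (\<Sum>y\<in>S. a y * X w y)"
      using S(1) by (intro sum.mono_neutral_cong_right) auto
    also have "(\<Sum>y\<in>insert x S. if x = y then b * X w y else 0) = b * X w x"
      using S(1) by (subst sum.delta') auto
    finally show ?thesis .
  qed
  then have eq: "(\<lambda>w. real (Suc n) * Z f w - (\<Sum>y\<in>insert x S. a' y * X w y)) = (\<lambda>w. A w + Z f w - b * X w x)"
    by (simp add: A_def algebra_simps)
  have "L2_inner P A A \<le> real n * (suminf lam + 1)" using le by (simp add: A_def[abs_def])
  then have "L2_inner P (\<lambda>w. A w + Z f w - b * X w x) (\<lambda>w. A w + Z f w - b * X w x)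
      \<le> real (Suc n) * (suminf lam + 1)"
    using le2 by (simp add: of_nat_Suc distrib_right)
  then show ?case
    unfolding eq[symmetric] using S x by (intro exI[of _ "insert x S"] exI[of _ a']) blast
qed

text \<open>The functional is a mean-square limit of finite combinations of point values, the only
  random variables whose laws are given. The sampling argument needs norm 1; functions of norm 0
  give the zero functional and are treated apart.\<close>

lemma Z_approx:
  assumes f: "f \<in> L2_space MD" and e: "0 < e"
  shows "\<exists>S a. finite S \<and> S \<subseteq> D \<and> L2_norm P (\<lambda>w. Z f w - (\<Sum>x\<in>S. a x * X w x)) < e"
proof (cases "L2_norm MD f = 0")
  case True
  then have "Z f w = 0" if "w \<in> space P" for w
    using L2_Cauchy_Schwarz[OF f X_L2[OF that]] by simp
  then have "L2_inner P (Z f) (Z f) = L2_inner P (\<lambda>w. 0) (\<lambda>w. 0)" by (rule Z_inner_cong)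
  then have "L2_norm P (Z f) = 0" by (simp add: L2_norm_def L2_inner_def[of P "\<lambda>w. 0"])
  then show ?thesis using e by (intro exI[of _ "{}"]) simp
next
  case False
  define r where "r = L2_norm MD f"
  have r: "0 < r" using False L2_norm_nonneg[of MD f] unfolding r_def by linarith
  define h where "h = (\<lambda>x. (1 / r) * f x)"
  have h: "h \<in> L2_space MD" unfolding h_def by (intro L2_space_scale f)
  have h1: "L2_inner MD h h = 1"
    unfolding h_def L2_norm_sq[symmetric] L2_norm_scale r_def[symmetric] using r by simp
  have T: "0 < suminf lam + 1" using lam_sum_nonneg by linarith
  \<comment> \<open>After undoing the normalization the squared error is at most the numerator
    \<open>r\<close>^2 times \<open>suminf lam + 1\<close>, divided by \<open>n\<close>.\<close>
  obtain n where n: "r\<^sup>2 * (suminf lam + 1) / e\<^sup>2 < real n" using reals_Archimedean2 by blast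
  have "0 \<le> r\<^sup>2 * (suminf lam + 1) / e\<^sup>2" using T by simp
  with n have n0: "0 < real n" by linarith
  obtain S a where S: "finite S" "S \<subseteq> D" and
    le: "L2_inner P (\<lambda>w. real n * Z h w - (\<Sum>x\<in>S. a x * X w x)) (\<lambda>w. real n * Z h w - (\<Sum>x\<in>S. a x * X w x))
      \<le> real n * (suminf lam + 1)"
    using Maurey_sampling[OF h h1] by blast
  have eq: "(\<lambda>w. Z f w - (\<Sum>x\<in>S. (r / real n * a x) * X w x))
      = (\<lambda>w. (r / real n) * (real n * Z h w - (\<Sum>x\<in>S. a x * X w x)))"
  proof
    fix w
    have "Z h w = 1 / r * Z f w" unfolding h_def by (rule L2_inner_scale_left)
    then have "Z f w = r * Z h w" using r by simp
    then show "Z f w - (\<Sum>x\<in>S. (r / real n * a x) * X w x) = (r / real n) * (real n * Z h w - (\<Sum>x\<in>S. a x * X w x))"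
      using n0 by (simp add: right_diff_distrib sum_distrib_left mult.assoc)
  qed
  have "(L2_norm P (\<lambda>w. Z f w - (\<Sum>x\<in>S. (r / real n * a x) * X w x)))\<^sup>2 \<le> (r / real n)\<^sup>2 * (real n * (suminf lam + 1))"
    unfolding eq L2_norm_scale power_mult_distrib power2_abs L2_norm_sq
    using le by (intro mult_left_mono) auto
  also have "\<dots> = r\<^sup>2 * (suminf lam + 1) / real n" using n0 by (simp add: power2_eq_square field_simps)
  also have "\<dots> < e\<^sup>2" using n n0 e by (simp add: field_simps)
  finally have "L2_norm P (\<lambda>w. Z f w - (\<Sum>x\<in>S. (r / real n * a x) * X w x)) < e"
    using e by (intro power2_less_imp_less[of _ e]) auto
  with S show ?thesis by (intro exI[of _ S] exI[of _ "\<lambda>x. r / real n * a x"]) auto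
qed

end

lemma iexp_diff_le: "norm (iexp a - iexp b) \<le> \<bar>a - b\<bar>"
proof -
  have "iexp a - iexp b = iexp b * (iexp (a - b) - 1)"
    by (simp add: algebra_simps flip: exp_add)
  then show ?thesis using iexp_approx1[of "a - b" 0] by (simp add: norm_mult)
qed

lemma (in prob_space) L1_le_L2_norm:
  assumes "f \<in> L2_space M"
  shows "integrable M (\<lambda>x. \<bar>f x\<bar>)" "(\<integral>x. \<bar>f x\<bar> \<partial>M) \<le> L2_norm M f"
proof -
  have 1: "(\<lambda>x. 1) \<in> L2_space M" by (simp add: L2_space_def)
  have a: "(\<lambda>x. \<bar>f x\<bar>) \<in> L2_space M" using assms by (auto simp: L2_space_def)
  show "integrable M (\<lambda>x. \<bar>f x\<bar>)" using L2_space_integrable_mult[OF a 1] by simp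
  show "(\<integral>x. \<bar>f x\<bar> \<partial>M) \<le> L2_norm M f"
    using L2_Cauchy_Schwarz[OF a 1] by (simp add: L2_inner_def L2_norm_def prob_space)
qed

text \<open>Independence is available for the product sigma-algebra over \<open>D\<close>, where
  finite combinations of point values are visibly measurable but integrals are not. Hence the
  characteristic function is factored for the approximations and only then passed to the limit. The
  formula yields both the Gaussian law and the independence across samples.\<close>

lemma iid_functionals_char:
  fixes D :: "'a::euclidean_space set"
  assumes P: "prob_space P" and D: "D \<in> sets lebesgue" and mercer: "mercer_expansion D K lam \<psi>"
    and iid: "iid_gaussian_processes P D K l \<omega>"
    and f: "\<And>i. i < l \<Longrightarrow> f i \<in> L2_space (lebesgue_on D)"
  shows "(\<integral>w. iexp (\<Sum>i<l. L2_inner (lebesgue_on D) (f i) (\<omega> i w)) \<partial>P)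
    = exp (- (\<Sum>i<l. kernel_form D K (f i) (f i)) / 2)"
proof -
  interpret prob_space P by (rule P)
  have mp: "mercer_process P D K lam \<psi> (\<omega> i)" if "i < l" for i
    using that iid by (intro mercer_process.intro mercer_process_axioms.intro P D mercer)
      (simp add: iid_gaussian_processes_def)
  let ?M = "lebesgue_on D"
  let ?Z = "\<lambda>i w. L2_inner ?M (f i) (\<omega> i w)"
  define Q where "Q i n S a \<longleftrightarrow> finite S \<and> S \<subseteq> D \<and>
      L2_norm P (\<lambda>w. ?Z i w - (\<Sum>x\<in>S. a x * \<omega> i w x)) < 1 / real (Suc n)" for i n S a
  have "\<exists>S a. Q i n S a" if "i < l" for i n
    unfolding Q_def by (rule mercer_process.Z_approx[OF mp[OF that] f[OF that]]) simp
  then obtain S a where "\<And>i n. i < l \<Longrightarrow> Q i n (S i n) (a i n)" by metis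
  note S = this[unfolded Q_def]
  define T where "T i n w = (\<Sum>x\<in>S i n. a i n x * \<omega> i w x)" for i n w
  define v where "v i n = (\<Sum>x\<in>S i n. \<Sum>y\<in>S i n. a i n x * a i n y * K x y)" for i n
  have T: "centered_gaussian P (T i n) (v i n)" if "i < l" for i n
    unfolding T_def v_def using S[OF that] that by (intro mercer_process.X_comb_gaussian[OF mp]) auto
  have TL2: "T i n \<in> L2_space P" if "i < l" for i n by (rule centered_gaussian_L2_space[OF T[OF that]])
  have ZL2: "?Z i \<in> L2_space P" if "i < l" for i by (rule mercer_process.Z_L2[OF mp[OF that] f[OF that]])
  have dL2: "(\<lambda>w. ?Z i w - T i n w) \<in> L2_space P" if "i < l" for i n
    using that by (intro L2_space_diff ZL2 TL2)
  have small: "L2_norm P (\<lambda>w. ?Z i w - T i n w) \<le> 1 / real (Suc n)" if "i < l" for i n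
    using S[OF that, of n] by (simp add: T_def)
  have Tchar: "(\<integral>w. iexp (\<Sum>i<l. T i n w) \<partial>P) = exp (- (\<Sum>i<l. v i n) / 2)" for n
  proof -
    have ind: "indep_vars (\<lambda>_. PiM D (\<lambda>_. borel)) (\<lambda>i w. restrict (\<omega> i w) D) {..<l}"
      using iid by (simp add: iid_gaussian_processes_def)
    \<comment> \<open>The points of \<open>S i n\<close> lie in \<open>D\<close>, so the combination
      factors through the restricted path.\<close>
    have "indep_vars (\<lambda>_. borel) (\<lambda>i w. iexp (\<Sum>x\<in>S i n. a i n x * (restrict (\<omega> i w) D) x)) {..<l}"
    proof (rule indep_vars_compose2[OF ind])
      fix i assume i: "i \<in> {..<l}"
      show "(\<lambda>g. iexp (\<Sum>x\<in>S i n. a i n x * g x)) \<in> borel_measurable (PiM D (\<lambda>_. borel))"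
        by (measurable; use S[of i n] i in auto)
    qed
    moreover have "(\<Sum>x\<in>S i n. a i n x * (restrict (\<omega> i w) D) x) = T i n w" if "i \<in> {..<l}" for i w
      using S[of i n] that by (auto simp: T_def intro!: sum.cong)
    then have "indep_vars (\<lambda>_. borel) (\<lambda>i w. iexp (\<Sum>x\<in>S i n. a i n x * (restrict (\<omega> i w) D) x)) {..<l}
        = indep_vars (\<lambda>_. borel) (\<lambda>i w. iexp (T i n w)) {..<l}"
      by (intro indep_vars_cong refl ext) (simp only:)
    ultimately have ind: "indep_vars (\<lambda>_. borel) (\<lambda>i w. iexp (T i n w)) {..<l}" by simp
    have "(\<integral>w. iexp (\<Sum>i<l. T i n w) \<partial>P) = (\<integral>w. (\<Prod>i<l. iexp (T i n w)) \<partial>P)"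
      by (simp add: exp_sum sum_distrib_left)
    also have "\<dots> = (\<Prod>i<l. \<integral>w. iexp (T i n w) \<partial>P)"
    proof (rule indep_vars_lebesgue_integral[OF _ ind])
      fix i assume "i \<in> {..<l}"
      then have [measurable]: "T i n \<in> borel_measurable P" using TL2 by (auto intro: L2_space_measurable)
      show "integrable P (\<lambda>w. iexp (T i n w))" by (rule integrable_const_bound[of _ 1]) auto
    qed simp
    also have "\<dots> = (\<Prod>i<l. complex_of_real (exp (- v i n / 2)))"
      using centered_gaussian_char[OF T] by (intro prod.cong) auto
    also have "\<dots> = exp (- (\<Sum>i<l. v i n) / 2)"
      by (simp add: exp_sum[symmetric] sum_negf sum_divide_distrib flip: of_real_prod)
    finally show ?thesis .
  qed
  have v_lim: "(\<lambda>n. v i n) \<longlonglongrightarrow> kernel_form D K (f i) (f i)" if i: "i < l" for i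
  proof -
    have "(\<lambda>n. \<bar>L2_norm P (?Z i) - L2_norm P (T i n)\<bar>) \<longlonglongrightarrow> 0"
    proof (rule tendsto_sandwich[OF always_eventually always_eventually tendsto_const LIMSEQ_inverse_real_of_nat])
      show "\<forall>n. \<bar>L2_norm P (?Z i) - L2_norm P (T i n)\<bar> \<le> inverse (real (Suc n))"
        using L2_norm_diff_le[OF ZL2[OF i] TL2[OF i]] small[OF i] by (auto simp: inverse_eq_divide intro: order_trans)
    qed simp
    then have "(\<lambda>n. L2_norm P (?Z i) - L2_norm P (T i n)) \<longlonglongrightarrow> 0" by (rule tendsto_rabs_zero_cancel)
    then have "(\<lambda>n. (L2_norm P (?Z i) - (L2_norm P (?Z i) - L2_norm P (T i n)))\<^sup>2) \<longlonglongrightarrow> (L2_norm P (?Z i) - 0)\<^sup>2"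
      by (intro tendsto_intros)
    moreover have "(L2_norm P (T i n))\<^sup>2 = v i n" for n
      using centered_gaussian_variance[OF T[OF i]] by (simp add: L2_norm_sq L2_inner_self_eq)
    ultimately show ?thesis
      using mercer_process.Z_covariance(1)[OF mp[OF i] f[OF i] f[OF i]] by (simp add: L2_norm_sq)
  qed
  have "(\<lambda>n. exp (- (\<Sum>i<l. v i n) / 2)) \<longlonglongrightarrow> exp (- (\<Sum>i<l. kernel_form D K (f i) (f i)) / 2)"
    using v_lim by (intro tendsto_intros) auto
  then have 1: "(\<lambda>n. \<integral>w. iexp (\<Sum>i<l. T i n w) \<partial>P) \<longlonglongrightarrow> exp (- (\<Sum>i<l. kernel_form D K (f i) (f i)) / 2)"
    unfolding Tchar by (rule tendsto_of_real)
  have [measurable]: "?Z i \<in> borel_measurable P" "T i n \<in> borel_measurable P" if "i < l" for i n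
    using that ZL2 TL2 by (auto intro: L2_space_measurable)
  \<comment> \<open>The map a \<mapsto> exp(i a) is 1-Lipschitz, and on a probability space the
    first absolute moment is at most the mean-square norm, so each functional contributes at most
    \<open>1 / real (Suc n)\<close>.\<close>
  have "norm ((\<integral>w. iexp (\<Sum>i<l. T i n w) \<partial>P) - (\<integral>w. iexp (\<Sum>i<l. ?Z i w) \<partial>P)) \<le> real l * (1 / real (Suc n))" for n
  proof -
    have i1: "integrable P (\<lambda>w. iexp (\<Sum>i<l. T i n w))" "integrable P (\<lambda>w. iexp (\<Sum>i<l. ?Z i w))"
      by (rule integrable_const_bound[of _ 1]; simp)+
    have i2: "integrable P (\<lambda>w. \<Sum>i<l. \<bar>?Z i w - T i n w\<bar>)"
      using L1_le_L2_norm(1)[OF dL2] by (intro Bochner_Integration.integrable_sum) auto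
    have "norm ((\<integral>w. iexp (\<Sum>i<l. T i n w) \<partial>P) - (\<integral>w. iexp (\<Sum>i<l. ?Z i w) \<partial>P))
        = norm (\<integral>w. iexp (\<Sum>i<l. T i n w) - iexp (\<Sum>i<l. ?Z i w) \<partial>P)"
      using i1 by simp
    also have "\<dots> \<le> (\<integral>w. norm (iexp (\<Sum>i<l. T i n w) - iexp (\<Sum>i<l. ?Z i w)) \<partial>P)"
      by (rule integral_norm_bound)
    also have "\<dots> \<le> (\<integral>w. (\<Sum>i<l. \<bar>?Z i w - T i n w\<bar>) \<partial>P)"
    proof (rule integral_mono)
      show "integrable P (\<lambda>w. norm (iexp (\<Sum>i<l. T i n w) - iexp (\<Sum>i<l. ?Z i w)))"
        using i1 by (intro integrable_norm Bochner_Integration.integrable_diff)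
      fix w
      have "norm (iexp (\<Sum>i<l. T i n w) - iexp (\<Sum>i<l. ?Z i w)) \<le> \<bar>(\<Sum>i<l. T i n w) - (\<Sum>i<l. ?Z i w)\<bar>"
        by (rule iexp_diff_le)
      also have "\<dots> = \<bar>\<Sum>i<l. ?Z i w - T i n w\<bar>" unfolding sum_subtractf by (rule abs_minus_commute)
      also have "\<dots> \<le> (\<Sum>i<l. \<bar>?Z i w - T i n w\<bar>)" by (rule sum_abs)
      finally show "norm (iexp (\<Sum>i<l. T i n w) - iexp (\<Sum>i<l. ?Z i w)) \<le> (\<Sum>i<l. \<bar>?Z i w - T i n w\<bar>)" .
    qed (rule i2)
    also have "\<dots> = (\<Sum>i<l. \<integral>w. \<bar>?Z i w - T i n w\<bar> \<partial>P)"
      using L1_le_L2_norm(1)[OF dL2] by (intro Bochner_Integration.integral_sum) auto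
    also have "\<dots> \<le> (\<Sum>i<l. 1 / real (Suc n))"
      by (intro sum_mono order_trans[OF L1_le_L2_norm(2)[OF dL2] small]) auto
    finally show ?thesis by simp
  qed
  note bound = this
  have "(\<lambda>n. real l * inverse (real (Suc n))) \<longlonglongrightarrow> real l * 0"
    by (intro tendsto_mult tendsto_const LIMSEQ_inverse_real_of_nat)
  then have null: "(\<lambda>n. real l * (1 / real (Suc n))) \<longlonglongrightarrow> 0"
    by (simp only: inverse_eq_divide mult_zero_right)
  have "(\<lambda>n. (\<integral>w. iexp (\<Sum>i<l. T i n w) \<partial>P) - (\<integral>w. iexp (\<Sum>i<l. ?Z i w) \<partial>P)) \<longlonglongrightarrow> 0"
    by (rule Lim_null_comparison[OF always_eventually null]) (rule allI, rule bound)
  then have "(\<lambda>n. \<integral>w. iexp (\<Sum>i<l. T i n w) \<partial>P) \<longlonglongrightarrow> (\<integral>w. iexp (\<Sum>i<l. ?Z i w) \<partial>P)"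
    by (rule LIM_zero_cancel)
  then show ?thesis using 1 LIMSEQ_unique by blast
qed

subsection \<open>Range approximation for a fixed sample\<close>

lemma suminf_ennreal_swap:
  fixes f :: "nat \<Rightarrow> nat \<Rightarrow> ennreal"
  shows "(\<Sum>i. \<Sum>j. f i j) = (\<Sum>j. \<Sum>i. f i j)"
proof -
  have "(\<Sum>i. \<Sum>j. f i j) = (\<integral>\<^sup>+i. (\<Sum>j. f i j) \<partial>count_space UNIV)"
    by (simp add: nn_integral_count_space_nat)
  also have "\<dots> = (\<Sum>j. \<integral>\<^sup>+i. f i j \<partial>count_space UNIV)"
    by (rule nn_integral_suminf) simp
  finally show ?thesis by (simp add: nn_integral_count_space_nat)
qed

lemma L2_inner_residual_right:
  assumes "e \<in> L2_space M" "h \<in> L2_space M" "\<And>i. i \<in> I \<Longrightarrow> g i \<in> L2_space M"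
  shows "L2_inner M h (\<lambda>x. e x - (\<Sum>i\<in>I. a i * g i x)) = L2_inner M h e - (\<Sum>i\<in>I. a i * L2_inner M h (g i))"
  by (subst L2_inner_diff_right)
    (use assms in \<open>auto intro!: L2_space_sum L2_space_scale simp: L2_inner_lincomb_right\<close>)

lemma hilbert_schmidt_operator: "hilbert_schmidt M N A \<Longrightarrow> L2_operator M N A"
  by (simp add: hilbert_schmidt_def)

lemma L2_operator_space: "L2_operator M N A \<Longrightarrow> f \<in> L2_space M \<Longrightarrow> A f \<in> L2_space N"
  by (simp add: L2_operator_def)

locale hs_svd =
  fixes M :: "'a measure" and N :: "'b measure" and A :: "('a \<Rightarrow> real) \<Rightarrow> ('b \<Rightarrow> real)"
    and \<sigma> :: "nat \<Rightarrow> real" and u :: "nat \<Rightarrow> 'b \<Rightarrow> real" and v :: "nat \<Rightarrow> 'a \<Rightarrow> real"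
  assumes hs: "hilbert_schmidt M N A" and svd: "is_svd M N A \<sigma> u v"
begin

lemma v_orthonormal: "L2_orthonormal M v" and u_orthonormal: "L2_orthonormal N u"
  using svd by (auto simp: is_svd_def)

lemma v_L2: "v j \<in> L2_space M" and u_L2: "u j \<in> L2_space N"
  using v_orthonormal u_orthonormal by (auto intro: L2_orthonormal_space)

lemma A_L2: "f \<in> L2_space M \<Longrightarrow> A f \<in> L2_space N"
  using hs by (intro L2_operator_space[of M N A] hilbert_schmidt_operator)

text \<open>\<open>A\<close> is linear only up to null sets, so the singular expansions of
  \<open>A e\<close> and of each \<open>A (g i)\<close> are added term by term instead of rewriting
  \<open>A\<close> of the combination.\<close>

lemma svd_lincomb_sums:
  fixes g :: "nat \<Rightarrow> 'a \<Rightarrow> real"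
  assumes e: "e \<in> L2_space M" and g: "\<And>i. i < l \<Longrightarrow> g i \<in> L2_space M"
  shows "L2_sums N (\<lambda>j y. (\<sigma> j * L2_inner M (v j) (\<lambda>x. e x - (\<Sum>i<l. a i * g i x))) * u j y)
    (\<lambda>y. A e y - (\<Sum>i<l. a i * A (g i) y))"
  using g
proof (induction l)
  case 0
  then show ?case using svd e by (simp add: is_svd_def)
next
  case (Suc l)
  have gl: "g l \<in> L2_space M" and gi: "\<And>i. i < l \<Longrightarrow> g i \<in> L2_space M" using Suc.prems by auto
  have r: "(\<lambda>x. e x - (\<Sum>i<l. a i * g i x)) \<in> L2_space M"
    using gi by (intro L2_space_diff e L2_space_sum L2_space_scale) auto
  have *: "L2_sums N (\<lambda>j y. (\<sigma> j * L2_inner M (v j) (\<lambda>x. e x - (\<Sum>i<l. a i * g i x))) * u j y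
        + (- a l) * ((\<sigma> j * L2_inner M (v j) (g l)) * u j y))
      (\<lambda>y. (A e y - (\<Sum>i<l. a i * A (g i) y)) + (- a l) * A (g l) y)"
    using Suc.IH[OF gi] svd gl gi
    by (intro L2_sums_add_scaled L2_space_diff A_L2 e L2_space_sum L2_space_scale u_L2 gl)
      (auto simp: is_svd_def)
  have inner: "L2_inner M (v j) (\<lambda>x. e x - (\<Sum>i<Suc l. a i * g i x))
      = L2_inner M (v j) (\<lambda>x. e x - (\<Sum>i<l. a i * g i x)) - a l * L2_inner M (v j) (g l)" for j
    using L2_inner_diff_right[OF r L2_space_scale[OF gl, of "a l"] v_L2[of j]]
    by (simp add: L2_inner_scale_right algebra_simps)
  have terms: "(\<lambda>j y. (\<sigma> j * L2_inner M (v j) (\<lambda>x. e x - (\<Sum>i<Suc l. a i * g i x))) * u j y) =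
      (\<lambda>j y. (\<sigma> j * L2_inner M (v j) (\<lambda>x. e x - (\<Sum>i<l. a i * g i x))) * u j y
        + (- a l) * ((\<sigma> j * L2_inner M (v j) (g l)) * u j y))"
    unfolding inner by (simp add: algebra_simps)
  have limit: "(\<lambda>y. A e y - (\<Sum>i<Suc l. a i * A (g i) y)) =
      (\<lambda>y. (A e y - (\<Sum>i<l. a i * A (g i) y)) + (- a l) * A (g l) y)"
    by (simp add: diff_diff_eq)
  show ?case unfolding terms limit by (rule *)
qed

lemma svd_lincomb_norm:
  fixes g :: "nat \<Rightarrow> 'a \<Rightarrow> real"
  assumes e: "e \<in> L2_space M" and g: "\<And>i. i < l \<Longrightarrow> g i \<in> L2_space M"
  shows "(\<lambda>j. (\<sigma> j)\<^sup>2 * (L2_inner M (v j) (\<lambda>x. e x - (\<Sum>i<l. a i * g i x)))\<^sup>2) sums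
    (L2_norm N (\<lambda>y. A e y - (\<Sum>i<l. a i * A (g i) y)))\<^sup>2"
proof -
  have "(\<lambda>j. (\<sigma> j * L2_inner M (v j) (\<lambda>x. e x - (\<Sum>i<l. a i * g i x)))\<^sup>2) sums
    L2_inner N (\<lambda>y. A e y - (\<Sum>i<l. a i * A (g i) y)) (\<lambda>y. A e y - (\<Sum>i<l. a i * A (g i) y))"
    using g by (intro L2_sums_orthonormal_norm[OF u_orthonormal _ svd_lincomb_sums[OF e g]]
        L2_space_diff A_L2 e L2_space_sum L2_space_scale) auto
  then show ?thesis by (simp add: power_mult_distrib L2_norm_sq)
qed

lemma svd_norm:
  "e \<in> L2_space M \<Longrightarrow> (\<lambda>j. (\<sigma> j)\<^sup>2 * (L2_inner M (v j) e)\<^sup>2) sums (L2_norm N (A e))\<^sup>2"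
  using svd_lincomb_norm[of e 0] by simp

lemma suminf_basis_inner:
  assumes "L2_basis M e" "\<And>m. q m \<in> L2_space M"
  shows "(\<Sum>n. \<Sum>m. ennreal ((\<sigma> m)\<^sup>2 * (L2_inner M (q m) (e n))\<^sup>2)) = (\<Sum>m. ennreal ((\<sigma> m)\<^sup>2 * L2_inner M (q m) (q m)))"
proof -
  have "(\<Sum>n. ennreal ((\<sigma> m)\<^sup>2 * (L2_inner M (q m) (e n))\<^sup>2)) = ennreal ((\<sigma> m)\<^sup>2 * L2_inner M (q m) (q m))" for m
  proof (rule suminf_ennreal_eq)
    have "(\<lambda>n. (L2_inner M (q m) (e n))\<^sup>2) sums L2_inner M (q m) (q m)"
      using L2_basis_Parseval[OF assms(1) assms(2)[of m]] by (simp add: L2_inner_commute)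
    then show "(\<lambda>n. (\<sigma> m)\<^sup>2 * (L2_inner M (q m) (e n))\<^sup>2) sums ((\<sigma> m)\<^sup>2 * L2_inner M (q m) (q m))"
      by (rule sums_mult)
  qed auto
  then show ?thesis by (subst suminf_ennreal_swap) simp
qed

text \<open>Parseval in both indices with the sums exchanged: the value is the same for every basis,
  which makes the arbitrary choice in \<open>hs_norm\<close> harmless.\<close>

lemma basis_image_suminf:
  assumes e: "L2_basis M e"
  shows "(\<Sum>n. ennreal ((L2_norm N (A (e n)))\<^sup>2)) = (\<Sum>m. ennreal ((\<sigma> m)\<^sup>2))"
proof -
  have eL: "e n \<in> L2_space M" for n by (rule L2_orthonormal_space[OF L2_basis_orthonormal[OF e]])
  have "ennreal ((L2_norm N (A (e n)))\<^sup>2) = (\<Sum>m. ennreal ((\<sigma> m)\<^sup>2 * (L2_inner M (v m) (e n))\<^sup>2))" for n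
    by (rule suminf_ennreal_eq[symmetric, OF _ svd_norm[OF eL]]) simp
  then show ?thesis
    using suminf_basis_inner[OF e v_L2] by (simp add: L2_orthonormal_inner[OF v_orthonormal])
qed

lemma sigma_summable: "summable (\<lambda>j. (\<sigma> j)\<^sup>2)"
proof (rule summable_suminf_not_top)
  obtain e where e: "L2_basis M e" and sm: "summable (\<lambda>j. (L2_norm N (A (e j)))\<^sup>2)"
    using hs by (auto simp: hilbert_schmidt_def)
  show "(\<Sum>m. ennreal ((\<sigma> m)\<^sup>2)) \<noteq> \<top>"
    unfolding basis_image_suminf[OF e, symmetric] using sm by (subst suminf_ennreal2) auto
qed simp

lemma basis_image_summable:
  assumes e: "L2_basis M e"
  shows "summable (\<lambda>n. (L2_norm N (A (e n)))\<^sup>2)"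
proof (rule summable_suminf_not_top)
  show "(\<Sum>n. ennreal ((L2_norm N (A (e n)))\<^sup>2)) \<noteq> \<top>"
    unfolding basis_image_suminf[OF e] using sigma_summable by (subst suminf_ennreal2) auto
qed simp

definition residual_norm :: "nat \<Rightarrow> (nat \<Rightarrow> 'a \<Rightarrow> real) \<Rightarrow> real" where
  "residual_norm l g = hs_norm M N (range_residual N A l (\<lambda>i. A (g i)))"

lemma residual_summable:
  assumes e: "L2_basis M e" and g: "\<And>i. i < l \<Longrightarrow> g i \<in> L2_space M"
  shows "summable (\<lambda>n. (L2_norm N (range_residual N A l (\<lambda>i. A (g i)) (e n)))\<^sup>2)"
proof (rule summable_comparison_test'[OF basis_image_summable[OF e]])
  fix n
  have "e n \<in> L2_space M" by (rule L2_orthonormal_space[OF L2_basis_orthonormal[OF e]])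
  moreover have "(\<lambda>y. \<Sum>i<l. 0 * A (g i) y) \<in> col_span l (\<lambda>i. A (g i))"
    unfolding col_span_def by (intro CollectI exI[of _ "\<lambda>_. 0"] refl)
  ultimately have "L2_norm N (range_residual N A l (\<lambda>i. A (g i)) (e n)) \<le> L2_norm N (\<lambda>y. A (e n) y - (\<Sum>i<l. 0 * A (g i) y))"
    unfolding range_residual_def using g by (intro orth_proj_minimal A_L2)
  then show "norm ((L2_norm N (range_residual N A l (\<lambda>i. A (g i)) (e n)))\<^sup>2) \<le> (L2_norm N (A (e n)))\<^sup>2"
    by (simp add: power_mono)
qed

lemma residual_norm_nonneg:
  assumes "\<exists>e. L2_basis M e" and g: "\<And>i. i < l \<Longrightarrow> g i \<in> L2_space M"
  shows "0 \<le> residual_norm l g"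
proof -
  have "0 \<le> (\<Sum>n. (L2_norm N (range_residual N A l (\<lambda>i. A (g i)) ((SOME e. L2_basis M e) n)))\<^sup>2)"
    by (rule suminf_nonneg[OF residual_summable[OF someI_ex[OF assms(1)] g]]) simp_all
  then show ?thesis unfolding residual_norm_def hs_norm_def Let_def by (rule real_sqrt_ge_zero)
qed

text \<open>The squared distance of \<open>A (e n)\<close> to any fixed combination of columns is a
  series in the scalar functionals of \<open>G w i\<close>. Measurability in the sample enters
  through these scalars and passes to the projection by the rational-coefficient argument.\<close>

lemma residual_norm_measurable:
  assumes "\<exists>e. L2_basis M e"
    and G: "\<And>i w. i < l \<Longrightarrow> w \<in> space P \<Longrightarrow> G w i \<in> L2_space M"
    and meas: "\<And>m i. i < l \<Longrightarrow> (\<lambda>w. L2_inner M (v m) (G w i)) \<in> borel_measurable P"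
  shows "(\<lambda>w. residual_norm l (G w)) \<in> borel_measurable P"
proof -
  define e where "e = (SOME e. L2_basis M e)"
  have e: "L2_basis M e" unfolding e_def using assms(1) by (rule someI_ex)
  have eL: "e n \<in> L2_space M" for n by (rule L2_orthonormal_space[OF L2_basis_orthonormal[OF e]])
  have "(\<lambda>w. L2_norm N (range_residual N A l (\<lambda>i. A (G w i)) (e n))) \<in> borel_measurable P" for n
    unfolding range_residual_def
  proof (rule borel_measurable_orth_proj_residual)
    show "A (G w i) \<in> L2_space N" if "w \<in> space P" "i < l" for w i using that by (intro A_L2 G)
    show "A (e n) \<in> L2_space N" by (intro A_L2 eL)
    fix a
    have "(\<lambda>w. sqrt (\<Sum>j. (\<sigma> j)\<^sup>2 * (L2_inner M (v j) (e n) - (\<Sum>i<l. a i * L2_inner M (v j) (G w i)))\<^sup>2)) \<in> borel_measurable P"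
      using meas by measurable
    moreover have "L2_norm N (\<lambda>y. A (e n) y - (\<Sum>i<l. a i * A (G w i) y)) =
        sqrt (\<Sum>j. (\<sigma> j)\<^sup>2 * (L2_inner M (v j) (e n) - (\<Sum>i<l. a i * L2_inner M (v j) (G w i)))\<^sup>2)"
      if w: "w \<in> space P" for w
    proof -
      have "L2_inner M (v j) (\<lambda>x. e n x - (\<Sum>i<l. a i * G w i x)) =
          L2_inner M (v j) (e n) - (\<Sum>i<l. a i * L2_inner M (v j) (G w i))" for j
        by (rule L2_inner_residual_right[OF eL v_L2]) (use G[OF _ w] in auto)
      then have "(L2_norm N (\<lambda>y. A (e n) y - (\<Sum>i<l. a i * A (G w i) y)))\<^sup>2 =
          (\<Sum>j. (\<sigma> j)\<^sup>2 * (L2_inner M (v j) (e n) - (\<Sum>i<l. a i * L2_inner M (v j) (G w i)))\<^sup>2)"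
        using sums_unique[OF svd_lincomb_norm[OF eL G[OF _ w], where a = a]] by (simp only:)
      from real_sqrt_unique[OF this L2_norm_nonneg] show ?thesis by (rule sym)
    qed
    ultimately show "(\<lambda>w. L2_norm N (\<lambda>y. A (e n) y - (\<Sum>i<l. a i * A (G w i) y))) \<in> borel_measurable P"
      by (subst measurable_cong)
  qed
  then show ?thesis
    unfolding residual_norm_def hs_norm_def Let_def e_def[symmetric] by measurable
qed

lemma tail_functional_summable:
  assumes g: "\<And>i. i < l \<Longrightarrow> g i \<in> L2_space M"
  shows "summable (\<lambda>m. (\<sigma> (m + k))\<^sup>2 * (\<Sum>i<(l::nat). (L2_inner M (v (m + k)) (g i))\<^sup>2))"
proof -
  have "summable (\<lambda>m. \<Sum>i<l. (\<sigma> m)\<^sup>2 * (L2_inner M (v m) (g i))\<^sup>2)"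
    using svd_norm[OF g] by (intro summable_sum) (auto dest: sums_summable)
  then show ?thesis by (subst summable_iff_shift) (simp add: sum_distrib_left)
qed

context
  fixes k l :: nat and g :: "nat \<Rightarrow> 'a \<Rightarrow> real" and T :: "nat \<Rightarrow> nat \<Rightarrow> real"
  assumes g: "\<And>i. i < l \<Longrightarrow> g i \<in> L2_space M"
    and T: "\<And>m j. m < k \<Longrightarrow> j < k \<Longrightarrow> (\<Sum>i<l. L2_inner M (v m) (g i) * T i j) = (if m = j then 1 else 0)"
begin

text \<open>The candidate \<open>\<Sum>\<^sub>i a\<^sub>i A(g\<^sub>i)\<close> for \<open>A e\<close> has \<open>a\<^sub>i = \<Sum>\<^sub>j \<langle>v\<^sub>j, e\<rangle> T\<^sub>i\<^sub>j\<close>, so that the error has no component along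
  the first \<open>k\<close> left singular functions.\<close>

lemma residual_norm_bound:
  assumes "\<exists>e. L2_basis M e"
  shows "residual_norm l g \<le> sqrt ((\<Sum>m. (\<sigma> (m + k))\<^sup>2) +
    (\<Sum>m. (\<sigma> (m + k))\<^sup>2 * (\<Sum>i<l. (L2_inner M (v (m + k)) (g i))\<^sup>2)) * (\<Sum>i<l. \<Sum>j<k. (T i j)\<^sup>2))"
proof -
  define e where "e = (SOME e. L2_basis M e)"
  have e: "L2_basis M e" unfolding e_def using assms by (rule someI_ex)
  have eL: "e n \<in> L2_space M" for n by (rule L2_orthonormal_space[OF L2_basis_orthonormal[OF e]])
  define x where "x m i = L2_inner M (v m) (g i)" for m i
  define S where "S m j = (\<Sum>i<l. T i j * x m i)" for m j
  \<comment> \<open>The error for input \<open>e\<close> has component \<sigma>_m <q_m, e> along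
    \<open>u m\<close>, so summing over an orthonormal basis leaves the squared norms of the
    \<open>q m\<close>. These vanish for m < k; for other \<open>m\<close>, Cauchy-Schwarz bounds
    them by 1 plus the squared row norm times \<open>R\<close>.\<close>
  define q where "q m = (\<lambda>y. v m y - (\<Sum>j<k. S m j * v j y))" for m
  define R where "R = (\<Sum>i<l. \<Sum>j<k. (T i j)\<^sup>2)"
  define res where "res n = L2_norm N (range_residual N A l (\<lambda>i. A (g i)) (e n))" for n
  have qL: "q m \<in> L2_space M" for m
    unfolding q_def by (intro L2_space_diff L2_space_sum L2_space_scale v_L2)
  have R0: "0 \<le> R" by (simp add: R_def sum_nonneg)
  have res: "ennreal ((res n)\<^sup>2) \<le> (\<Sum>m. ennreal ((\<sigma> m)\<^sup>2 * (L2_inner M (q m) (e n))\<^sup>2))" for n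
  proof -
    define a where "a i = (\<Sum>j<k. L2_inner M (v j) (e n) * T i j)" for i
    have "res n \<le> L2_norm N (\<lambda>y. A (e n) y - (\<Sum>i<l. a i * A (g i) y))"
      unfolding res_def range_residual_def
      by (rule orth_proj_minimal) (auto intro!: A_L2 g eL simp: col_span_def)
    then have "(res n)\<^sup>2 \<le> (L2_norm N (\<lambda>y. A (e n) y - (\<Sum>i<l. a i * A (g i) y)))\<^sup>2"
      by (intro power_mono) (auto simp: res_def)
    then have le: "ennreal ((res n)\<^sup>2) \<le> ennreal ((L2_norm N (\<lambda>y. A (e n) y - (\<Sum>i<l. a i * A (g i) y)))\<^sup>2)"
      by (rule ennreal_leI)
    have eq: "ennreal ((L2_norm N (\<lambda>y. A (e n) y - (\<Sum>i<l. a i * A (g i) y)))\<^sup>2)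
        = (\<Sum>m. ennreal ((\<sigma> m)\<^sup>2 * (L2_inner M (v m) (\<lambda>x. e n x - (\<Sum>i<l. a i * g i x)))\<^sup>2))"
      by (rule suminf_ennreal_eq[symmetric, OF _ svd_lincomb_norm[OF eL g]]) auto
    have "L2_inner M (v m) (\<lambda>x. e n x - (\<Sum>i<l. a i * g i x)) = L2_inner M (q m) (e n)" for m
    proof -
      have "L2_inner M (v m) (\<lambda>x. e n x - (\<Sum>i<l. a i * g i x)) = L2_inner M (v m) (e n) - (\<Sum>i<l. a i * x m i)"
        unfolding x_def by (rule L2_inner_residual_right[OF eL v_L2]) (use g in auto)
      moreover have "(\<Sum>i<l. a i * x m i) = (\<Sum>j<k. S m j * L2_inner M (v j) (e n))"
        unfolding a_def S_def sum_distrib_right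
        by (subst sum.swap) (intro sum.cong refl, simp)
      ultimately show ?thesis
        unfolding q_def
        by (simp add: L2_inner_diff_left L2_inner_lincomb_left eL v_L2 L2_space_sum L2_space_scale)
    qed
    then show ?thesis using le unfolding eq by (simp only:)
  qed
  define b where "b m = (if m < k then 0 else (\<sigma> m)\<^sup>2 * (1 + (\<Sum>i<l. (x m i)\<^sup>2) * R))" for m
  have b0: "0 \<le> b m" for m using R0 by (simp add: b_def sum_nonneg)
  have qb: "(\<sigma> m)\<^sup>2 * L2_inner M (q m) (q m) \<le> b m" for m
  proof (cases "m < k")
    case True
    have "S m j = (if m = j then 1 else 0)" if "j < k" for j
      using T[OF True that] by (simp add: S_def x_def mult.commute)
    then have "(\<Sum>j<k. S m j * v j y) = (\<Sum>j<k. v j y * (if m = j then 1 else 0))" for y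
      by (intro sum.cong) auto
    then have "(\<Sum>j<k. S m j * v j y) = v m y" for y
      using True by (subst sum_mult_delta[symmetric, of "{..<k}" m "\<lambda>j. v j y"]) auto
    then have "q m = (\<lambda>y. 0)" by (simp add: q_def)
    then show ?thesis using True by (simp add: b_def L2_inner_def)
  next
    case False
    have ortho: "L2_inner M (v m) (v j) = 0" if "j < k" for j
      using that False by (simp add: L2_orthonormal_inner[OF v_orthonormal])
    have "L2_inner M (q m) (q m) = L2_inner M (v m) (v m)
        + 2 * (-1) * L2_inner M (v m) (\<lambda>y. \<Sum>j<k. S m j * v j y)
        + (-1)\<^sup>2 * L2_inner M (\<lambda>y. \<Sum>j<k. S m j * v j y) (\<lambda>y. \<Sum>j<k. S m j * v j y)"
      unfolding q_def
      using L2_inner_add_scaled_self[of "v m" M "\<lambda>y. \<Sum>j<k. S m j * v j y" "-1"] v_L2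
      by (simp add: L2_space_sum L2_space_scale)
    also have "\<dots> = 1 + (\<Sum>j<k. (S m j)\<^sup>2)"
      using ortho by (simp add: L2_inner_lincomb_right v_L2 L2_orthonormal_lincomb_sq[OF v_orthonormal]
          L2_orthonormal_inner[OF v_orthonormal])
    also have "(\<Sum>j<k. (S m j)\<^sup>2) \<le> (\<Sum>j<k. (\<Sum>i<l. (T i j)\<^sup>2) * (\<Sum>i<l. (x m i)\<^sup>2))"
      unfolding S_def by (intro sum_mono Cauchy_Schwarz_ineq_sum)
    also have "\<dots> = (\<Sum>i<l. (x m i)\<^sup>2) * R"
      unfolding R_def sum_distrib_right[symmetric] by (subst sum.swap) (simp add: mult.commute)
    finally show ?thesis using False by (simp add: b_def mult_left_mono)
  qed
  have s1: "summable (\<lambda>m. (\<sigma> (m + k))\<^sup>2)"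
    using sigma_summable by (subst summable_iff_shift)
  have s2: "summable (\<lambda>m. (\<sigma> (m + k))\<^sup>2 * (\<Sum>i<l. (x (m + k) i)\<^sup>2))"
    using tail_functional_summable[OF g] by (simp add: x_def)
  have bk: "b (m + k) = (\<sigma> (m + k))\<^sup>2 + (\<sigma> (m + k))\<^sup>2 * (\<Sum>i<l. (x (m + k) i)\<^sup>2) * R" for m
    by (simp add: b_def algebra_simps)
  have s3: "summable (\<lambda>m. b (m + k))" unfolding bk by (intro summable_add summable_mult2 s1 s2)
  then have sb: "summable b" by (subst (asm) summable_iff_shift)
  have "suminf b = (\<Sum>m. b (m + k)) + (\<Sum>m<k. b m)" by (rule suminf_split_initial_segment[OF sb])
  also have "(\<Sum>m<k. b m) = 0" by (simp add: b_def)
  also have "(\<Sum>m. b (m + k)) = (\<Sum>m. (\<sigma> (m + k))\<^sup>2) + (\<Sum>m. (\<sigma> (m + k))\<^sup>2 * (\<Sum>i<l. (x (m + k) i)\<^sup>2)) * R"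
    unfolding bk suminf_mult2[OF s2] by (rule suminf_add[symmetric, OF s1 summable_mult2[OF s2]])
  finally have B: "suminf b = (\<Sum>m. (\<sigma> (m + k))\<^sup>2) + (\<Sum>m. (\<sigma> (m + k))\<^sup>2 * (\<Sum>i<l. (x (m + k) i)\<^sup>2)) * R"
    by simp
  have "(\<Sum>n. ennreal ((res n)\<^sup>2)) \<le> (\<Sum>n. \<Sum>m. ennreal ((\<sigma> m)\<^sup>2 * (L2_inner M (q m) (e n))\<^sup>2))"
    using res by (intro suminf_le) auto
  also have "\<dots> = (\<Sum>m. ennreal ((\<sigma> m)\<^sup>2 * L2_inner M (q m) (q m)))"
    by (rule suminf_basis_inner[OF e qL])
  also have "\<dots> \<le> (\<Sum>m. ennreal (b m))"
    using qb by (intro suminf_le) (auto intro: ennreal_leI)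
  also have "\<dots> = ennreal (suminf b)" by (rule suminf_ennreal2[OF b0 sb])
  finally have le: "(\<Sum>n. ennreal ((res n)\<^sup>2)) \<le> ennreal (suminf b)" .
  have sr: "summable (\<lambda>n. (res n)\<^sup>2)"
    unfolding res_def by (rule residual_summable[OF e g])
  then have "(\<Sum>n. (res n)\<^sup>2) \<le> suminf b"
    using le suminf_nonneg[OF sb b0] by (simp add: suminf_ennreal2)
  then show ?thesis
    unfolding residual_norm_def hs_norm_def Let_def e_def[symmetric] res_def[symmetric] B x_def R_def
    by (rule real_sqrt_le_mono)
qed

end

end

subsection \<open>Whitening the Gaussian test matrix\<close>

text \<open>The increasing enumeration of all indices except \<open>j\<close>. It presents the other
  rows as a family indexed by an initial segment, the form that \<open>span_dist_sq\<close>
  takes.\<close>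

definition skip :: "nat \<Rightarrow> nat \<Rightarrow> nat" where
  "skip j n = (if n < j then n else Suc n)"

lemma skip_image:
  assumes "j < k"
  shows "{..<k} = insert j (skip j ` {..<k - 1})" "j \<notin> skip j ` {..<k - 1}" "inj_on (skip j) {..<k - 1}"
proof -
  show "{..<k} = insert j (skip j ` {..<k - 1})"
  proof (intro equalityI subsetI)
    fix m assume m: "m \<in> {..<k}"
    show "m \<in> insert j (skip j ` {..<k - 1})"
    proof (cases "m = j")
      case False
      then have "m = skip j (if m < j then m else m - 1)" by (auto simp: skip_def)
      moreover have "(if m < j then m else m - 1) \<in> {..<k - 1}" using m False assms by auto
      ultimately show ?thesis by blast
    qed simp
  qed (use assms in \<open>auto simp: skip_def\<close>)
qed (auto simp: skip_def inj_on_def split: if_splits)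

lemma sum_skip:
  fixes f :: "nat \<Rightarrow> real"
  assumes "j < k"
  shows "(\<Sum>n<k. f n) = f j + (\<Sum>t<k - 1. f (skip j t))"
  unfolding skip_image(1)[OF assms] using skip_image(2,3)[OF assms]
  by (subst sum.insert) (auto simp: sum.reindex)

lemma span_dist_sq_attained_ex:
  "\<exists>a. span_dist_sq l m G g = (\<Sum>i<l. (g i - (\<Sum>j<m. a j * G j i))\<^sup>2) \<and>
    (\<forall>j<m. (\<Sum>i<l. (g i - (\<Sum>j<m. a j * G j i)) * G j i) = 0)"
  by (rule span_dist_sq_attained[of l m G g]) blast

text \<open>The residual of row \<open>j\<close> is orthogonal to all other rows, and its inner
  product with row \<open>j\<close> is its own squared norm \<open>d j\<close>. Divided by
  \<open>d j\<close> it is column \<open>j\<close> of the right inverse, of squared norm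
  \<open>1 / d j\<close>.\<close>

lemma right_inverse_exists:
  fixes x :: "nat \<Rightarrow> nat \<Rightarrow> real" and k l :: nat
  defines "d \<equiv> \<lambda>j. span_dist_sq l (k - 1) (\<lambda>t. x (skip j t)) (x j)"
  assumes d: "\<And>j. j < k \<Longrightarrow> 0 < d j"
  shows "\<exists>T. (\<forall>m<k. \<forall>j<k. (\<Sum>i<l. x m i * T i j) = (if m = j then 1 else 0)) \<and>
    (\<Sum>i<l. \<Sum>j<k. (T i j)\<^sup>2) = (\<Sum>j<k. 1 / d j)"
proof -
  define Q where "Q j r \<longleftrightarrow> (\<Sum>i<l. (r i)\<^sup>2) = d j \<and> (\<Sum>i<l. x j i * r i) = d j \<and>
      (\<forall>m<k. m \<noteq> j \<longrightarrow> (\<Sum>i<l. x m i * r i) = 0)" for j r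
  have "\<exists>r. Q j r" if j: "j < k" for j
  proof -
    from span_dist_sq_attained_ex[of l "k - 1" "\<lambda>t. x (skip j t)" "x j"] obtain a
      where a': "span_dist_sq l (k - 1) (\<lambda>t. x (skip j t)) (x j) = (\<Sum>i<l. (x j i - (\<Sum>t<k - 1. a t * x (skip j t) i))\<^sup>2)"
      and orth: "\<forall>t<k - 1. (\<Sum>i<l. (x j i - (\<Sum>t<k - 1. a t * x (skip j t) i)) * x (skip j t) i) = 0"
      by (elim exE conjE)
    have a: "d j = (\<Sum>i<l. (x j i - (\<Sum>t<k - 1. a t * x (skip j t) i))\<^sup>2)" using a' by (simp add: d_def)
    define r where "r i = x j i - (\<Sum>t<k - 1. a t * x (skip j t) i)" for i
    have o: "(\<Sum>i<l. x (skip j t) i * r i) = 0" if "t < k - 1" for t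
      using orth[rule_format, OF that] by (simp add: r_def mult.commute)
    have "(\<Sum>i<l. x m i * r i) = 0" if "m < k" "m \<noteq> j" for m
    proof -
      have "m \<in> insert j (skip j ` {..<k - 1})" using that skip_image(1)[OF j] by blast
      then show ?thesis using o that by auto
    qed
    moreover have "(\<Sum>i<l. x j i * r i) = d j"
    proof -
      have "x j i * r i = (r i)\<^sup>2 + (\<Sum>t<k - 1. a t * (x (skip j t) i * r i))" for i
      proof -
        have xj: "x j i = r i + (\<Sum>t<k - 1. a t * x (skip j t) i)" by (simp add: r_def)
        show ?thesis
          unfolding xj by (simp add: power2_eq_square distrib_right sum_distrib_right mult.assoc)
      qed
      then have "(\<Sum>i<l. x j i * r i) = (\<Sum>i<l. (r i)\<^sup>2) + (\<Sum>i<l. \<Sum>t<k - 1. a t * (x (skip j t) i * r i))"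
        by (simp add: sum.distrib)
      also have "(\<Sum>i<l. \<Sum>t<k - 1. a t * (x (skip j t) i * r i)) = (\<Sum>t<k - 1. a t * (\<Sum>i<l. x (skip j t) i * r i))"
        by (subst sum.swap) (simp add: sum_distrib_left)
      also have "\<dots> = 0" using o by simp
      finally show ?thesis using a by (simp add: r_def)
    qed
    moreover have "(\<Sum>i<l. (r i)\<^sup>2) = d j" by (simp only: a r_def)
    ultimately show ?thesis unfolding Q_def by (intro exI[of _ r]) simp
  qed
  then obtain r where "\<And>j. j < k \<Longrightarrow> Q j (r j)" by metis
  then have r: "\<And>j. j < k \<Longrightarrow> (\<Sum>i<l. (r j i)\<^sup>2) = d j"
    "\<And>j. j < k \<Longrightarrow> (\<Sum>i<l. x j i * r j i) = d j"
    "\<And>j m. j < k \<Longrightarrow> m < k \<Longrightarrow> m \<noteq> j \<Longrightarrow> (\<Sum>i<l. x m i * r j i) = 0"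
    unfolding Q_def by auto
  define T where "T i j = r j i / d j" for i j
  have "(\<Sum>i<l. x m i * T i j) = (if m = j then 1 else 0)" if "m < k" "j < k" for m j
  proof -
    have "(\<Sum>i<l. x m i * T i j) = (\<Sum>i<l. x m i * r j i) / d j"
      by (simp add: T_def sum_divide_distrib)
    then show ?thesis using that r d[OF that(2)] by auto
  qed
  moreover have "(\<Sum>i<l. \<Sum>j<k. (T i j)\<^sup>2) = (\<Sum>j<k. 1 / d j)"
  proof -
    have "(\<Sum>i<l. (T i j)\<^sup>2) = 1 / d j" if "j < k" for j
    proof -
      have "(\<Sum>i<l. (T i j)\<^sup>2) = (\<Sum>i<l. (r j i)\<^sup>2) / (d j)\<^sup>2"
        by (simp add: T_def power_divide sum_divide_distrib)
      then show ?thesis using r(1)[OF that] d[OF that] by (simp add: power2_eq_square)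
    qed
    then show ?thesis by (subst sum.swap) simp
  qed
  ultimately show ?thesis by blast
qed

section \<open>Gram-Schmidt for a bilinear form on coefficient vectors\<close>

context
  fixes B :: "(nat \<Rightarrow> real) \<Rightarrow> (nat \<Rightarrow> real) \<Rightarrow> real" and k :: nat
  assumes lin: "\<And>a b c z. B (\<lambda>i. a i + c * b i) z = B a z + c * B b z"
    and sym: "\<And>a b. B a b = B b a"
    and pos: "\<And>a. \<exists>i<k. a i \<noteq> 0 \<Longrightarrow> 0 < B a a"
begin

lemma form_zero: "B (\<lambda>i. 0) z = 0"
  using lin[of "\<lambda>i. 0" "-1" "\<lambda>i. 0" z] by simp

lemma form_lincomb: "B (\<lambda>i. \<Sum>q<m. c q * \<alpha> q i) z = (\<Sum>q<(m::nat). c q * B (\<alpha> q) z)"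
  by (induction m) (simp_all add: form_zero lin)

lemma form_scale: "B (\<lambda>i. c * a i) z = c * B a z"
  using lin[of "\<lambda>i. 0" c a z] by (simp add: form_zero)

text \<open>Dependent inputs are skipped, so \<open>m\<close> may be smaller than \<open>n\<close>.
  Membership in \<open>col_span n y\<close> is recorded so that a coordinate at which all inputs
  vanish also vanishes for the output.\<close>

lemma gram_schmidt_coeffs:
  fixes y :: "nat \<Rightarrow> nat \<Rightarrow> real"
  shows "\<exists>m\<le>n. \<exists>\<alpha>. (\<forall>p<m. \<forall>q<m. B (\<alpha> p) (\<alpha> q) = (if p = q then 1 else 0)) \<and>
    (\<forall>t<n. \<exists>\<beta>. \<forall>i<k. y t i = (\<Sum>q<m. \<beta> q * \<alpha> q i)) \<and> (\<forall>q<m. \<alpha> q \<in> col_span n y)"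
proof (induction n)
  case (Suc n)
  then obtain m \<alpha> where m: "m \<le> n"
    and on0: "\<forall>p<m. \<forall>q<m. B (\<alpha> p) (\<alpha> q) = (if p = q then 1 else 0)"
    and span: "\<forall>t<n. \<exists>\<beta>. \<forall>i<k. y t i = (\<Sum>q<m. \<beta> q * \<alpha> q i)"
    and in_span: "\<forall>q<m. \<alpha> q \<in> col_span n y"
    by (elim exE conjE)
  note on = on0[rule_format]
  have mono: "h \<in> col_span (Suc n) y" if "h \<in> col_span n y" for h
    using col_span_Suc_add[OF that, of 0] by simp
  define r where "r i = y n i - (\<Sum>q<m. B (y n) (\<alpha> q) * \<alpha> q i)" for i
  show ?case
  \<comment> \<open>Positivity of \<open>B\<close> is available only for coefficients that are
    nonzero at an index below \<open>k\<close>, so the residual is tested there.\<close>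
  proof (cases "\<exists>i<k. r i \<noteq> 0")
    case False
    then have "\<forall>i<k. y n i = (\<Sum>q<m. B (y n) (\<alpha> q) * \<alpha> q i)" by (auto simp: r_def)
    then have yn: "\<exists>\<beta>. \<forall>i<k. y n i = (\<Sum>q<m. \<beta> q * \<alpha> q i)"
      by (rule exI[of _ "\<lambda>q. B (y n) (\<alpha> q)"])
    have "\<forall>t<Suc n. \<exists>\<beta>. \<forall>i<k. y t i = (\<Sum>q<m. \<beta> q * \<alpha> q i)"
    proof (intro allI impI)
      fix t assume "t < Suc n"
      then consider "t < n" | "t = n" by linarith
      then show "\<exists>\<beta>. \<forall>i<k. y t i = (\<Sum>q<m. \<beta> q * \<alpha> q i)"
        by cases (use yn span in simp_all)
    qed
    moreover have "m \<le> Suc n" "\<forall>q<m. \<alpha> q \<in> col_span (Suc n) y" using m in_span mono by simp_all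
    ultimately show ?thesis
      using on0 by (intro exI[of _ m] exI[of _ \<alpha>] conjI)
  next
    case True
    then have rr: "0 < B r r" by (rule pos)
    define s where "s = sqrt (B r r)"
    have s: "0 < s" "s * s = B r r" using rr by (auto simp: s_def)
    define \<alpha>' where "\<alpha>' = \<alpha>(m := (\<lambda>i. (1 / s) * r i))"
    have old: "\<alpha>' q = \<alpha> q" if "q < m" for q using that by (simp add: \<alpha>'_def)
    have new: "\<alpha>' m = (\<lambda>i. (1 / s) * r i)" by (simp add: \<alpha>'_def)
    have r_eq: "r = (\<lambda>i. y n i + (-1) * (\<Sum>q<m. B (y n) (\<alpha> q) * \<alpha> q i))"
      by (simp add: r_def fun_eq_iff)
    have r_orth: "B r (\<alpha> p) = 0" if "p < m" for p
    proof -
      have "B r (\<alpha> p) = B (y n) (\<alpha> p) - (\<Sum>q<m. B (y n) (\<alpha> q) * B (\<alpha> q) (\<alpha> p))"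
        unfolding r_eq lin form_lincomb by simp
      also have "(\<Sum>q<m. B (y n) (\<alpha> q) * B (\<alpha> q) (\<alpha> p)) = (\<Sum>q<m. B (y n) (\<alpha> q) * (if p = q then 1 else 0))"
        using on that by (intro sum.cong refl) auto
      also have "\<dots> = B (y n) (\<alpha> p)" using that by (subst sum_mult_delta) auto
      finally show ?thesis by simp
    qed
    have on': "B (\<alpha>' p) (\<alpha>' q) = (if p = q then 1 else 0)" if "p < Suc m" "q < Suc m" for p q
    proof -
      consider "p < m" "q < m" | "p = m" "q < m" | "p < m" "q = m" | "p = m" "q = m"
        using \<open>p < Suc m\<close> \<open>q < Suc m\<close> by linarith
      then show ?thesis
      proof cases
        case 1 then show ?thesis using on old by simp
      next
        case 2
        have "B (\<alpha>' m) (\<alpha> q) = 0" unfolding new form_scale r_orth[OF 2(2)] by simp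
        with 2 show ?thesis using old by simp
      next
        case 3
        have "B (\<alpha>' m) (\<alpha> p) = 0" unfolding new form_scale r_orth[OF 3(1)] by simp
        with 3 show ?thesis using old sym[of "\<alpha> p" "\<alpha>' m"] by simp
      next
        case 4
        have "B (\<alpha>' m) (\<alpha>' m) = (1 / s) * B r (\<alpha>' m)" unfolding new by (rule form_scale)
        also have "B r (\<alpha>' m) = B (\<alpha>' m) r" by (rule sym)
        also have "\<dots> = (1 / s) * B r r" unfolding new by (rule form_scale)
        finally have "B (\<alpha>' m) (\<alpha>' m) = (1 / s) * ((1 / s) * B r r)" .
        with 4 show ?thesis using s(1) by (simp add: s(2)[symmetric])
      qed
    qed
    have span': "\<exists>\<beta>. \<forall>i<k. y t i = (\<Sum>q<Suc m. \<beta> q * \<alpha>' q i)" if t: "t < Suc n" for t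
    proof (cases "t < n")
      case True
      then obtain \<beta> where "\<forall>i<k. y t i = (\<Sum>q<m. \<beta> q * \<alpha> q i)" using span by blast
      then show ?thesis using old by (intro exI[of _ "\<beta>(m := 0)"]) simp
    next
      case False
      then have "t = n" using t by simp
      moreover have "y n i = (\<Sum>q<m. B (y n) (\<alpha> q) * \<alpha> q i) + s * ((1 / s) * r i)" for i
        using s by (simp add: r_def)
      ultimately show ?thesis
        using old by (intro exI[of _ "(\<lambda>q. B (y n) (\<alpha> q))(m := s)"]) (simp add: new)
    qed
    have in_span': "\<alpha>' q \<in> col_span (Suc n) y" if "q < Suc m" for q
    proof (cases "q < m")
      case True
      then show ?thesis using old in_span mono by simp
    next
      case False
      then have q: "q = m" using that by simp
      have sum_in: "(\<lambda>i. \<Sum>q<p. B (y n) (\<alpha> q) * \<alpha> q i) \<in> col_span n y" if "p \<le> m" for p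
        using that
      proof (induction p)
        case 0
        show ?case unfolding col_span_def by (intro CollectI exI[of _ "\<lambda>_. 0"]) simp
      next
        case (Suc p)
        then show ?case using in_span col_span_add_scaled[of _ n y "\<alpha> p"] by simp
      qed
      obtain c where c: "(\<lambda>i. \<Sum>q<m. B (y n) (\<alpha> q) * \<alpha> q i) = (\<lambda>i. \<Sum>t<n. c t * y t i)"
        using sum_in[OF order_refl] unfolding col_span_def by (elim CollectE exE)
      have "(1 / s) * r i = (\<Sum>t<Suc n. ((\<lambda>t. - c t / s)(n := 1 / s)) t * y t i)" for i
        using fun_cong[OF c, of i] by (simp add: r_def algebra_simps sum_negf sum_divide_distrib diff_divide_distrib)
      then show ?thesis
        unfolding q new col_span_def by (intro CollectI exI[of _ "(\<lambda>t. - c t / s)(n := 1 / s)"] ext)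
    qed
    have "Suc m \<le> Suc n" using m by simp
    then show ?thesis
      by (intro exI[of _ "Suc m"] exI[of _ \<alpha>'] conjI allI impI on' span' in_span')
  qed
qed (intro exI[of _ 0], simp)

end

text \<open>The last vector is the normalized column \<open>j\<close> of the inverse
  \<open>W\<close>. Pairing with that column reads off coordinate \<open>j\<close>, so it is
  orthogonal under \<open>B\<close> to the span of all other unit vectors, where the remaining
  \<open>\<alpha> q\<close> live. Its own coordinate \<open>j\<close> is W_jj / sqrt(W_jj). In
  probabilistic terms 1 / W_jj is the conditional variance of entry \<open>j\<close> given the
  others.\<close>

lemma whitening_exists:
  fixes C :: "nat \<Rightarrow> nat \<Rightarrow> real" and k :: nat
  defines "B \<equiv> \<lambda>a b. \<Sum>i<k. \<Sum>j<k. a i * C i j * b j"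
    and "W \<equiv> the (mat_inverse (mat k k (\<lambda>(i, j). C i j)))"
  assumes symC: "\<And>i j. i < k \<Longrightarrow> j < k \<Longrightarrow> C i j = C j i"
    and pos: "\<And>a. \<exists>i<k. a i \<noteq> 0 \<Longrightarrow> 0 < B a a"
    and j: "j < k"
  shows "dim_row W = k" "0 < W $$ (j, j)"
    "\<exists>m\<le>k - 1. \<exists>\<alpha>. (\<forall>p\<le>m. \<forall>q\<le>m. B (\<alpha> p) (\<alpha> q) = (if p = q then 1 else 0)) \<and>
      \<alpha> m j = sqrt (W $$ (j, j)) \<and>
      (\<forall>t<k - 1. \<exists>\<beta>. \<forall>i<k. (if i = skip j t then 1 else 0) = (\<Sum>q<m. \<beta> q * \<alpha> q i))"
proof -
  have lin: "B (\<lambda>i. a i + c * b i) z = B a z + c * B b z" for a b c z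
    unfolding B_def by (simp add: algebra_simps sum.distrib sum_distrib_left)
  have sym: "B a b = B b a" for a b
    unfolding B_def by (subst sum.swap) (intro sum.cong refl, simp add: symC)
  define CM where "CM = mat k k (\<lambda>(i, j). C i j)"
  have CM: "CM \<in> carrier_mat k k" by (simp add: CM_def)
  have "det CM \<noteq> 0"
  proof
    assume "det CM = 0"
    then obtain z where z: "z \<in> carrier_vec k" "z \<noteq> 0\<^sub>v k" "CM *\<^sub>v z = 0\<^sub>v k"
      using det_0_iff_vec_prod_zero_field[OF CM] by auto
    have "\<exists>i<k. z $ i \<noteq> 0" using z by (metis carrier_vecD eq_vecI index_zero_vec)
    then have "0 < B (\<lambda>i. z $ i) (\<lambda>i. z $ i)" by (rule pos)
    moreover have "(\<Sum>n<k. C i n * z $ n) = 0" if "i < k" for i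
    proof -
      have "(CM *\<^sub>v z) $ i = 0" using z that by simp
      then show ?thesis using that z by (simp add: CM_def scalar_prod_def atLeast0LessThan)
    qed
    then have "B (\<lambda>i. z $ i) (\<lambda>i. z $ i) = 0"
      unfolding B_def by (simp add: mult.assoc flip: sum_distrib_left)
    ultimately show False by simp
  qed
  then have "CM \<in> Units (ring_mat TYPE(real) k ())" by (rule det_non_zero_imp_unit[OF CM])
  then obtain W' where W': "mat_inverse CM = Some W'"
    using mat_inverse(1)[OF CM, of "()"] by (cases "mat_inverse CM") auto
  then have WW: "W = W'" by (simp add: W_def CM_def)
  have inv: "CM * W = 1\<^sub>m k" "W \<in> carrier_mat k k" using mat_inverse(2)[OF CM W'] WW by auto
  then show dim: "dim_row W = k" by auto
  have CW: "(\<Sum>n<k. C i n * W $$ (n, j)) = (if i = j then 1 else 0)" if "i < k" for i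
  proof -
    have "(CM * W) $$ (i, j) = (if i = j then 1 else 0)" using inv(1) that j by simp
    then show ?thesis
      using that j CM inv(2) by (simp add: CM_def scalar_prod_def atLeast0LessThan)
  qed
  \<comment> \<open>The defining equation of column \<open>j\<close> of the inverse, read through
    the form; taking the column itself for \<open>a\<close> shows that its \<open>B\<close>-square
    is its diagonal entry.\<close>
  have Bcol: "B a (\<lambda>i. W $$ (i, j)) = a j" for a
  proof -
    have "B a (\<lambda>i. W $$ (i, j)) = (\<Sum>i<k. a i * (\<Sum>n<k. C i n * W $$ (n, j)))"
      unfolding B_def by (simp add: sum_distrib_left mult.assoc)
    also have "\<dots> = (\<Sum>i<k. a i * (if j = i then 1 else 0))" using CW by (intro sum.cong) auto
    also have "\<dots> = a j" using j by (subst sum_mult_delta) auto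
    finally show ?thesis .
  qed
  have "\<exists>i<k. W $$ (i, j) \<noteq> 0"
  proof (rule ccontr)
    assume "\<not> ?thesis"
    then have "(\<Sum>n<k. C j n * W $$ (n, j)) = 0" by simp
    then show False using CW[OF j] by simp
  qed
  then have "0 < B (\<lambda>i. W $$ (i, j)) (\<lambda>i. W $$ (i, j))" by (rule pos)
  then show Wj: "0 < W $$ (j, j)" by (simp add: Bcol)
  define y where "y t i = (if i = skip j t then 1 else (0::real))" for t i
  have "\<exists>m\<le>k - 1. \<exists>\<alpha>. (\<forall>p<m. \<forall>q<m. B (\<alpha> p) (\<alpha> q) = (if p = q then 1 else 0)) \<and>
    (\<forall>t<k - 1. \<exists>\<beta>. \<forall>i<k. y t i = (\<Sum>q<m. \<beta> q * \<alpha> q i)) \<and> (\<forall>q<m. \<alpha> q \<in> col_span (k - 1) y)"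
    by (rule gram_schmidt_coeffs[where B = B and k = k and n = "k - 1" and y = y]) (fact lin, fact sym, erule pos)
  then obtain m \<alpha> where m: "m \<le> k - 1"
    and on: "\<forall>p<m. \<forall>q<m. B (\<alpha> p) (\<alpha> q) = (if p = q then 1 else 0)"
    and span: "\<forall>t<k - 1. \<exists>\<beta>. \<forall>i<k. y t i = (\<Sum>q<m. \<beta> q * \<alpha> q i)"
    and in_span: "\<forall>q<m. \<alpha> q \<in> col_span (k - 1) y"
    by (elim exE conjE)
  define s where "s = sqrt (W $$ (j, j))"
  have s: "0 < s" "s * s = W $$ (j, j)" using Wj by (auto simp: s_def)
  define \<alpha>' where "\<alpha>' = \<alpha>(m := (\<lambda>i. (1 / s) * W $$ (i, j)))"
  have old: "\<alpha>' q = \<alpha> q" if "q < m" for q using that by (simp add: \<alpha>'_def)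
  have new: "\<alpha>' m = (\<lambda>i. (1 / s) * W $$ (i, j))" by (simp add: \<alpha>'_def)
  have Bnew: "B (\<alpha>' m) a = a j / s" "B a (\<alpha>' m) = a j / s" for a
  proof -
    have "B (\<lambda>i. 0 + (1 / s) * W $$ (i, j)) a = B (\<lambda>i. 0) a + (1 / s) * B (\<lambda>i. W $$ (i, j)) a" by (rule lin)
    moreover have "B (\<lambda>i. 0) a = 0" by (simp add: B_def)
    ultimately show "B (\<alpha>' m) a = a j / s" unfolding new by (simp add: sym[of _ a] Bcol)
    then show "B a (\<alpha>' m) = a j / s" by (simp add: sym)
  qed
  have zero: "\<alpha> q j = 0" if "q < m" for q
  proof -
    have "\<alpha> q \<in> col_span (k - 1) y" using in_span that by simp
    then obtain c where "\<alpha> q = (\<lambda>i. \<Sum>t<k - 1. c t * y t i)"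
      unfolding col_span_def by (elim CollectE exE)
    moreover have "y t j = 0" for t by (auto simp: y_def skip_def)
    ultimately show ?thesis by simp
  qed
  have aj: "\<alpha>' m j = s" using s(1) by (simp add: new s(2)[symmetric])
  have on': "B (\<alpha>' p) (\<alpha>' q) = (if p = q then 1 else 0)" if "p \<le> m" "q \<le> m" for p q
  proof -
    consider "p < m" "q < m" | "p = m" "q < m" | "p < m" "q = m" | "p = m" "q = m"
      using \<open>p \<le> m\<close> \<open>q \<le> m\<close> by linarith
    then show ?thesis
    proof cases
      case 1 then show ?thesis using on old by simp
    next
      case 2 then show ?thesis using old zero by (simp add: Bnew)
    next
      case 3 then show ?thesis using old zero by (simp add: Bnew)
    next
      case 4 then show ?thesis using aj s by (simp add: Bnew)
    qed
  qed
  have on'': "\<forall>p\<le>m. \<forall>q\<le>m. B (\<alpha>' p) (\<alpha>' q) = (if p = q then 1 else 0)"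
    by (intro allI impI on')
  have span': "\<forall>t<k - 1. \<exists>\<beta>. \<forall>i<k. (if i = skip j t then 1 else 0) = (\<Sum>q<m. \<beta> q * \<alpha>' q i)"
    using span old unfolding y_def by simp
  show "\<exists>m\<le>k - 1. \<exists>\<alpha>. (\<forall>p\<le>m. \<forall>q\<le>m. B (\<alpha> p) (\<alpha> q) = (if p = q then 1 else 0)) \<and>
      \<alpha> m j = sqrt (W $$ (j, j)) \<and>
      (\<forall>t<k - 1. \<exists>\<beta>. \<forall>i<k. (if i = skip j t then 1 else 0) = (\<Sum>q<m. \<beta> q * \<alpha> q i))"
    using m on'' aj[unfolded s_def] span' by (intro exI[of _ m] exI[of _ \<alpha>'] conjI)
qed

text \<open>The whitened vector \<open>m\<close> is \<open>\<alpha> m j\<close> times row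
  \<open>j\<close> plus a combination of the other rows, and those rows lie in the span of the
  whitened vectors before \<open>m\<close>. Hence \<open>\<alpha> m j\<close> times the optimal
  residual of row \<open>j\<close> is an admissible residual.\<close>

lemma whitened_span_dist_le:
  fixes x \<alpha> :: "nat \<Rightarrow> nat \<Rightarrow> real" and k :: nat
  defines "Y \<equiv> \<lambda>i q. \<Sum>n<k. \<alpha> q n * x n i"
  assumes j: "j < k"
    and span: "\<forall>t<k - 1. \<exists>\<beta>. \<forall>i<k. (if i = skip j t then 1 else 0) = (\<Sum>q<m. \<beta> q * \<alpha> q i)"
  shows "span_dist_sq l m (\<lambda>q i. Y i q) (\<lambda>i. Y i m)
    \<le> (\<alpha> m j)\<^sup>2 * span_dist_sq l (k - 1) (\<lambda>t. x (skip j t)) (x j)"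
proof -
  define c where "c = \<alpha> m j"
  obtain a where a: "span_dist_sq l (k - 1) (\<lambda>t. x (skip j t)) (x j)
      = (\<Sum>i<l. (x j i - (\<Sum>t<k - 1. a t * x (skip j t) i))\<^sup>2)"
    by (rule span_dist_sq_attained)
  define R where "R t \<beta> \<longleftrightarrow> (\<forall>i<k. (if i = skip j t then 1 else 0) = (\<Sum>q<m. \<beta> q * \<alpha> q i))" for t \<beta>
  have "\<forall>t<k - 1. \<exists>\<beta>. R t \<beta>" using span by (simp add: R_def)
  then obtain \<beta> where "\<And>t. t < k - 1 \<Longrightarrow> R t (\<beta> t)" by metis
  note \<beta> = this[unfolded R_def, rule_format]
  have xs: "x (skip j t) i = (\<Sum>q<m. \<beta> t q * Y i q)" if t: "t < k - 1" for t i
  proof -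
    have "skip j t < k" using t by (auto simp: skip_def)
    then have "x (skip j t) i = (\<Sum>n<k. x n i * (if skip j t = n then 1 else 0))"
      by (subst sum_mult_delta) auto
    also have "\<dots> = (\<Sum>n<k. x n i * (\<Sum>q<m. \<beta> t q * \<alpha> q n))"
    proof (intro sum.cong refl)
      fix n assume "n \<in> {..<k}"
      then have "(if skip j t = n then 1 else 0) = (\<Sum>q<m. \<beta> t q * \<alpha> q n)"
        using \<beta>[OF t, of n] by (cases "skip j t = n") auto
      then show "x n i * (if skip j t = n then 1 else 0) = x n i * (\<Sum>q<m. \<beta> t q * \<alpha> q n)"
        by (simp only:)
    qed
    also have "\<dots> = (\<Sum>q<m. \<beta> t q * Y i q)"
      unfolding Y_def sum_distrib_left by (subst sum.swap) (intro sum.cong refl, simp)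
    finally show ?thesis .
  qed
  \<comment> \<open>Removes the share of the other rows in the whitened vector together with the
    scaled optimal approximation of row \<open>j\<close>.\<close>
  define h where "h t = \<alpha> m (skip j t) + c * a t" for t
  define b where "b q = (\<Sum>t<k - 1. h t * \<beta> t q)" for q
  have "Y i m - (\<Sum>q<m. b q * Y i q) = c * (x j i - (\<Sum>t<k - 1. a t * x (skip j t) i))" for i
  proof -
    have "(\<Sum>q<m. b q * Y i q) = (\<Sum>t<k - 1. h t * (\<Sum>q<m. \<beta> t q * Y i q))"
      unfolding b_def sum_distrib_left sum_distrib_right by (subst sum.swap) (simp add: mult.assoc)
    also have "\<dots> = (\<Sum>t<k - 1. h t * x (skip j t) i)" using xs by simp
    also have "\<dots> = (\<Sum>t<k - 1. \<alpha> m (skip j t) * x (skip j t) i) + c * (\<Sum>t<k - 1. a t * x (skip j t) i)"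
      by (simp add: h_def distrib_right sum.distrib sum_distrib_left mult.assoc)
    finally show ?thesis
      unfolding Y_def sum_skip[OF j, of "\<lambda>n. \<alpha> m n * x n i"] by (simp add: c_def algebra_simps)
  qed
  then have eq: "(\<Sum>i<l. (Y i m - (\<Sum>q<m. b q * Y i q))\<^sup>2) = c\<^sup>2 * (\<Sum>i<l. (x j i - (\<Sum>t<k - 1. a t * x (skip j t) i))\<^sup>2)"
    by (simp only: power_mult_distrib sum_distrib_left)
  show ?thesis
    unfolding a c_def[symmetric] eq[symmetric] by (rule span_dist_sq_le)
qed

context mercer_process
begin

lemma kernel_form_lincomb:
  assumes f: "\<And>i. i \<in> I \<Longrightarrow> f i \<in> L2_space MD" and g: "\<And>j. j \<in> J \<Longrightarrow> g j \<in> L2_space MD"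
  shows "kernel_form D K (\<lambda>x. \<Sum>i\<in>I. a i * f i x) (\<lambda>x. \<Sum>j\<in>J. b j * g j x)
    = (\<Sum>i\<in>I. \<Sum>j\<in>J. a i * kernel_form D K (f i) (g j) * b j)"
proof -
  let ?f = "\<lambda>x. \<Sum>i\<in>I. a i * f i x" and ?g = "\<lambda>x. \<Sum>j\<in>J. b j * g j x"
  have L: "?f \<in> L2_space MD" "?g \<in> L2_space MD"
    using f g by (auto intro!: L2_space_sum L2_space_scale)
  have "kernel_form D K ?f ?g = L2_inner P (Z ?f) (Z ?g)" by (rule Z_covariance(1)[OF L, symmetric])
  also have "\<dots> = L2_inner P (\<lambda>w. \<Sum>i\<in>I. a i * Z (f i) w) (\<lambda>w. \<Sum>j\<in>J. b j * Z (g j) w)"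
    unfolding L2_inner_def[of P]
    by (intro Bochner_Integration.integral_cong refl) (simp only: Z_lincomb[OF f] Z_lincomb[OF g])
  also have "\<dots> = (\<Sum>i\<in>I. a i * (\<Sum>j\<in>J. b j * L2_inner P (Z (f i)) (Z (g j))))"
    using f g
    by (subst L2_inner_lincomb_left)
      (auto intro!: Z_L2 L2_space_sum L2_space_scale sum.cong L2_inner_lincomb_right simp: L2_inner_lincomb_right)
  also have "\<dots> = (\<Sum>i\<in>I. \<Sum>j\<in>J. a i * kernel_form D K (f i) (g j) * b j)"
    unfolding sum_distrib_left using f g by (intro sum.cong refl) (simp add: Z_covariance)
  finally show ?thesis .
qed

lemma kernel_form_commute:
  "f \<in> L2_space MD \<Longrightarrow> g \<in> L2_space MD \<Longrightarrow> kernel_form D K f g = kernel_form D K g f"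
  by (simp add: Z_covariance(1)[symmetric] L2_inner_commute)

end

lemma kernel_form_scale:
  "kernel_form D K (\<lambda>x. c * f x) (\<lambda>x. d * g x) = c * d * kernel_form D K f g"
  unfolding kernel_form_def
  by (subst integral_mult_right_zero[symmetric], intro Bochner_Integration.integral_cong) auto

section \<open>Markov's inequality and two forms of Jensen's inequality\<close>

lemma (in prob_space) Markov_nn_integral:
  assumes g: "g \<in> borel_measurable M" and S: "S \<in> events" and e: "0 < e" and b: "0 \<le> b"
    and le: "AE w in M. w \<in> S \<longrightarrow> ennreal e \<le> g w"
    and int: "(\<integral>\<^sup>+w. g w \<partial>M) \<le> ennreal b"
  shows "prob S \<le> b / e"
proof -
  have "ennreal (e * prob S) = (\<integral>\<^sup>+w. ennreal e * indicator S w \<partial>M)"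
    using S e by (simp add: nn_integral_cmult_indicator emeasure_eq_measure ennreal_mult')
  also have "\<dots> \<le> (\<integral>\<^sup>+w. g w \<partial>M)"
    using le by (intro nn_integral_mono_AE) (auto simp: indicator_def elim!: eventually_mono)
  finally have "ennreal (e * prob S) \<le> ennreal b" using int by (rule order_trans)
  then have "e * prob S \<le> b" using b by simp
  then show ?thesis using e by (simp add: field_simps)
qed

text \<open>Jensen's inequality for countably many weights: the tangent of exp at the mean lies
  below exp, and summing it against the weights gives the claim. Extended values avoid a summability
  assumption on the right.\<close>

lemma exp_suminf_le:
  fixes q h :: "nat \<Rightarrow> real"
  assumes q: "\<And>m. 0 \<le> q m" "q sums 1" and h: "summable (\<lambda>m. q m * h m)"
  shows "ennreal (exp (\<Sum>m. q m * h m)) \<le> (\<Sum>m. ennreal (q m * exp (h m)))"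
proof (cases "(\<Sum>m. ennreal (q m * exp (h m))) = \<top>")
  case False
  then have s: "summable (\<lambda>m. q m * exp (h m))"
    using q(1) by (intro summable_suminf_not_top) auto
  define a where "a = (\<Sum>m. q m * h m)"
  have "(\<lambda>m. q m * h m) sums a" unfolding a_def by (rule summable_sums[OF h])
  then have "(\<lambda>m. exp a * (q m * (1 - a) + q m * h m)) sums (exp a * (1 * (1 - a) + a))"
    by (intro sums_mult sums_add sums_mult2 q(2))
  moreover have "exp a * (q m * (1 - a) + q m * h m) \<le> q m * exp (h m)" for m
  proof -
    have "exp a * (1 + (h m - a)) \<le> exp a * exp (h m - a)"
      by (intro mult_left_mono exp_ge_add_one_self) auto
    then have "exp a * (1 + (h m - a)) \<le> exp (h m)" by (simp flip: exp_add)
    from mult_left_mono[OF this q(1)[of m]] show ?thesis by (simp add: algebra_simps)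
  qed
  ultimately have "exp a * (1 * (1 - a) + a) \<le> (\<Sum>m. q m * exp (h m))"
    by (intro sums_le[OF _ _ summable_sums[OF s]])
  then have "ennreal (exp a) \<le> ennreal (\<Sum>m. q m * exp (h m))" by (intro ennreal_leI) simp
  also have "\<dots> = (\<Sum>m. ennreal (q m * exp (h m)))"
    using q(1) s by (intro suminf_ennreal2[symmetric]) auto
  finally show ?thesis by (simp add: a_def)
qed simp

text \<open>Jensen's inequality for the power \<open>q\<close> with the \<open>a j\<close>, divided
  by their sum, as weights; the sum is then factored out.\<close>

lemma powr_sum_le:
  fixes a y :: "nat \<Rightarrow> real"
  assumes k: "0 < k" and a: "\<And>j. j < k \<Longrightarrow> 0 < a j" and y: "\<And>j. j < k \<Longrightarrow> 0 < y j" and q: "1 \<le> q"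
  shows "(\<Sum>j<k. a j * y j) powr q \<le> (\<Sum>j<k. a j) powr q * (\<Sum>j<k. a j / (\<Sum>j<k. a j) * y j powr q)"
proof -
  define S where "S = (\<Sum>j<k. a j)"
  have S: "0 < S" unfolding S_def using k a by (intro sum_pos) auto
  have w: "(\<Sum>j<k. a j / S) = 1" using S by (simp add: S_def flip: sum_divide_distrib)
  have "(\<Sum>j<k. a j * y j) = S * (\<Sum>j<k. (a j / S) *\<^sub>R y j)"
    using S by (simp add: sum_distrib_left)
  then have "(\<Sum>j<k. a j * y j) powr q = S powr q * (\<Sum>j<k. (a j / S) *\<^sub>R y j) powr q"
    by (simp only: powr_mult)
  also have "(\<Sum>j<k. (a j / S) *\<^sub>R y j) powr q \<le> (\<Sum>j<k. a j / S * y j powr q)"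
    by (rule convex_on_sum[OF _ _ powr_convex[OF q] w])
      (use k a y S in \<open>auto intro: divide_nonneg_pos less_imp_le\<close>)
  finally show ?thesis by (simp add: S_def mult_left_mono)
qed

subsection \<open>The randomized range finder\<close>

locale randomized_range = prob_space P for P :: "'w measure" +
  fixes D1 :: "'a::euclidean_space set" and N :: "'b measure"
    and F :: "('a \<Rightarrow> real) \<Rightarrow> ('b \<Rightarrow> real)" and \<sigma> lam :: "nat \<Rightarrow> real"
    and u :: "nat \<Rightarrow> 'b \<Rightarrow> real" and v \<psi> :: "nat \<Rightarrow> 'a \<Rightarrow> real" and K :: "'a \<Rightarrow> 'a \<Rightarrow> real"
    and \<omega> :: "nat \<Rightarrow> 'w \<Rightarrow> 'a \<Rightarrow> real" and k p :: nat
  assumes D1: "D1 \<in> sets lebesgue"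
    and hs: "hilbert_schmidt (lebesgue_on D1) N F"
    and svd: "is_svd (lebesgue_on D1) N F \<sigma> u v"
    and mercer: "mercer_expansion D1 K lam \<psi>"
    and k: "1 \<le> k" and p: "2 \<le> p"
    and iid: "iid_gaussian_processes P D1 K (k + p) \<omega>"
begin

abbreviation M where "M \<equiv> lebesgue_on D1"

abbreviation l where "l \<equiv> k + p"

sublocale hs_svd M N F \<sigma> u v by unfold_locales (fact hs, fact svd)

lemma mp: "i < l \<Longrightarrow> mercer_process P D1 K lam \<psi> (\<omega> i)"
  using iid by (intro mercer_process.intro mercer_process_axioms.intro prob_space_axioms D1 mercer)
    (simp add: iid_gaussian_processes_def)

sublocale mp0: mercer_process P D1 K lam \<psi> "\<omega> 0" by (rule mp) (use k in simp)

lemma \<omega>_L2: "i < l \<Longrightarrow> w \<in> space P \<Longrightarrow> \<omega> i w \<in> L2_space M"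
  by (rule mercer_process.X_L2[OF mp])

lemma basis_exists: "\<exists>e. L2_basis M e"
  using mp0.basis by blast

definition x :: "nat \<Rightarrow> nat \<Rightarrow> 'w \<Rightarrow> real" where
  "x m i w = L2_inner M (v m) (\<omega> i w)"

lemma x_measurable [measurable]: "i < l \<Longrightarrow> x m i \<in> borel_measurable P"
  unfolding x_def by (rule mercer_process.Z_measurable[OF mp v_L2])

lemma x_variance: "i < l \<Longrightarrow> integrable P (\<lambda>w. (x m i w)\<^sup>2) \<and> (\<integral>w. (x m i w)\<^sup>2 \<partial>P) = kernel_form D1 K (v m) (v m)"
  unfolding x_def L2_inner_self_eq[symmetric]
  by (intro conjI L2_space_integrable_sq mercer_process.Z_L2[OF mp v_L2]
      mercer_process.Z_covariance(1)[OF mp v_L2 v_L2])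

definition W :: "real mat" where
  "W = the (mat_inverse (kernel_matrix D1 K v k))"

definition B :: "(nat \<Rightarrow> real) \<Rightarrow> (nat \<Rightarrow> real) \<Rightarrow> real" where
  "B a b = (\<Sum>i<k. \<Sum>j<k. a i * kernel_form D1 K (v i) (v j) * b j)"

lemma B_kernel_form: "B a b = kernel_form D1 K (\<lambda>x. \<Sum>i<k. a i * v i x) (\<lambda>x. \<Sum>j<k. b j * v j x)"
  unfolding B_def by (rule mp0.kernel_form_lincomb[symmetric]) (rule v_L2)+

lemma B_pos:
  assumes "\<exists>i<k. a i \<noteq> 0"
  shows "0 < B a a"
proof -
  obtain i where i: "i < k" "a i \<noteq> 0" using assms by blast
  have "0 < (\<Sum>i<k. (a i)\<^sup>2)" using i by (intro sum_pos2[of _ i]) auto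
  then show ?thesis
    unfolding B_kernel_form
    by (intro mp0.kernel_form_pos L2_space_sum L2_space_scale v_L2)
      (simp add: L2_orthonormal_lincomb_sq[OF v_orthonormal])
qed

lemma kernel_matrix_eq: "kernel_matrix D1 K v k = mat k k (\<lambda>(i, j). kernel_form D1 K (v i) (v j))"
  by (simp add: kernel_matrix_def kernel_form_def)

lemma
  assumes "j < k"
  shows dim_W: "dim_row W = k" and W_pos: "0 < W $$ (j, j)"
    and whitening: "\<exists>m\<le>k - 1. \<exists>\<alpha>. (\<forall>p\<le>m. \<forall>q\<le>m. B (\<alpha> p) (\<alpha> q) = (if p = q then 1 else 0)) \<and>
      \<alpha> m j = sqrt (W $$ (j, j)) \<and>
      (\<forall>t<k - 1. \<exists>\<beta>. \<forall>i<k. (if i = skip j t then 1 else 0) = (\<Sum>q<m. \<beta> q * \<alpha> q i))"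
  unfolding W_def kernel_matrix_eq B_def
  by (rule whitening_exists[where C = "\<lambda>i j. kernel_form D1 K (v i) (v j)", OF
      mp0.kernel_form_commute[OF v_L2 v_L2] B_pos[unfolded B_def] assms]; assumption)+

definition trW :: real where "trW = (\<Sum>j<k. W $$ (j, j))"

lemma trW_pos: "0 < trW"
  unfolding trW_def using k W_pos by (intro sum_pos) (auto simp: lessThan_empty_iff)

lemma quality_factor_eq: "1 / quality_factor D1 K lam v k = lam 0 * trW / real k"
  using dim_W[of 0] k by (simp add: quality_factor_def mat_trace_def trW_def W_def[symmetric])

definition d :: "nat \<Rightarrow> 'w \<Rightarrow> real" where
  "d j w = span_dist_sq l (k - 1) (\<lambda>t i. x (skip j t) i w) (\<lambda>i. x j i w)"

lemma d_nonneg [simp]: "0 \<le> d j w"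
  by (simp add: d_def)

lemma d_measurable [measurable]: "d j \<in> borel_measurable P"
  unfolding d_def by (rule span_dist_sq_measurable) auto

text \<open>Whitening replaces the correlated rows by coordinates with identity covariance,
  independent across samples. The scaled distance \<open>W $$ (j, j) * d j w\<close> then dominates
  the distance of a standard Gaussian vector from at most k - 1 independent ones.\<close>

lemma d_Laplace:
  assumes j: "j < k" and s: "0 < s"
  shows "(\<integral>\<^sup>+w. ennreal (exp (- s * (W $$ (j, j) * d j w))) \<partial>P) \<le> ennreal ((1 + 2 * s) powr - ((real p + 1) / 2))"
proof -
  from whitening[OF j] obtain m \<alpha> where m: "m \<le> k - 1"
    and on: "\<forall>p\<le>m. \<forall>q\<le>m. B (\<alpha> p) (\<alpha> q) = (if p = q then 1 else 0)"
    and \<alpha>: "\<alpha> m j = sqrt (W $$ (j, j))"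
    and span: "\<forall>t<k - 1. \<exists>\<beta>. \<forall>i<k. (if i = skip j t then 1 else 0) = (\<Sum>q<m. \<beta> q * \<alpha> q i)"
    by (elim exE conjE)
  define f where "f q = (\<lambda>y. \<Sum>n<k. \<alpha> q n * v n y)" for q
  have f: "f q \<in> L2_space M" for q unfolding f_def by (intro L2_space_sum L2_space_scale v_L2)
  define Y where "Y i q w = (\<Sum>n<k. \<alpha> q n * x n i w)" for i q w
  have Yf: "Y i q w = L2_inner M (f q) (\<omega> i w)" if "i < l" "w \<in> space P" for i q w
    unfolding Y_def x_def f_def using \<omega>_L2[OF that] by (intro L2_inner_lincomb_left[symmetric] v_L2)
  have "(\<integral>\<^sup>+w. ennreal (exp (- s * (W $$ (j, j) * d j w))) \<partial>P)
      \<le> (\<integral>\<^sup>+w. ennreal (exp (- s * span_dist_sq l m (\<lambda>q i. Y i q w) (\<lambda>i. Y i m w))) \<partial>P)"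
  proof (intro nn_integral_mono ennreal_leI)
    fix w
    have "span_dist_sq l m (\<lambda>q i. Y i q w) (\<lambda>i. Y i m w) \<le> (\<alpha> m j)\<^sup>2 * d j w"
      unfolding Y_def d_def by (rule whitened_span_dist_le[OF j span])
    also have "(\<alpha> m j)\<^sup>2 = W $$ (j, j)" unfolding \<alpha> using W_pos[OF j] by simp
    finally show "exp (- s * (W $$ (j, j) * d j w)) \<le> exp (- s * span_dist_sq l m (\<lambda>q i. Y i q w) (\<lambda>i. Y i m w))"
      using s by (simp add: mult_left_mono)
  qed
  also have "\<dots> \<le> ennreal ((1 + 2 * s) powr (- real (p + 1) / 2))"
  proof (rule gaussian_span_dist_Laplace)
    show "Y i q \<in> borel_measurable P" if "i < l" for i q
      unfolding Y_def using that by measurable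
    \<comment> \<open>At most k - 1 of the k + p dimensions are used by the subspace, which leaves p
      + 1 degrees of freedom.\<close>
    show "m + (p + 1) \<le> l" using m k by simp
    fix t :: "nat \<Rightarrow> nat \<Rightarrow> real"
    define g where "g i = (\<lambda>y. \<Sum>q\<le>m. t i q * f q y)" for i
    have g: "g i \<in> L2_space M" for i unfolding g_def by (intro L2_space_sum L2_space_scale f)
    \<comment> \<open>Orthonormality of the coefficient vectors under \<open>B\<close> says exactly
      that the whitened functionals of one sample are uncorrelated with variance 1.\<close>
    have kf: "kernel_form D1 K (g i) (g i) = (\<Sum>q\<le>m. (t i q)\<^sup>2)" for i
    proof -
      have "kernel_form D1 K (g i) (g i) = (\<Sum>a\<le>m. \<Sum>b\<le>m. t i a * kernel_form D1 K (f a) (f b) * t i b)"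
        unfolding g_def by (rule mp0.kernel_form_lincomb) (rule f)+
      also have "\<dots> = (\<Sum>a\<le>m. \<Sum>b\<le>m. (t i a * t i b) * (if a = b then 1 else 0))"
        using on unfolding f_def B_kernel_form[symmetric] by (intro sum.cong refl) simp
      also have "\<dots> = (\<Sum>a\<le>m. (t i a)\<^sup>2)"
        by (intro sum.cong refl, subst sum_mult_delta) (auto simp: power2_eq_square)
      finally show ?thesis .
    qed
    have "(\<Sum>q\<le>m. t i q * Y i q w) = L2_inner M (g i) (\<omega> i w)" if "i < l" "w \<in> space P" for i w
      unfolding g_def using that by (subst L2_inner_lincomb_left[OF f \<omega>_L2]) (simp_all add: Yf)
    then have "(\<integral>w. iexp (\<Sum>i<l. \<Sum>q\<le>m. t i q * Y i q w) \<partial>P) = (\<integral>w. iexp (\<Sum>i<l. L2_inner M (g i) (\<omega> i w)) \<partial>P)"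
      by (intro Bochner_Integration.integral_cong refl) simp
    also have "\<dots> = exp (- (\<Sum>i<l. kernel_form D1 K (g i) (g i)) / 2)"
      by (rule iid_functionals_char[OF prob_space_axioms D1 mercer iid g])
    also have "\<dots> = exp (- (\<Sum>i<l. \<Sum>q\<le>m. (t i q)\<^sup>2) / 2)" by (simp only: kf)
    finally show "(\<integral>w. iexp (\<Sum>i<l. \<Sum>q\<le>m. t i q * Y i q w) \<partial>P) = exp (- (\<Sum>i<l. \<Sum>q\<le>m. (t i q)\<^sup>2) / 2)" .
  qed (rule s)
  also have "- real (p + 1) / 2 = - ((real p + 1) / 2)"
    by (simp only: of_nat_add of_nat_1 minus_divide_left)
  finally show ?thesis .
qed

lemma d_neg_moment:
  assumes j: "j < k" and a: "0 < a" "a < (real p + 1) / 2"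
  shows "(\<integral>\<^sup>+w. neg_power a (W $$ (j, j) * d j w) \<partial>P)
    \<le> ennreal (Gamma ((real p + 1) / 2 - a) / (2 powr a * Gamma ((real p + 1) / 2)))"
  by (rule neg_power_moment_le[OF _ _ _ d_Laplace[OF j] a])
    (use W_pos[OF j] in \<open>auto intro: sigma_finite_measure_axioms\<close>)

text \<open>\<open>neg_power\<close> is infinite at 0, so a finite inverse moment excludes distance
  0: the first \<open>k\<close> rows of the test matrix are almost surely linearly
  independent.\<close>

lemma d_pos_AE: "AE w in P. \<forall>j<k. 0 < d j w"
proof -
  have "AE w in P. 0 < d j w" if j: "j < k" for j
  proof -
    have "(\<integral>\<^sup>+w. neg_power 1 (W $$ (j, j) * d j w) \<partial>P) < \<infinity>"
      using d_neg_moment[OF j, of 1] p by (auto intro: le_less_trans)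
    then have "AE w in P. neg_power 1 (W $$ (j, j) * d j w) \<noteq> \<infinity>"
      by (intro nn_integral_noteq_infinite) auto
    then show ?thesis
    proof eventually_elim
      case (elim w)
      then have "\<not> W $$ (j, j) * d j w \<le> 0" by (auto simp: neg_power_def)
      then show ?case using W_pos[OF j] by (simp add: not_le zero_less_mult_iff)
    qed
  qed
  then have "\<forall>j\<in>{..<k}. AE w in P. 0 < d j w" by simp
  then have "AE w in P. \<forall>j\<in>{..<k}. 0 < d j w" by (subst AE_ball_countable) auto
  then show ?thesis by (auto elim!: eventually_mono)
qed

definition R :: "'w \<Rightarrow> real" where "R w = (\<Sum>j<k. 1 / d j w)"

definition A :: "'w \<Rightarrow> real" where "A w = (\<Sum>m. (\<sigma> (m + k))\<^sup>2 * (\<Sum>i<l. (x (m + k) i w)\<^sup>2))"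

definition \<tau>2 :: real where "\<tau>2 = (\<Sum>m. (\<sigma> (m + k))\<^sup>2)"

definition err :: "'w \<Rightarrow> real" where "err w = residual_norm l (\<lambda>i. \<omega> i w)"

lemma tail_summable: "summable (\<lambda>m. (\<sigma> (m + k))\<^sup>2)"
  using sigma_summable by (subst summable_iff_shift)

lemma \<tau>2_nonneg: "0 \<le> \<tau>2"
  unfolding \<tau>2_def by (rule suminf_nonneg[OF tail_summable]) simp

lemma A_summable: "w \<in> space P \<Longrightarrow> summable (\<lambda>m. (\<sigma> (m + k))\<^sup>2 * (\<Sum>i<l. (x (m + k) i w)\<^sup>2))"
  unfolding x_def by (rule tail_functional_summable[OF \<omega>_L2])

lemma A_nonneg: "w \<in> space P \<Longrightarrow> 0 \<le> A w"
  unfolding A_def by (intro suminf_nonneg A_summable) (auto intro!: mult_nonneg_nonneg sum_nonneg)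

lemma R_nonneg [simp]: "0 \<le> R w"
  by (simp add: R_def sum_nonneg)

lemma A_measurable [measurable]: "A \<in> borel_measurable P"
  unfolding A_def by measurable

lemma R_measurable [measurable]: "R \<in> borel_measurable P"
  unfolding R_def by measurable

lemma err_measurable [measurable]: "err \<in> borel_measurable P"
  unfolding err_def
  by (rule residual_norm_measurable[OF basis_exists]) (use \<omega>_L2 x_measurable[unfolded x_def] in auto)

lemma err_nonneg: "w \<in> space P \<Longrightarrow> 0 \<le> err w"
  unfolding err_def by (rule residual_norm_nonneg[OF basis_exists \<omega>_L2])

lemma err_bound: "AE w in P. err w \<le> sqrt (\<tau>2 + A w * R w)"
  using d_pos_AE AE_space
proof eventually_elim
  case (elim w)
  have "\<exists>T. (\<forall>m<k. \<forall>j<k. (\<Sum>i<l. x m i w * T i j) = (if m = j then 1 else 0)) \<and>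
      (\<Sum>i<l. \<Sum>j<k. (T i j)\<^sup>2) = R w"
    unfolding R_def d_def by (rule right_inverse_exists) (use elim(1) in \<open>simp add: d_def\<close>)
  then obtain T where T: "\<forall>m<k. \<forall>j<k. (\<Sum>i<l. x m i w * T i j) = (if m = j then 1 else 0)"
    and TR: "(\<Sum>i<l. \<Sum>j<k. (T i j)\<^sup>2) = R w"
    by (elim exE conjE)
  show ?case
    unfolding err_def \<tau>2_def A_def x_def TR[symmetric]
    by (rule residual_norm_bound[OF \<omega>_L2[OF _ elim(2)] T[unfolded x_def, rule_format] basis_exists])
qed

end

section \<open>Moments and tail bounds of the two factors\<close>

context randomized_range
begin

abbreviation tail_var :: "nat \<Rightarrow> real" where
  "tail_var m \<equiv> kernel_form D1 K (v m) (v m)"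

lemma tail_var_le: "tail_var m \<le> lam 0"
  using mp0.kernel_form_le[OF v_L2[of m]] by (simp add: L2_orthonormal_inner[OF v_orthonormal])

lemma tail_var_pos: "0 < tail_var m"
  by (rule mp0.kernel_form_pos[OF v_L2]) (simp add: L2_orthonormal_inner[OF v_orthonormal])

lemma W_nonneg: "j < k \<Longrightarrow> 0 \<le> W $$ (j, j)"
  by (rule less_imp_le[OF W_pos])

lemma A_ennreal:
  "w \<in> space P \<Longrightarrow> ennreal (A w) = (\<Sum>m. ennreal ((\<sigma> (m + k))\<^sup>2 * (\<Sum>i<l. (x (m + k) i w)\<^sup>2)))"
  unfolding A_def by (intro suminf_ennreal2[symmetric] A_summable) (auto intro!: mult_nonneg_nonneg sum_nonneg)

lemma A_nn_integral: "(\<integral>\<^sup>+w. ennreal (A w) \<partial>P) \<le> ennreal (real l * lam 0 * \<tau>2)"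
proof -
  have "(\<integral>\<^sup>+w. ennreal (A w) \<partial>P) = (\<integral>\<^sup>+w. (\<Sum>m. ennreal ((\<sigma> (m + k))\<^sup>2 * (\<Sum>i<l. (x (m + k) i w)\<^sup>2))) \<partial>P)"
    by (intro nn_integral_cong A_ennreal)
  also have "\<dots> = (\<Sum>m. \<integral>\<^sup>+w. ennreal ((\<sigma> (m + k))\<^sup>2 * (\<Sum>i<l. (x (m + k) i w)\<^sup>2)) \<partial>P)"
    by (intro nn_integral_suminf) measurable
  also have "\<dots> \<le> (\<Sum>m. ennreal ((\<sigma> (m + k))\<^sup>2 * (real l * lam 0)))"
  proof (intro suminf_le allI summableI)
    fix m
    have int: "integrable P (\<lambda>w. \<Sum>i<l. (x (m + k) i w)\<^sup>2)"
      using x_variance by (intro Bochner_Integration.integrable_sum) auto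
    have "(\<integral>w. (\<Sum>i<l. (x (m + k) i w)\<^sup>2) \<partial>P) = real l * tail_var (m + k)"
      using x_variance by (subst Bochner_Integration.integral_sum) auto
    also have "\<dots> \<le> real l * lam 0" by (intro mult_left_mono tail_var_le) simp
    finally have "(\<integral>w. (\<sigma> (m + k))\<^sup>2 * (\<Sum>i<l. (x (m + k) i w)\<^sup>2) \<partial>P) \<le> (\<sigma> (m + k))\<^sup>2 * (real l * lam 0)"
      by (simp add: mult_left_mono)
    moreover have "(\<integral>\<^sup>+w. ennreal ((\<sigma> (m + k))\<^sup>2 * (\<Sum>i<l. (x (m + k) i w)\<^sup>2)) \<partial>P)
        = ennreal (\<integral>w. (\<sigma> (m + k))\<^sup>2 * (\<Sum>i<l. (x (m + k) i w)\<^sup>2) \<partial>P)"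
      using int by (intro nn_integral_eq_integral) (auto intro!: mult_nonneg_nonneg sum_nonneg)
    ultimately show "(\<integral>\<^sup>+w. ennreal ((\<sigma> (m + k))\<^sup>2 * (\<Sum>i<l. (x (m + k) i w)\<^sup>2)) \<partial>P)
        \<le> ennreal ((\<sigma> (m + k))\<^sup>2 * (real l * lam 0))"
      by (simp only: ennreal_leI)
  qed
  also have "\<dots> = ennreal (\<Sum>m. (\<sigma> (m + k))\<^sup>2 * (real l * lam 0))"
    using mp0.lam_pos[of 0] by (intro suminf_ennreal2 summable_mult2 tail_summable) auto
  also have "(\<Sum>m. (\<sigma> (m + k))\<^sup>2 * (real l * lam 0)) = real l * lam 0 * \<tau>2"
    unfolding \<tau>2_def by (subst suminf_mult2[OF tail_summable, symmetric]) simp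
  finally show ?thesis .
qed

text \<open>An equality for positive distance. At distance 0 the left side is 0, since
  \<open>1 / 0 = 0\<close>, while \<open>neg_power\<close> is infinite.\<close>

lemma inverse_d_le:
  assumes j: "j < k"
  shows "ennreal (1 / d j w) \<le> ennreal (W $$ (j, j)) * neg_power 1 (W $$ (j, j) * d j w)"
proof (cases "d j w = 0")
  case False
  then have "0 < d j w" using d_nonneg[of j w] by linarith
  moreover note W_pos[OF j]
  ultimately show ?thesis
    by (simp add: neg_power_def not_le powr_minus_divide ennreal_mult'[symmetric] zero_less_mult_iff)
qed simp

lemma R_nn_integral: "(\<integral>\<^sup>+w. ennreal (R w) \<partial>P) \<le> ennreal (trW / (real p - 1))"
proof -
  have "(\<integral>\<^sup>+w. ennreal (R w) \<partial>P) \<le> (\<integral>\<^sup>+w. (\<Sum>j<k. ennreal (W $$ (j, j)) * neg_power 1 (W $$ (j, j) * d j w)) \<partial>P)"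
  proof (rule nn_integral_mono)
    fix w
    have "ennreal (R w) = (\<Sum>j<k. ennreal (1 / d j w))"
      unfolding R_def by (rule sum_ennreal[symmetric]) simp
    also have "\<dots> \<le> (\<Sum>j<k. ennreal (W $$ (j, j)) * neg_power 1 (W $$ (j, j) * d j w))"
      by (intro sum_mono inverse_d_le) simp
    finally show "ennreal (R w) \<le> (\<Sum>j<k. ennreal (W $$ (j, j)) * neg_power 1 (W $$ (j, j) * d j w))" .
  qed
  also have "\<dots> = (\<Sum>j<k. ennreal (W $$ (j, j)) * (\<integral>\<^sup>+w. neg_power 1 (W $$ (j, j) * d j w) \<partial>P))"
    by (subst nn_integral_sum) (auto simp: nn_integral_cmult)
  also have "\<dots> \<le> (\<Sum>j<k. ennreal (W $$ (j, j)) * ennreal (1 / (real p - 1)))"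
    using d_neg_moment[of _ 1] inverse_moment_constant[OF p] p by (intro sum_mono mult_left_mono) auto
  also have "\<dots> = (\<Sum>j<k. ennreal (W $$ (j, j) * (1 / (real p - 1))))"
    using p by (intro sum.cong refl ennreal_mult'[symmetric] W_nonneg) auto
  also have "\<dots> = ennreal (\<Sum>j<k. W $$ (j, j) * (1 / (real p - 1)))"
    using p by (intro sum_ennreal mult_nonneg_nonneg W_nonneg) auto
  also have "(\<Sum>j<k. W $$ (j, j) * (1 / (real p - 1))) = trW / (real p - 1)"
    by (simp add: trW_def sum_divide_distrib)
  finally show ?thesis .
qed

lemma integral_le_of_nn_integral:
  assumes f: "f \<in> borel_measurable P" "\<And>w. w \<in> space P \<Longrightarrow> 0 \<le> f w" and b: "0 \<le> b"
    and le: "(\<integral>\<^sup>+w. ennreal (f w) \<partial>P) \<le> ennreal b"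
  shows "integrable P f" "(\<integral>w. f w \<partial>P) \<le> b"
proof -
  show i: "integrable P f"
    using le f by (intro integrableI_nonneg) (auto intro: le_less_trans)
  have "ennreal (\<integral>w. f w \<partial>P) \<le> ennreal b"
    using le f by (subst nn_integral_eq_integral[OF i, symmetric]) auto
  then show "(\<integral>w. f w \<partial>P) \<le> b" using b by simp
qed

text \<open>sqrt(a + b) \<le> sqrt(a) + sqrt(b) separates the tail of the singular values from the
  product, and Cauchy-Schwarz bounds E sqrt(A R) by sqrt(E A) sqrt(E R) despite the dependence of
  the factors.\<close>

lemma err_expectation:
  "integrable P err \<and> (\<integral>w. err w \<partial>P) \<le> sqrt \<tau>2 + sqrt (real l * lam 0 * \<tau>2 * (trW / (real p - 1)))"
proof -
  have bA: "0 \<le> real l * lam 0 * \<tau>2" using mp0.lam_pos[of 0] \<tau>2_nonneg by simp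
  have bR: "0 \<le> trW / (real p - 1)" using trW_pos p by simp
  note A_int = integral_le_of_nn_integral[OF A_measurable A_nonneg bA A_nn_integral]
  note R_int = integral_le_of_nn_integral[OF R_measurable R_nonneg bR R_nn_integral]
  \<comment> \<open>The absolute value is harmless on \<open>space P\<close>, where \<open>A\<close>
    is known to be nonnegative, and makes \<open>f\<close> a square root of a nonnegative number
    everywhere.\<close>
  define f where "f w = sqrt (\<bar>A w\<bar>)" for w
  define g where "g w = sqrt (R w)" for w
  have [measurable]: "f \<in> borel_measurable P" "g \<in> borel_measurable P" unfolding f_def g_def by measurable
  have f: "f \<in> L2_space P" using A_int(1) by (intro L2_spaceI) (auto simp: f_def)
  have g: "g \<in> L2_space P" using R_int(1) by (intro L2_spaceI) (auto simp: g_def)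
  have ff: "L2_inner P f f \<le> real l * lam 0 * \<tau>2"
  proof -
    have "L2_inner P f f = (\<integral>w. A w \<partial>P)"
      unfolding L2_inner_self_eq f_def using A_nonneg by (intro Bochner_Integration.integral_cong) auto
    then show ?thesis using A_int(2) by simp
  qed
  have gg: "L2_inner P g g \<le> trW / (real p - 1)"
    using R_int(2) by (simp add: L2_inner_self_eq g_def)
  have fg: "(\<integral>w. f w * g w \<partial>P) \<le> sqrt (real l * lam 0 * \<tau>2 * (trW / (real p - 1)))"
  proof -
    have "(\<integral>w. f w * g w \<partial>P) \<le> sqrt (L2_inner P f f * L2_inner P g g)"
      using L2_Cauchy_Schwarz[OF f g] by (simp add: L2_inner_def L2_norm_def real_sqrt_mult)
    also have "\<dots> \<le> sqrt (real l * lam 0 * \<tau>2 * (trW / (real p - 1)))"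
      using ff gg bA by (intro real_sqrt_le_mono mult_mono) auto
    finally show ?thesis .
  qed
  have int: "integrable P (\<lambda>w. sqrt \<tau>2 + f w * g w)"
    using L2_space_integrable_mult[OF f g] by simp
  have le: "AE w in P. err w \<le> sqrt \<tau>2 + f w * g w"
    using err_bound AE_space
  proof eventually_elim
    case (elim w)
    have "sqrt (\<tau>2 + A w * R w) \<le> sqrt \<tau>2 + sqrt (A w * R w)"
      using \<tau>2_nonneg A_nonneg[OF elim(2)] by (intro sqrt_add_le_add_sqrt) auto
    also have "sqrt (A w * R w) = f w * g w"
      using A_nonneg[OF elim(2)] by (simp add: f_def g_def real_sqrt_mult)
    finally show ?case using elim(1) by linarith
  qed
  have ie: "integrable P err"
  proof (rule Bochner_Integration.integrable_bound[OF int err_measurable])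
    show "AE w in P. norm (err w) \<le> norm (sqrt \<tau>2 + f w * g w)"
      using le AE_space
    proof eventually_elim
      case (elim w)
      have "norm (err w) = err w" using err_nonneg[OF elim(2)] by simp
      also note elim(1)
      also have "sqrt \<tau>2 + f w * g w \<le> norm (sqrt \<tau>2 + f w * g w)" unfolding real_norm_def by (rule abs_ge_self)
      finally show ?case .
    qed
  qed
  have "(\<integral>w. err w \<partial>P) \<le> (\<integral>w. sqrt \<tau>2 + f w * g w \<partial>P)"
    by (rule integral_mono_AE[OF ie int le])
  also have "\<dots> = sqrt \<tau>2 + (\<integral>w. f w * g w \<partial>P)"
    using L2_space_integrable_mult[OF f g] by (simp add: prob_space)
  finally show ?thesis using ie fg by auto
qed

text \<open>A Chernoff bound. The factor is \<tau>^2 times a convex combination, with weights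
  \<sigma>_m^2 / \<tau>^2, of sums over the samples; Jensen's inequality for exp reduces its
  exponential moment to a single \<open>m\<close>. There the sum is a multiple of a chi-square
  variable with \<open>l\<close> degrees of freedom, of variance parameter at most
  \<open>lam 0\<close>, hence at most the trace. No independence between different \<open>m\<close>
  enters.\<close>

lemma A_tail:
  assumes s: "1 < s" and \<tau>: "0 < \<tau>2"
  shows "prob {w \<in> space P. real l * s\<^sup>2 * suminf lam * \<tau>2 < A w} \<le> (s * exp (- (s\<^sup>2 - 1) / 2)) ^ l"
proof -
  define \<Lambda> where "\<Lambda> = suminf lam"
  have lam_\<Lambda>: "lam 0 \<le> \<Lambda>"
    using sum_le_suminf[OF mp0.lam_summable, of "{0}"] mp0.lam_pos by (auto simp: \<Lambda>_def less_imp_le)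
  have \<Lambda>: "0 < \<Lambda>" using lam_\<Lambda> mp0.lam_pos[of 0] by linarith
  \<comment> \<open>The minimizer of the Chernoff bound for a chi-square variable scaled by
    \<open>\<Lambda> * \<tau>2\<close> at the threshold \<open>l * s\<close>^2 times that scale; it
    makes 1 - 2 \<theta> \<tau>2 \<Lambda> equal to 1/s^2.\<close>
  define \<theta> where "\<theta> = (1 - 1 / s\<^sup>2) / (2 * (\<Lambda> * \<tau>2))"
  have s2: "1 < s\<^sup>2" using s by (simp add: one_less_power)
  have "1 / s\<^sup>2 < 1" by (subst divide_less_eq_1_pos) (use s2 in linarith)+
  then have \<theta>: "0 < \<theta>" unfolding \<theta>_def using \<Lambda> \<tau> by (intro divide_pos_pos) auto
  have "2 * (a / (2 * (\<Lambda> * \<tau>2)) * \<tau>2 * \<Lambda>) = a" for a using \<Lambda> \<tau> by simp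
  then have \<theta>\<Lambda>: "1 - 2 * (\<theta> * \<tau>2 * \<Lambda>) = 1 / s\<^sup>2" by (simp only: \<theta>_def)
  define q where "q m = (\<sigma> (m + k))\<^sup>2 / \<tau>2" for m
  have q: "0 \<le> q m" for m using \<tau> by (simp add: q_def)
  have q1: "q sums 1"
    using sums_divide[OF summable_sums[OF tail_summable], of \<tau>2] \<tau> by (simp add: q_def[abs_def] \<tau>2_def[symmetric])
  define h where "h m w = \<theta> * \<tau>2 * (\<Sum>i<l. (x (m + k) i w)\<^sup>2)" for m w
  have h_measurable [measurable]: "h m \<in> borel_measurable P" for m unfolding h_def by measurable
  have qh: "q m * h m w = \<theta> * ((\<sigma> (m + k))\<^sup>2 * (\<Sum>i<l. (x (m + k) i w)\<^sup>2))" for m w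
    using \<tau> by (simp add: q_def h_def)
  have exp_A: "ennreal (exp (\<theta> * A w)) \<le> (\<Sum>m. ennreal (q m * exp (h m w)))" if w: "w \<in> space P" for w
  proof -
    have "summable (\<lambda>m. q m * h m w)" unfolding qh by (intro summable_mult A_summable w)
    from exp_suminf_le[OF q q1 this]
    show ?thesis unfolding qh A_def suminf_mult[OF A_summable[OF w], symmetric] .
  qed
  have exp_h: "(\<integral>\<^sup>+w. ennreal (exp (h m w)) \<partial>P) \<le> ennreal (s ^ l)" for m
  proof -
    define c where "c = tail_var (m + k)"
    have c: "0 < c" "c \<le> \<Lambda>" unfolding c_def using tail_var_pos tail_var_le[of "m + k"] lam_\<Lambda> by (auto intro: order_trans)
    define Y where "Y i w = x (m + k) i w / sqrt c" for i w
    \<comment> \<open>Negative, but above -1/2: an exponential moment is a Laplace transform at a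
      negative argument.\<close>
    define r where "r = - (\<theta> * \<tau>2 * c)"
    have "\<theta> * \<tau>2 * c \<le> \<theta> * \<tau>2 * \<Lambda>" using c \<theta> \<tau> by (intro mult_left_mono) auto
    then have r: "1 / s\<^sup>2 \<le> 1 + 2 * r" using \<theta>\<Lambda> by (simp add: r_def)
    have "0 < 1 / s\<^sup>2" using s by simp
    with r have r': "- 1 / 2 < r" by linarith
    have "h m w = - r * (\<Sum>i<l. (Y i w)\<^sup>2)" for w
      using c by (simp add: h_def r_def Y_def power_divide flip: sum_divide_distrib)
    then have "(\<integral>\<^sup>+w. ennreal (exp (h m w)) \<partial>P) = (\<integral>\<^sup>+w. ennreal (exp (- r * (\<Sum>i<l. (Y i w)\<^sup>2))) \<partial>P)"
      by simp
    also have "\<dots> = ennreal ((1 + 2 * r) powr (- real (card {..<l}) / 2))"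
    proof (rule nn_integral_gaussian_exp_sq[OF _ r'])
      show "Y i \<in> borel_measurable P" if "i \<in> {..<l}" for i unfolding Y_def using that by (intro borel_measurable_divide x_measurable borel_measurable_const) simp
      fix t :: "nat \<Rightarrow> real"
      have "t i * Y i w = L2_inner M (\<lambda>y. (t i / sqrt c) * v (m + k) y) (\<omega> i w)" for i w
        unfolding L2_inner_scale_left by (simp add: Y_def x_def)
      then have "(\<integral>w. iexp (\<Sum>i<l. t i * Y i w) \<partial>P) =
          (\<integral>w. iexp (\<Sum>i<l. L2_inner M (\<lambda>y. (t i / sqrt c) * v (m + k) y) (\<omega> i w)) \<partial>P)" by (simp only:)
      also have "\<dots> = exp (- (\<Sum>i<l. kernel_form D1 K (\<lambda>y. (t i / sqrt c) * v (m + k) y) (\<lambda>y. (t i / sqrt c) * v (m + k) y)) / 2)"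
        by (rule iid_functionals_char[OF prob_space_axioms D1 mercer iid]) (intro L2_space_scale v_L2)
      also have "\<dots> = exp (- (\<Sum>i<l. (t i)\<^sup>2) / 2)"
        unfolding kernel_form_scale c_def[symmetric] using c by (simp add: power2_eq_square)
      finally show "(\<integral>w. iexp (\<Sum>i<l. t i * Y i w) \<partial>P) = exp (- (\<Sum>i<l. (t i)\<^sup>2) / 2)" .
    qed simp
    also have "\<dots> \<le> ennreal ((1 / s\<^sup>2) powr (- real l / 2))"
      using r \<open>0 < 1 / s\<^sup>2\<close> by (intro ennreal_leI) (simp add: powr_mono2')
    also have "(1 / s\<^sup>2) powr (- real l / 2) = s ^ l"
    proof -
      have "1 / s\<^sup>2 = s powr (- 2)" using s by (simp add: powr_minus_divide)
      moreover have "- 2 * (- real l / 2) = real l" by simp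
      ultimately have "(1 / s\<^sup>2) powr (- real l / 2) = s powr real l" by (simp only: powr_powr)
      then show ?thesis using s by (simp only: powr_realpow)
    qed
    finally show ?thesis .
  qed
  have int: "(\<integral>\<^sup>+w. ennreal (exp (\<theta> * A w)) \<partial>P) \<le> ennreal (s ^ l)"
  proof -
    have "(\<integral>\<^sup>+w. ennreal (exp (\<theta> * A w)) \<partial>P) \<le> (\<integral>\<^sup>+w. (\<Sum>m. ennreal (q m * exp (h m w))) \<partial>P)"
      by (intro nn_integral_mono exp_A)
    also have "\<dots> = (\<Sum>m. \<integral>\<^sup>+w. ennreal (q m) * ennreal (exp (h m w)) \<partial>P)"
      using q by (subst nn_integral_suminf) (auto simp: ennreal_mult')
    also have "\<dots> = (\<Sum>m. ennreal (q m) * (\<integral>\<^sup>+w. ennreal (exp (h m w)) \<partial>P))"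
      by (intro suminf_cong nn_integral_cmult) measurable
    also have "\<dots> \<le> (\<Sum>m. ennreal (q m) * ennreal (s ^ l))"
      using exp_h by (intro suminf_le allI summableI mult_left_mono) auto
    also have "\<dots> = (\<Sum>m. ennreal (q m)) * ennreal (s ^ l)" by simp
    also have "(\<Sum>m. ennreal (q m)) = 1" using suminf_ennreal_eq[OF q q1] by simp
    finally show ?thesis by simp
  qed
  have "prob {w \<in> space P. real l * s\<^sup>2 * suminf lam * \<tau>2 < A w} \<le> s ^ l / exp (\<theta> * (real l * s\<^sup>2 * \<Lambda> * \<tau>2))"
    by (rule Markov_nn_integral[OF _ _ _ _ _ int])
      (use s \<theta> in \<open>auto simp: \<Lambda>_def intro!: AE_I2 ennreal_leI less_imp_le\<close>)
  also have "\<theta> * (real l * s\<^sup>2 * \<Lambda> * \<tau>2) = real l * ((s\<^sup>2 - 1) / 2)"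
    using \<Lambda> \<tau> s by (simp add: \<theta>_def field_simps)
  also have "s ^ l / exp (real l * ((s\<^sup>2 - 1) / 2)) = (s * exp (- (s\<^sup>2 - 1) / 2)) ^ l"
  proof -
    have "real l * (- (s\<^sup>2 - 1) / 2) = - (real l * ((s\<^sup>2 - 1) / 2))" by (simp only: minus_divide_left[symmetric] mult_minus_right)
    then have "exp (- (s\<^sup>2 - 1) / 2) ^ l = inverse (exp (real l * ((s\<^sup>2 - 1) / 2)))"
      by (simp only: exp_of_nat_mult[symmetric] exp_minus)
    then show ?thesis by (simp only: power_mult_distrib divide_inverse)
  qed
  finally show ?thesis .
qed

text \<open>Markov's inequality for \<open>R\<close> to the power p/2. Jensen's inequality with
  weights W_jj / Tr(W) reduces that power to the individual negative moments, so no information on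
  the joint law of the distances is used.\<close>

lemma R_tail:
  assumes t: "1 \<le> t"
  shows "prob {w \<in> space P. t\<^sup>2 * (3 * trW / (real p + 1)) < R w} \<le> t powr (- real p)"
proof -
  \<comment> \<open>The threshold carries t^2, so the power p/2 yields the decay t^-p; it is below
    (p + 1)/2, where the negative moments are finite.\<close>
  define q where "q = real p / 2"
  have q: "1 \<le> q" using p by (simp add: q_def)
  define G where "G w = ennreal (trW powr q) * (\<Sum>j<k. ennreal (W $$ (j, j) / trW) * neg_power q (W $$ (j, j) * d j w))" for w
  have G [measurable]: "G \<in> borel_measurable P" unfolding G_def by measurable
  define b where "b = trW powr q * (3 / (real p + 1)) powr q"
  have intG: "(\<integral>\<^sup>+w. G w \<partial>P) \<le> ennreal b"
  proof -
    have "(\<integral>\<^sup>+w. G w \<partial>P) = ennreal (trW powr q) *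
        (\<Sum>j<k. ennreal (W $$ (j, j) / trW) * (\<integral>\<^sup>+w. neg_power q (W $$ (j, j) * d j w) \<partial>P))"
      unfolding G_def by (subst nn_integral_cmult, simp, subst nn_integral_sum) (auto simp: nn_integral_cmult)
    also have "\<dots> \<le> ennreal (trW powr q) * (\<Sum>j<k. ennreal (W $$ (j, j) / trW) * ennreal ((3 / (real p + 1)) powr q))"
    proof (intro mult_left_mono sum_mono)
      fix j assume "j \<in> {..<k}"
      then have "(\<integral>\<^sup>+w. neg_power q (W $$ (j, j) * d j w) \<partial>P)
          \<le> ennreal (Gamma ((real p + 1) / 2 - q) / (2 powr q * Gamma ((real p + 1) / 2)))"
        using p by (intro d_neg_moment) (auto simp: q_def)
      also have "\<dots> \<le> ennreal ((3 / (real p + 1)) powr q)"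
        unfolding q_def by (intro ennreal_leI neg_moment_constant_le p)
      finally show "(\<integral>\<^sup>+w. neg_power q (W $$ (j, j) * d j w) \<partial>P) \<le> ennreal ((3 / (real p + 1)) powr q)" .
    qed auto
    also have "\<dots> = ennreal (trW powr q) * ((\<Sum>j<k. ennreal (W $$ (j, j) / trW)) * ennreal ((3 / (real p + 1)) powr q))"
      by (simp only: sum_distrib_right)
    also have "(\<Sum>j<k. ennreal (W $$ (j, j) / trW)) = ennreal (\<Sum>j<k. W $$ (j, j) / trW)"
      using W_pos trW_pos by (intro sum_ennreal) (auto intro: less_imp_le)
    also have "(\<Sum>j<k. W $$ (j, j) / trW) = 1"
      using trW_pos by (simp add: trW_def flip: sum_divide_distrib)
    finally show ?thesis by (simp add: b_def ennreal_mult')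
  qed
  define c where "c = t\<^sup>2 * (3 * trW / (real p + 1))"
  have c: "0 < c" using t trW_pos by (simp add: c_def)
  have "prob {w \<in> space P. c < R w} \<le> b / c powr q"
  proof (rule Markov_nn_integral[OF G _ _ _ _ intG])
    show "AE w in P. w \<in> {w \<in> space P. c < R w} \<longrightarrow> ennreal (c powr q) \<le> G w"
      using d_pos_AE
    proof eventually_elim
      case (elim w)
      have Wd: "0 < W $$ (j, j) * d j w" if "j < k" for j using W_pos[OF that] elim that by simp
      have "R w = (\<Sum>j<k. W $$ (j, j) * (1 / (W $$ (j, j) * d j w)))"
        unfolding R_def using W_pos by (intro sum.cong refl) (simp add: less_imp_neq[symmetric])
      then have "R w powr q \<le> trW powr q * (\<Sum>j<k. W $$ (j, j) / trW * (1 / (W $$ (j, j) * d j w)) powr q)"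
        unfolding trW_def using k W_pos Wd q by (simp only:) (intro powr_sum_le, auto)
      then have "ennreal (R w powr q) \<le> ennreal (trW powr q * (\<Sum>j<k. W $$ (j, j) / trW * (1 / (W $$ (j, j) * d j w)) powr q))"
        by (rule ennreal_leI)
      also have "\<dots> = ennreal (trW powr q) * (\<Sum>j<k. ennreal (W $$ (j, j) / trW * (1 / (W $$ (j, j) * d j w)) powr q))"
        using W_pos trW_pos by (subst sum_ennreal) (auto simp: ennreal_mult' W_nonneg intro!: mult_nonneg_nonneg divide_nonneg_nonneg)
      also have "\<dots> = G w"
      proof -
        have "ennreal (W $$ (j, j) / trW * (1 / (W $$ (j, j) * d j w)) powr q)
            = ennreal (W $$ (j, j) / trW) * neg_power q (W $$ (j, j) * d j w)" if "j < k" for j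
        proof -
          have "(1 / (W $$ (j, j) * d j w)) powr q = (W $$ (j, j) * d j w) powr - q"
            by (simp only: powr_divide powr_one_eq_one powr_minus_divide)
          moreover have "neg_power q (W $$ (j, j) * d j w) = ennreal ((W $$ (j, j) * d j w) powr - q)"
            using Wd[OF that] by (simp only: neg_power_def not_le[symmetric] if_False)
          moreover have "0 \<le> W $$ (j, j) / trW" using W_nonneg[OF that] trW_pos by simp
          ultimately show ?thesis by (simp only: ennreal_mult')
        qed
        then show ?thesis unfolding G_def by simp
      qed
      finally have "ennreal (R w powr q) \<le> G w" .
      moreover have "ennreal (c powr q) \<le> ennreal (R w powr q)" if "w \<in> {w \<in> space P. c < R w}"
        using that c q by (intro ennreal_leI powr_mono2) auto
      ultimately show ?case by (intro impI) (rule order_trans)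
    qed
  qed (use c in \<open>auto simp: b_def\<close>)
  also have "b / c powr q = t powr (- real p)"
  proof -
    have "c powr q = (t\<^sup>2) powr q * ((3 / (real p + 1)) powr q * trW powr q)"
      unfolding c_def by (simp add: powr_mult[symmetric])
    moreover have "(t\<^sup>2) powr q = t powr real p"
      using t by (simp add: q_def powr_powr flip: powr_numeral)
    ultimately show ?thesis using t trW_pos by (simp add: b_def powr_minus_divide)
  qed
  finally show ?thesis by (simp add: c_def)
qed

text \<open>Adds the degenerate cases of the Chernoff argument. At s = 1 the bound is 1; if the tail
  of singular values vanishes, then A is 0 and the strict event is empty.\<close>

lemma A_tail_ge_1:
  assumes s: "1 \<le> s"
  shows "prob {w \<in> space P. real l * s\<^sup>2 * suminf lam * \<tau>2 < A w} \<le> (s * exp (- (s\<^sup>2 - 1) / 2)) ^ l"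
proof -
  consider "s = 1" | "\<tau>2 = 0" | "1 < s" "0 < \<tau>2" using s \<tau>2_nonneg by linarith
  then show ?thesis
  proof cases
    case 1
    then show ?thesis by simp
  next
    case 2
    then have "\<sigma> (m + k) = 0" for m
      using suminf_eq_zero_iff[OF tail_summable] by (simp add: \<tau>2_def)
    then have empty: "{w \<in> space P. real l * s\<^sup>2 * suminf lam * \<tau>2 < A w} = {}" by (simp add: A_def 2)
    show ?thesis unfolding empty using s by simp
  qed (rule A_tail)
qed

text \<open>Outside both exceptional events and a null set the product of the factors is at most the
  product of the thresholds, so the failure event is covered by their union.\<close>

lemma err_tail:
  assumes s: "1 \<le> s" and t: "1 \<le> t"
  defines "b \<equiv> sqrt (\<tau>2 + real l * s\<^sup>2 * suminf lam * \<tau>2 * (t\<^sup>2 * (3 * trW / (real p + 1))))"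
  shows "1 - t powr (- real p) - (s * exp (- (s\<^sup>2 - 1) / 2)) ^ l \<le> prob {w \<in> space P. err w \<le> b}"
proof -
  define EA where "EA = {w \<in> space P. real l * s\<^sup>2 * suminf lam * \<tau>2 < A w}"
  define ER where "ER = {w \<in> space P. t\<^sup>2 * (3 * trW / (real p + 1)) < R w}"
  have [measurable]: "EA \<in> events" "ER \<in> events" unfolding EA_def ER_def by measurable
  have G: "{w \<in> space P. err w \<le> b} \<in> events" by measurable
  have "AE w in P. w \<in> space P - {w \<in> space P. err w \<le> b} \<longrightarrow> w \<in> EA \<union> ER"
    using err_bound AE_space
  proof eventually_elim
    case (elim w)
    show ?case
    proof (rule impI, rule ccontr)
      assume w: "w \<in> space P - {w \<in> space P. err w \<le> b}" and "w \<notin> EA \<union> ER"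
      then have "A w \<le> real l * s\<^sup>2 * suminf lam * \<tau>2" "R w \<le> t\<^sup>2 * (3 * trW / (real p + 1))"
        using elim(2) by (auto simp: EA_def ER_def not_less)
      then have "A w * R w \<le> real l * s\<^sup>2 * suminf lam * \<tau>2 * (t\<^sup>2 * (3 * trW / (real p + 1)))"
        using A_nonneg[OF elim(2)] by (intro mult_mono) auto
      then have "err w \<le> b" unfolding b_def by (intro order_trans[OF elim(1)] real_sqrt_le_mono add_left_mono)
      with w elim(2) show False by simp
    qed
  qed
  then have "prob (space P - {w \<in> space P. err w \<le> b}) \<le> prob (EA \<union> ER)"
    by (rule finite_measure_mono_AE) simp
  also have "\<dots> \<le> prob EA + prob ER" by (rule measure_Un_le) simp_all
  also have "\<dots> \<le> (s * exp (- (s\<^sup>2 - 1) / 2)) ^ l + t powr (- real p)"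
    unfolding EA_def ER_def by (intro add_mono A_tail_ge_1 R_tail s t)
  finally show ?thesis using prob_compl[OF G] by simp
qed

end

section \<open>Both bounds in terms of the quality factor\<close>

theorem theorem2p1:
  fixes D1 D2 :: "(real ^ 'd) set"
    and F :: "(real ^ 'd \<Rightarrow> real) \<Rightarrow> (real ^ 'd \<Rightarrow> real)"
    and \<sigma> lam :: "nat \<Rightarrow> real"
    and u v \<psi> :: "nat \<Rightarrow> real ^ 'd \<Rightarrow> real"
    and K :: "real ^ 'd \<Rightarrow> real ^ 'd \<Rightarrow> real"
    and P :: "'w measure"
    and \<omega> :: "nat \<Rightarrow> 'w \<Rightarrow> real ^ 'd \<Rightarrow> real"
    and k p :: nat
    and err :: "'w \<Rightarrow> real" and \<gamma> :: real
  assumes D1: "open D1" "connected D1" "D1 \<noteq> {}"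
    and D2: "open D2" "connected D2" "D2 \<noteq> {}"
    and F: "hilbert_schmidt (lebesgue_on D1) (lebesgue_on D2) F"
    and svd: "is_svd (lebesgue_on D1) (lebesgue_on D2) F \<sigma> u v"
    and K_cont: "continuous_on (D1 \<times> D1) (\<lambda>(x, y). K x y)"
    and K_spd: "sym_pos_def_kernel D1 K"
    and mercer: "mercer_expansion D1 K lam \<psi>"
    and k: "k \<ge> 1" and p: "p \<ge> 2"
    and P: "prob_space P"
    and \<omega>: "iid_gaussian_processes P D1 K (k + p) \<omega>"
  defines "err \<equiv> (\<lambda>w. hs_norm (lebesgue_on D1) (lebesgue_on D2)
                    (range_residual (lebesgue_on D2) F (k + p) (\<lambda>i. F (\<omega> i w))))"
    and "\<gamma> \<equiv> quality_factor D1 K lam v k"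
  shows "(integrable P err \<and>
          (\<integral>w. err w \<partial>P) \<le>
            (1 + sqrt (1 / \<gamma> * (real k * real (k + p) / (real p - 1)))) *
            sqrt (\<Sum>j. (\<sigma> (j + k))\<^sup>2)) \<and>
         (p \<ge> 4 \<longrightarrow> (\<forall>s t :: real. s \<ge> 1 \<and> t \<ge> 1 \<longrightarrow>
          measure P {w \<in> space P. err w \<le>
              sqrt (1 + t\<^sup>2 * s\<^sup>2 * (3 / \<gamma>) * (real k * real (k + p) / (real p + 1)) *
                        (\<Sum>j. lam j / lam 0)) *
              sqrt (\<Sum>j. (\<sigma> (j + k))\<^sup>2)}
            \<ge> 1 - t powr (- real p) - (s * exp (- (s\<^sup>2 - 1) / 2)) ^ (k + p)))"
proof -
  interpret rr: randomized_range P D1 "lebesgue_on D2" F \<sigma> lam u v \<psi> K \<omega> k p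
    by (intro randomized_range.intro randomized_range_axioms.intro P F svd mercer k p \<omega>)
      (use D1 in simp)
  have err_eq: "err = rr.err"
    unfolding err_def rr.err_def[abs_def] rr.residual_norm_def ..
  \<comment> \<open>The quality factor enters both bounds only through its reciprocal, in which
    \<open>k\<close> cancels against the numerator of k (k + p).\<close>
  have \<gamma>_eq: "1 / \<gamma> = lam 0 * rr.trW / real k"
    unfolding \<gamma>_def by (rule rr.quality_factor_eq)
  have lam0: "0 < lam 0" by (rule rr.mp0.lam_pos)
  have k0: "0 < real k" using k by simp
  have eq: "rr.\<tau>2 * (1 / \<gamma> * (real k * real (k + p) / (real p - 1)))
      = real (k + p) * lam 0 * rr.\<tau>2 * (rr.trW / (real p - 1))"
    unfolding \<gamma>_eq using k0 by simp
  have sq: "sqrt (real (k + p) * lam 0 * rr.\<tau>2 * (rr.trW / (real p - 1)))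
      = sqrt rr.\<tau>2 * sqrt (1 / \<gamma> * (real k * real (k + p) / (real p - 1)))"
    unfolding eq[symmetric] by (rule real_sqrt_mult)
  have "sqrt rr.\<tau>2 + sqrt (real (k + p) * lam 0 * rr.\<tau>2 * (rr.trW / (real p - 1)))
      = (1 + sqrt (1 / \<gamma> * (real k * real (k + p) / (real p - 1)))) * sqrt rr.\<tau>2"
    unfolding sq distrib_right mult_1 by (simp only: mult.commute)
  with rr.err_expectation have expectation: "integrable P err \<and> (\<integral>w. err w \<partial>P) \<le>
      (1 + sqrt (1 / \<gamma> * (real k * real (k + p) / (real p - 1)))) * sqrt (\<Sum>j. (\<sigma> (j + k))\<^sup>2)"
    unfolding err_eq rr.\<tau>2_def[symmetric] by (simp only:)
  have tail: "1 - t powr (- real p) - (s * exp (- (s\<^sup>2 - 1) / 2)) ^ (k + p) \<le> measure P {w \<in> space P. err w \<le>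
      sqrt (1 + t\<^sup>2 * s\<^sup>2 * (3 / \<gamma>) * (real k * real (k + p) / (real p + 1)) * (\<Sum>j. lam j / lam 0)) *
      sqrt (\<Sum>j. (\<sigma> (j + k))\<^sup>2)}" if "1 \<le> s" "1 \<le> t" for s t
  proof -
    \<comment> \<open>Stated for arbitrary reals so that \<open>field_simps\<close> meets variables
      only: \<open>k\<close> cancels, and the \<open>lam 0\<close> in the reciprocal of \<gamma>
      cancels the one dividing the eigenvalue sum.\<close>
    have algebra: "(1 + T * S * (3 * (a * w / kk)) * (kk * L / y) * (\<Lambda> / a)) * \<tau> = \<tau> + L * S * \<Lambda> * \<tau> * (T * (3 * w / y))"
      if "kk \<noteq> 0" "a \<noteq> 0" "y \<noteq> 0" for T S a w kk L y \<Lambda> \<tau> :: real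
      using that by (simp add: field_simps)
    have lam_sum: "(\<Sum>j. lam j / lam 0) = suminf lam / lam 0"
      by (rule suminf_divide[OF rr.mp0.lam_summable])
    have three: "3 / \<gamma> = 3 * (lam 0 * rr.trW / real k)" unfolding \<gamma>_eq[symmetric] by simp
    have "(1 + t\<^sup>2 * s\<^sup>2 * (3 / \<gamma>) * (real k * real (k + p) / (real p + 1)) * (\<Sum>j. lam j / lam 0)) * rr.\<tau>2
        = rr.\<tau>2 + real (k + p) * s\<^sup>2 * suminf lam * rr.\<tau>2 * (t\<^sup>2 * (3 * rr.trW / (real p + 1)))"
      unfolding lam_sum three by (rule algebra) (use k0 lam0 in simp_all)
    then show ?thesis
      using rr.err_tail[OF that] unfolding err_eq rr.\<tau>2_def[symmetric] real_sqrt_mult[symmetric] by (simp only:)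
  qed
  show ?thesis using expectation tail by blast
qed

end
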